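(* Let $\bullet$ be nothing, "$\leq 1$", or "$1$". For every topological space $X$, let $\lambda^\sharp_X \colon \mathbf V_\bullet \mathcal Q_{\mathsf V} X \to \mathcal Q_{\mathsf V}\mathbf V_\bullet X$ be the map $$\lambda^\sharp_X(\mu) = \{\nu \in \mathbf V_\bullet X \mid \nu(U) \geq \mu(\Box U) \text{ for every open subset } U \text{ of } X\}.$$ Then $\lambda^\sharp = (\lambda^\sharp_X)_X$ is a weak distributive law of the monad $\mathcal Q_{\mathsf V}$ over the monad $\mathbf V_\bullet$ on the category $\mathbf{Top}$ of topological spaces and continuous maps.
   Context: Weak distributive law. Let $(S,\eta^S,\mu^S)$ and $(T,\eta^T,\mu^T)$ be monads on a category. A weak distributive law of $S$ over $T$ is a natural transformation $\lambda\colon TS\to ST$ such that, for every object $X$: (i) $\lambda_X\circ T\eta^S_X=\eta^S_{TX}$; (ii) $\lambda_X\circ T\mu^S_X=\mu^S_{TX}\circ S\lambda_X\circ\lambda_{SX}$; (iii) $\lambda_X\circ\mu^T_{SX}=S\mu^T_X\circ\lambda_{TX}\circ T\lambda_X$. (Compatibility with $\eta^T$ is not required.) Continuous valuations. $\overline{\mathbb R}_+=[0,\infty]$ has the Scott topology (opens: $\emptyset$, the whole set, and $]t,\infty]$, $t\in\mathbb R_+=[0,\infty[$). $\mathcal O X$ is the lattice of open subsets of $X$. A continuous valuation on $X$ is a map $\nu\colon\mathcal O X\to\overline{\mathbb R}_+$ with $\nu(\emptyset)=0$, $\nu(U)+\nu(V)=\nu(U\cup V)+\nu(U\cap V)$,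 and which is Scott-continuous (monotone and preserving directed suprema). $\mathbf V X$ is the space of all continuous valuations on $X$, with the topology generated by the sets $[U>r]=\{\nu\mid\nu(U)>r\}$, $U\in\mathcal O X$, $r\in\mathbb R_+$; $\mathbf V_{\leq1}X$ and $\mathbf V_1X$ are the subspaces of those with $\nu(X)\leq1$, resp. $\nu(X)=1$. $\mathbf V_\bullet$ denotes any of these, according to $\bullet$. For continuous $h\colon X\to\overline{\mathbb R}_+$, $\int_{x\in X}h(x)\,d\nu=\int_0^\infty\nu(h^{-1}(]t,\infty]))\,dt$. $\mathbf V_\bullet$ is a monad on $\mathbf{Top}$: $\mathbf V_\bullet f(\nu)(V)=\nu(f^{-1}(V))$; the unit $\eta_X$ maps $x$ to the Dirac valuation $\delta_x$; the multiplication is $\mu_X(\xi)(U)=\int_{\nu\in\mathbf V_\bullet X}\nu(U)\,d\xi$. The monad $\mathcal Q_{\mathsf V}$. The specialization preordering of a space is: $x\leq y$ iff every open neighborhood of $x$ contains $y$; $\uparrow A$ is the upward closure of $A$. A subset is saturated if it is upwards closed; compactness assumes no separation. $\mathcal Q_{\mathsf V}X$ is the set of non-empty compact saturated subsets of $X$, with the topology with basic open sets $\Box U=\{Q\mid Q\subseteq U\}$, $U\in\mathcal O X$. It is a monad on $\mathbf{Top}$: $\mathcal Q_{\mathsf V}f(Q)=\uparrow f[Q]$, unit $x\mapsto\uparrow x$, multiplication $\mathcal Q'\mapsto\bigcup\mathcal Q'$. *)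

theory Defs
  imports "HOL-Analysis.Analysis"
begin

section \<open>The specialization preordering and the monad \<open>Q\<^sub>V\<close>\<close>

definition specialization_le :: "'a topology \<Rightarrow> 'a \<Rightarrow> 'a \<Rightarrow> bool" where
  "specialization_le X x y \<longleftrightarrow>
     x \<in> topspace X \<and> y \<in> topspace X \<and> (\<forall>U. openin X U \<and> x \<in> U \<longrightarrow> y \<in> U)"

definition up_closure :: "'a topology \<Rightarrow> 'a set \<Rightarrow> 'a set" where
  "up_closure X A = {y. \<exists>x\<in>A. specialization_le X x y}"

definition saturated_in :: "'a topology \<Rightarrow> 'a set \<Rightarrow> bool" where
  "saturated_in X A \<longleftrightarrow>
     A \<subseteq> topspace X \<and> (\<forall>x y. x \<in> A \<and> specialization_le X x y \<longrightarrow> y \<in> A)"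

definition Q_carrier :: "'a topology \<Rightarrow> 'a set set" where
  "Q_carrier X = {Q. Q \<noteq> {} \<and> compactin X Q \<and> saturated_in X Q}"

definition Q_box :: "'a topology \<Rightarrow> 'a set \<Rightarrow> 'a set set" where
  "Q_box X U = {Q \<in> Q_carrier X. Q \<subseteq> U}"

definition Q_space :: "'a topology \<Rightarrow> 'a set topology" where
  "Q_space X = topology_generated_by {Q_box X U | U. openin X U}"

text \<open>
  The functors need the target space (and \<open>V_map\<close> below also the source space) of
  the morphism as an argument.
\<close>

definition Q_map :: "'b topology \<Rightarrow> ('a \<Rightarrow> 'b) \<Rightarrow> 'a set \<Rightarrow> 'b set" where
  "Q_map Y f Q = up_closure Y (f ` Q)"

definition Q_unit :: "'a topology \<Rightarrow> 'a \<Rightarrow> 'a set" where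
  "Q_unit X x = up_closure X {x}"

definition Q_mult :: "'a set set \<Rightarrow> 'a set" where
  "Q_mult Q' = \<Union>Q'"

lemma topspace_Q_space [simp]: "topspace (Q_space X) = Q_carrier X"
proof -
  have "Q_box X (topspace X) = Q_carrier X"
    by (auto simp: Q_box_def Q_carrier_def saturated_in_def)
  then have "Q_carrier X \<in> {Q_box X U | U. openin X U}"
    by (metis (mono_tags, lifting) mem_Collect_eq openin_topspace)
  then show ?thesis
    unfolding Q_space_def topology_generated_by_topspace
    by (auto simp: Q_box_def)
qed

section \<open>Continuous valuations and the monads \<open>V\<close>\<close>

text \<open>
  A valuation is only defined on open sets. To make functional equality the equality of
  valuations, its values elsewhere are fixed (to \<open>undefined\<close>) by \<open>extensional\<close>, and
  valuations are built with \<open>restrict\<close>.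
\<close>

definition continuous_valuation :: "'a topology \<Rightarrow> ('a set \<Rightarrow> ennreal) \<Rightarrow> bool" where
  "continuous_valuation X \<nu> \<longleftrightarrow>
     \<nu> \<in> extensional {U. openin X U} \<and>
     \<nu> {} = 0 \<and>
     (\<forall>U V. openin X U \<and> openin X V \<longrightarrow> \<nu> U + \<nu> V = \<nu> (U \<union> V) + \<nu> (U \<inter> V)) \<and>
     (\<forall>U V. openin X U \<and> openin X V \<and> U \<subseteq> V \<longrightarrow> \<nu> U \<le> \<nu> V) \<and>
     (\<forall>D. D \<noteq> {} \<and> (\<forall>U\<in>D. openin X U) \<and> (\<forall>U\<in>D. \<forall>V\<in>D. \<exists>W\<in>D. U \<subseteq> W \<and> V \<subseteq> W)
        \<longrightarrow> \<nu> (\<Union>D) = (SUP U\<in>D. \<nu> U))"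

text \<open>
  The whole set of valuations is added to the generating family because the sets
  \<open>[U > r]\<close> never contain the zero valuation, while the topology generated by a family
  in \<^const>\<open>topology_generated_by\<close> has the union of that family as its carrier.
\<close>

definition V_all :: "'a topology \<Rightarrow> ('a set \<Rightarrow> ennreal) topology" where
  "V_all X = topology_generated_by
     (insert {\<nu>. continuous_valuation X \<nu>}
        {{\<nu>. continuous_valuation X \<nu> \<and> \<nu> U > ennreal r} | U r. openin X U \<and> 0 \<le> (r::real)})"

datatype valuation_kind = Any | Subprobability | Probability

fun has_kind :: "valuation_kind \<Rightarrow> 'a topology \<Rightarrow> ('a set \<Rightarrow> ennreal) \<Rightarrow> bool" where
  "has_kind Any X \<nu> \<longleftrightarrow> True"
| "has_kind Subprobability X \<nu> \<longleftrightarrow> \<nu> (topspace X) \<le> 1"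
| "has_kind Probability X \<nu> \<longleftrightarrow> \<nu> (topspace X) = 1"

definition V_space :: "valuation_kind \<Rightarrow> 'a topology \<Rightarrow> ('a set \<Rightarrow> ennreal) topology" where
  "V_space k X = subtopology (V_all X) {\<nu>. has_kind k X \<nu>}"

text \<open>
  The integrand below is antitone in \<open>t\<close>, so its Lebesgue integral is its (improper)
  Riemann integral.
\<close>

definition val_integral :: "'a topology \<Rightarrow> ('a set \<Rightarrow> ennreal) \<Rightarrow> ('a \<Rightarrow> ennreal) \<Rightarrow> ennreal" where
  "val_integral X \<nu> h = (\<integral>\<^sup>+t\<in>{0..}. \<nu> {x \<in> topspace X. h x > ennreal t} \<partial>lborel)"

definition V_map ::
    "'a topology \<Rightarrow> 'b topology \<Rightarrow> ('a \<Rightarrow> 'b) \<Rightarrow> ('a set \<Rightarrow> ennreal) \<Rightarrow> ('b set \<Rightarrow> ennreal)" where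
  "V_map X Y f \<nu> = (\<lambda>V\<in>{V. openin Y V}. \<nu> {x \<in> topspace X. f x \<in> V})"

definition V_unit :: "'a topology \<Rightarrow> 'a \<Rightarrow> 'a set \<Rightarrow> ennreal" where
  "V_unit X x = (\<lambda>U\<in>{U. openin X U}. if x \<in> U then 1 else 0)"

definition V_mult ::
    "valuation_kind \<Rightarrow> 'a topology \<Rightarrow> (('a set \<Rightarrow> ennreal) set \<Rightarrow> ennreal) \<Rightarrow> 'a set \<Rightarrow> ennreal" where
  "V_mult k X \<xi> = (\<lambda>U\<in>{U. openin X U}. val_integral (V_space k X) \<xi> (\<lambda>\<nu>. \<nu> U))"

lemma topspace_V_space [simp]:
  "topspace (V_space k X) = {\<nu>. continuous_valuation X \<nu> \<and> has_kind k X \<nu>}"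
proof -
  have "topspace (V_all X) = {\<nu>. continuous_valuation X \<nu>}"
    unfolding V_all_def topology_generated_by_topspace by auto
  then show ?thesis
    by (auto simp: V_space_def)
qed

section \<open>The map \<open>\<lambda>\<^sup>\<sharp>\<close>\<close>

definition lambda_sharp ::
    "valuation_kind \<Rightarrow> 'a topology \<Rightarrow> ('a set set \<Rightarrow> ennreal) \<Rightarrow> ('a set \<Rightarrow> ennreal) set" where
  "lambda_sharp k X \<mu> =
     {\<nu> \<in> topspace (V_space k X). \<forall>U. openin X U \<longrightarrow> \<nu> U \<ge> \<mu> (Q_box X U)}"

text \<open>
  A weak distributive law of \<open>S\<close> over \<open>T\<close> quantifies over functors and over all spaces,
  hence over types, so it is not a single HOL predicate. It is stated with the type
  variables of the points of the spaces left free, as the conjunction of: \<open>\<lambda>\<^sub>X\<close> is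
  a morphism \<open>T S X \<rightarrow> S T X\<close>; naturality with respect to all continuous \<open>f\<close> from
  \<open>X\<close> to \<open>Y\<close>; and the laws for \<open>\<eta>\<^sup>S\<close>, \<open>\<mu>\<^sup>S\<close> and \<open>\<mu>\<^sup>T\<close>, as
  equalities of functions on the carrier of the source space. Here \<open>S\<close> is \<open>Q\<close>
  and \<open>T\<close> is \<open>V\<close>.
\<close>

end

theory Submission
  imports Defs
begin

text \<open>
  A continuous valuation \<open>\<mu>\<close> on \<open>Q X\<close> induces the capacity \<open>U \<mapsto> \<mu> (\<box>U)\<close> on \<open>X\<close>, and
  \<open>\<lambda>\<^sup>\<sharp> \<mu>\<close> is the set of valuations above it. Integrating \<open>Q \<mapsto> min h on Q\<close> against \<open>\<mu>\<close>
  extends the capacity to a functional on lower semicontinuous functions \<open>h\<close> (called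
  \<open>lower_integral\<close> below). It is superlinear and, because the sets \<open>Q\<close> are compact,
  Scott-continuous; and \<open>\<nu>\<close> lies above the capacity iff its integral lies above this
  functional. So each part of the theorem asks for linear Scott-continuous functionals above a
  given superlinear one and below prescribed bounds.

  They come from a theorem of Hahn-Banach type (\<open>sandwich\<close>): between a superlinear
  Scott-continuous \<open>q\<close> and a sublinear \<open>p\<close> with \<open>q \<le> p\<close> there is a linear Scott-continuous
  functional. Any sublinear functional that is minimal above \<open>q\<close> has these properties: it is
  Scott-continuous since its Scott-continuous envelope is again sublinear, and superadditive
  by an explicit formula in terms of \<open>q\<close>. Since linear Scott-continuous functionals are
  integrals of continuous valuations (\<open>val_integral_valuation_of\<close>), this yields the key result
  \<open>exists_selection_with_constraints\<close>: a convex cone of constraints \<open>\<integral> e d\<nu> \<le> w\<close> can be met by some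
  \<open>\<nu>\<close> in \<open>\<lambda>\<^sup>\<sharp> \<mu>\<close> as soon as the lower integral meets each of them.

  Compactness and continuity. If the sets \<open>[U > r]\<close>, for \<open>(U, r)\<close> in \<open>B\<close>, cover \<open>\<lambda>\<^sup>\<sharp> \<mu>\<close>, then no
  member of \<open>\<lambda>\<^sup>\<sharp> \<mu>\<close> satisfies all constraints \<open>\<nu> U \<le> r\<close>, so the lower integral violates a
  positive combination of them. This combination uses finitely many elements of \<open>B\<close>, and
  violating it is an open condition on \<open>\<mu>\<close>. Hence finitely many of the sets still cover
  \<open>\<lambda>\<^sup>\<sharp> \<mu>'\<close> for all \<open>\<mu>'\<close> near \<open>\<mu>\<close> (\<open>lambda_sharp_covering_persists\<close>), from which both claims
  follow by general topology.

  The equations. The unit law is a computation. In the three others, one inclusion compares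
  values on open sets; for the other one, a valuation \<open>\<nu>\<close> is given and a member \<open>\<nu>'\<close> of some
  \<open>\<lambda>\<^sup>\<sharp>\<close> has to be found with \<open>\<integral> T g d\<nu>' \<le> \<integral> g d\<nu>\<close> for all \<open>g\<close>, where \<open>T g\<close> is \<open>g \<circ> f\<close> for
  naturality, \<open>Q \<mapsto> min g on Q\<close> for the multiplication of \<open>Q\<close>, and \<open>\<rho> \<mapsto> \<integral> g d\<rho>\<close> for that of
  \<open>V\<close>. All three are instances of \<open>exists_selection_below\<close>.
\<close>

section \<open>Suprema, infima and sums in the extended nonnegative reals\<close>

lemma ennreal_inverse_pos_finite:
  fixes a :: ennreal
  assumes "0 < a" "a < top"
  shows "0 < inverse a" "inverse a < top" "a * (inverse a * b) = b" "inverse a * (a * b) = b"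
proof -
  have 1: "a * inverse a = 1"
    using assms by (metis divide_ennreal_def ennreal_divide_self less_irrefl)
  show "0 < inverse a" "inverse a < top"
    using assms by (auto simp: ennreal_inverse_positive less_top[symmetric] ennreal_inverse_eq_top_iff)
  show "a * (inverse a * b) = b" "inverse a * (a * b) = b"
    using 1 by (simp_all add: mult.assoc[symmetric] mult.commute[of "inverse a" a])
qed

lemma inverse_mult_le_iff:
  fixes a x y :: ennreal
  assumes "0 < a" "a < top"
  shows "inverse a * x \<le> y \<longleftrightarrow> x \<le> a * y"
  using mult_left_mono[of "inverse a * x" y a] mult_left_mono[of x "a * y" "inverse a"]
  by (auto simp: ennreal_inverse_pos_finite[OF assms])

lemma INF_add_const_ennreal:
  fixes c :: ennreal
  shows "I \<noteq> {} \<Longrightarrow> (INF i\<in>I. f i + c) = (INF i\<in>I. f i) + c"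
  using continuous_at_Inf_mono[of "\<lambda>x. x + c" "f ` I"]
  using continuous_add[of "at_right (Inf (f ` I))", of "\<lambda>x. x" "\<lambda>x. c"]
  by (auto simp: mono_def image_comp)

lemma SUP_add_SUP_ennreal:
  fixes f :: "'i \<Rightarrow> ennreal"
  assumes "I \<noteq> {}" "J \<noteq> {}"
  shows "(SUP i\<in>I. f i) + (SUP j\<in>J. g j) = (SUP i\<in>I. SUP j\<in>J. f i + g j)"
proof -
  have "(SUP i\<in>I. f i) + (SUP j\<in>J. g j) = (SUP i\<in>I. f i + (SUP j\<in>J. g j))"
    by (rule ennreal_SUP_add_left[OF assms(1), symmetric])
  then show ?thesis
    by (simp add: ennreal_SUP_add_right[OF assms(2)])
qed

lemma INF_const_add_ennreal:
  fixes c :: ennreal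
  shows "I \<noteq> {} \<Longrightarrow> (INF i\<in>I. c + f i) = c + (INF i\<in>I. f i)"
  using INF_add_const_ennreal[of I f c] by (simp add: add.commute)

lemma INF_add_INF_ennreal:
  fixes f :: "'i \<Rightarrow> ennreal"
  assumes "I \<noteq> {}" "J \<noteq> {}"
  shows "(INF i\<in>I. f i) + (INF j\<in>J. g j) = (INF i\<in>I. INF j\<in>J. f i + g j)"
proof -
  have "(INF i\<in>I. f i) + (INF j\<in>J. g j) = (INF i\<in>I. f i + (INF j\<in>J. g j))"
    by (rule INF_add_const_ennreal[OF assms(1), symmetric])
  then show ?thesis
    by (simp add: INF_const_add_ennreal[OF assms(2)])
qed

lemma SUP_sum_directed:
  fixes F :: "'i \<Rightarrow> nat \<Rightarrow> ennreal"
  assumes "I \<noteq> {}" "\<And>i j. i \<in> I \<Longrightarrow> j \<in> I \<Longrightarrow> \<exists>k\<in>I. \<forall>n. F i n \<le> F k n \<and> F j n \<le> F k n"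
  shows "(\<Sum>n<m. SUP i\<in>I. F i n) = (SUP i\<in>I. \<Sum>n<m. F i n)"
proof (induction m)
  case 0
  then show ?case using assms(1) by simp
next
  case (Suc m)
  have "(SUP i\<in>I. (\<Sum>n<m. F i n) + F i m) = (SUP i\<in>I. \<Sum>n<m. F i n) + (SUP i\<in>I. F i m)"
  proof (rule SUP_add_directed_ennreal)
    fix i j assume "i \<in> I" "j \<in> I"
    then obtain k where "k \<in> I" "\<forall>n. F i n \<le> F k n \<and> F j n \<le> F k n" using assms(2) by blast
    then show "\<exists>k\<in>I. (\<Sum>n<m. F i n) + F j m \<le> (\<Sum>n<m. F k n) + F k m"
      by (intro bexI[of _ k] add_mono sum_mono) auto
  qed
  then show ?case by (simp add: Suc)
qed

text \<open>
  Lower semicontinuity of addition, pointwise. The first two cases are not subsumed by the third: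
  if \<open>a = 0\<close> then no number is below \<open>a\<close>.
\<close>
lemma ennreal_less_add_cases:
  fixes t a b :: ennreal
  shows "t < a + b \<longleftrightarrow> t < a \<or> t < b \<or> (\<exists>s. s \<le> t \<and> t < top \<and> t - s < a \<and> s < b)"
proof
  assume t: "t < a + b"
  have "\<exists>s. s \<le> t \<and> t < top \<and> t - s < a \<and> s < b" if "a \<le> t" "b \<le> t"
  proof -
    have fin: "t < top" using t by (rule order_less_le_trans) simp
    then have "a < top" "b < top" using that by (auto intro: le_less_trans)
    have "t - a < b"
      using t that \<open>a < top\<close> by (simp add: add.commute minus_less_iff_ennreal)
    then obtain s where s: "t - a < s" "s < b" using dense by blast
    then have "s \<le> t" using that by simp
    moreover have "t - s < a"
      using s that \<open>s \<le> t\<close> fin \<open>a < top\<close>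
      by (simp add: minus_less_iff_ennreal add.commute order_le_less_trans[OF \<open>s \<le> t\<close> fin])
    ultimately show ?thesis using fin s by blast
  qed
  then show "t < a \<or> t < b \<or> (\<exists>s. s \<le> t \<and> t < top \<and> t - s < a \<and> s < b)"
    by (meson not_le)
next
  assume "t < a \<or> t < b \<or> (\<exists>s. s \<le> t \<and> t < top \<and> t - s < a \<and> s < b)"
  then consider "t < a" | "t < b" | s where "s \<le> t" "t < top" "t - s < a" "s < b" by blast
  then show "t < a + b"
  proof cases
    case 3
    then have "t = (t - s) + s" by (simp add: diff_add_cancel_ennreal)
    also have "\<dots> < a + b" using 3
      by (intro add_strict_mono)
    finally show ?thesis .
  qed (simp_all add: add_strict_increasing add_strict_increasing2 order_less_le_trans)
qed

section \<open>A sandwich theorem for cones of functions\<close>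

text \<open>
  Scalars are positive and finite, so that they are invertible. This is what makes an inequality
  \<open>p (a f) \<le> a p f\<close> for all \<open>a\<close> equivalent to homogeneity.
\<close>
locale function_cone =
  fixes C :: "('a \<Rightarrow> ennreal) set"
  assumes zero_in: "(\<lambda>_. 0) \<in> C"
    and add_in: "f \<in> C \<Longrightarrow> g \<in> C \<Longrightarrow> (\<lambda>x. f x + g x) \<in> C"
    and scale_in: "f \<in> C \<Longrightarrow> 0 < a \<Longrightarrow> a < top \<Longrightarrow> (\<lambda>x. a * f x) \<in> C"

definition sublinear_on :: "('a \<Rightarrow> ennreal) set \<Rightarrow> (('a \<Rightarrow> ennreal) \<Rightarrow> ennreal) \<Rightarrow> bool" where
  "sublinear_on C p \<longleftrightarrow>
     p (\<lambda>_. 0) = 0 \<and>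
     (\<forall>f\<in>C. \<forall>g\<in>C. f \<le> g \<longrightarrow> p f \<le> p g) \<and>
     (\<forall>f\<in>C. \<forall>a. 0 < a \<and> a < top \<longrightarrow> p (\<lambda>x. a * f x) = a * p f) \<and>
     (\<forall>f\<in>C. \<forall>g\<in>C. p (\<lambda>x. f x + g x) \<le> p f + p g)"

definition superlinear_on :: "('a \<Rightarrow> ennreal) set \<Rightarrow> (('a \<Rightarrow> ennreal) \<Rightarrow> ennreal) \<Rightarrow> bool" where
  "superlinear_on C p \<longleftrightarrow>
     p (\<lambda>_. 0) = 0 \<and>
     (\<forall>f\<in>C. \<forall>g\<in>C. f \<le> g \<longrightarrow> p f \<le> p g) \<and>
     (\<forall>f\<in>C. \<forall>a. 0 < a \<and> a < top \<longrightarrow> p (\<lambda>x. a * f x) = a * p f) \<and>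
     (\<forall>f\<in>C. \<forall>g\<in>C. p f + p g \<le> p (\<lambda>x. f x + g x))"

definition directed_family :: "('a \<Rightarrow> ennreal) set \<Rightarrow> bool" where
  "directed_family D \<longleftrightarrow> D \<noteq> {} \<and> (\<forall>f\<in>D. \<forall>g\<in>D. \<exists>h\<in>D. f \<le> h \<and> g \<le> h)"

definition scott_on :: "('a \<Rightarrow> ennreal) set \<Rightarrow> (('a \<Rightarrow> ennreal) \<Rightarrow> ennreal) \<Rightarrow> bool" where
  "scott_on C F \<longleftrightarrow>
     (\<forall>f\<in>C. \<forall>g\<in>C. f \<le> g \<longrightarrow> F f \<le> F g) \<and>
     (\<forall>D\<subseteq>C. directed_family D \<and> Sup D \<in> C \<longrightarrow> F (Sup D) = (SUP f\<in>D. F f))"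

lemma sublinear_onD:
  assumes "sublinear_on C p"
  shows "p (\<lambda>_. 0) = 0"
    and "f \<in> C \<Longrightarrow> g \<in> C \<Longrightarrow> f \<le> g \<Longrightarrow> p f \<le> p g"
    and "f \<in> C \<Longrightarrow> 0 < a \<Longrightarrow> a < top \<Longrightarrow> p (\<lambda>x. a * f x) = a * p f"
    and "f \<in> C \<Longrightarrow> g \<in> C \<Longrightarrow> p (\<lambda>x. f x + g x) \<le> p f + p g"
  using assms unfolding sublinear_on_def by blast+

lemma superlinear_onD:
  assumes "superlinear_on C p"
  shows "p (\<lambda>_. 0) = 0"
    and "f \<in> C \<Longrightarrow> g \<in> C \<Longrightarrow> f \<le> g \<Longrightarrow> p f \<le> p g"
    and "f \<in> C \<Longrightarrow> 0 < a \<Longrightarrow> a < top \<Longrightarrow> p (\<lambda>x. a * f x) = a * p f"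
    and "f \<in> C \<Longrightarrow> g \<in> C \<Longrightarrow> p f + p g \<le> p (\<lambda>x. f x + g x)"
  using assms unfolding superlinear_on_def by blast+

definition minimal_sublinear_on ::
    "('a \<Rightarrow> ennreal) set \<Rightarrow> (('a \<Rightarrow> ennreal) \<Rightarrow> ennreal) \<Rightarrow> (('a \<Rightarrow> ennreal) \<Rightarrow> ennreal) \<Rightarrow> bool" where
  "minimal_sublinear_on C q p \<longleftrightarrow>
     sublinear_on C p \<and> (\<forall>f\<in>C. q f \<le> p f) \<and>
     (\<forall>p'. sublinear_on C p' \<and> (\<forall>f\<in>C. q f \<le> p' f \<and> p' f \<le> p f) \<longrightarrow> (\<forall>f\<in>C. p f \<le> p' f))"

lemma minimal_sublinear_onD:
  assumes "minimal_sublinear_on C q p"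
  shows "sublinear_on C p"
    and "f \<in> C \<Longrightarrow> q f \<le> p f"
    and "sublinear_on C p' \<Longrightarrow> (\<And>f. f \<in> C \<Longrightarrow> q f \<le> p' f) \<Longrightarrow> (\<And>f. f \<in> C \<Longrightarrow> p' f \<le> p f)
      \<Longrightarrow> f \<in> C \<Longrightarrow> p f \<le> p' f"
  using assms unfolding minimal_sublinear_on_def by blast+

lemma directed_family_image:
  assumes "directed_family D" "\<And>f g. f \<in> D \<Longrightarrow> g \<in> D \<Longrightarrow> f \<le> g \<Longrightarrow> T f \<le> T g"
  shows "directed_family (T ` D)"
  unfolding directed_family_def
proof (intro conjI ballI)
  fix u v assume "u \<in> T ` D" "v \<in> T ` D"
  then obtain f g where fg: "f \<in> D" "g \<in> D" "u = T f" "v = T g" by blast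
  then obtain h where "h \<in> D" "f \<le> h" "g \<le> h"
    using assms(1) unfolding directed_family_def by blast
  then show "\<exists>w\<in>T ` D. u \<le> w \<and> v \<le> w"
    using fg assms(2) by blast
qed (use assms(1) in \<open>auto simp: directed_family_def\<close>)

lemma scott_onD:
  assumes "scott_on C F"
  shows "f \<in> C \<Longrightarrow> g \<in> C \<Longrightarrow> f \<le> g \<Longrightarrow> F f \<le> F g"
    and "D \<subseteq> C \<Longrightarrow> directed_family D \<Longrightarrow> Sup D \<in> C \<Longrightarrow> F (Sup D) = (SUP f\<in>D. F f)"
  using assms unfolding scott_on_def by blast+

lemma scott_on_cong:
  assumes "scott_on C F" "\<And>f. f \<in> C \<Longrightarrow> G f = F f"
  shows "scott_on C G"
proof -
  have "(SUP f\<in>D. G f) = (SUP f\<in>D. F f)" if "D \<subseteq> C" for D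
    using assms(2) that by (intro SUP_cong) auto
  then show ?thesis
    using assms unfolding scott_on_def by simp
qed

context function_cone begin

lemma scott_on_scale:
  assumes g: "scott_on C g" and a: "0 < a" "a < top"
  shows "scott_on C (\<lambda>f. b * g (\<lambda>x. a * f x))"
  unfolding scott_on_def
proof (intro conjI ballI allI impI)
  fix f f' assume f: "f \<in> C" "f' \<in> C" "f \<le> f'"
  then have "(\<lambda>x. a * f x) \<le> (\<lambda>x. a * f' x)"
    by (auto simp: le_fun_def intro: mult_left_mono)
  then show "b * g (\<lambda>x. a * f x) \<le> b * g (\<lambda>x. a * f' x)"
    using g f scale_in a unfolding scott_on_def by (intro mult_left_mono) auto
next
  fix D assume D: "D \<subseteq> C" "directed_family D \<and> Sup D \<in> C"
  let ?D = "(\<lambda>f x. a * f x) ` D"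
  have eq: "Sup ?D = (\<lambda>x. a * Sup D x)"
    by (auto simp: fun_eq_iff image_image SUP_mult_left_ennreal)
  have "directed_family ?D"
    using D by (intro directed_family_image) (auto simp: le_fun_def intro: mult_left_mono)
  then have "g (Sup ?D) = (SUP f\<in>?D. g f)"
  proof (rule scott_onD(2)[OF g, rotated])
    show "Sup ?D \<in> C"
      unfolding eq by (intro scale_in a) (use D in blast)
  qed (use D scale_in a in blast)
  then show "b * g (\<lambda>x. a * Sup D x) = (SUP f\<in>D. b * g (\<lambda>x. a * f x))"
    unfolding eq by (simp add: image_image SUP_mult_left_ennreal)
qed

text \<open>Subtraction is truncated, but subtracting a finite constant still preserves suprema.\<close>
lemma scott_on_translate_diff:
  assumes g: "scott_on C g" and y: "y \<in> C" and c: "c < top"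
  shows "scott_on C (\<lambda>f. g (\<lambda>x. f x + y x) - c)"
  unfolding scott_on_def
proof (intro conjI ballI allI impI)
  fix f f' assume f: "f \<in> C" "f' \<in> C" "f \<le> f'"
  then have "(\<lambda>x. f x + y x) \<le> (\<lambda>x. f' x + y x)"
    by (auto simp: le_fun_def intro: add_right_mono)
  then show "g (\<lambda>x. f x + y x) - c \<le> g (\<lambda>x. f' x + y x) - c"
    using g f add_in y unfolding scott_on_def by (intro ennreal_minus_mono) auto
next
  fix D assume D: "D \<subseteq> C" "directed_family D \<and> Sup D \<in> C"
  let ?D = "(\<lambda>f x. f x + y x) ` D"
  have "D \<noteq> {}" using D by (simp add: directed_family_def)
  then have eq: "Sup ?D = (\<lambda>x. Sup D x + y x)"
    by (auto simp: fun_eq_iff image_image ennreal_SUP_add_left)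
  have "directed_family ?D"
    using D by (intro directed_family_image) (auto simp: le_fun_def intro: add_right_mono)
  then have "g (Sup ?D) = (SUP f\<in>?D. g f)"
  proof (rule scott_onD(2)[OF g, rotated])
    show "Sup ?D \<in> C"
      unfolding eq by (intro add_in y) (use D in blast)
  qed (use D add_in y in blast)
  then show "g (\<lambda>x. Sup D x + y x) - c = (SUP f\<in>D. g (\<lambda>x. f x + y x) - c)"
    unfolding eq using c by (simp add: image_image SUP_diff_ennreal)
qed

lemma homogeneous_from_le:
  assumes le: "\<And>f a. f \<in> C \<Longrightarrow> 0 < a \<Longrightarrow> a < top \<Longrightarrow> p (\<lambda>x. a * f x) \<le> a * p f"
    and "f \<in> C" "0 < a" "a < top"
  shows "p (\<lambda>x. a * f x) = a * p f"
proof (rule antisym)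
  show "p (\<lambda>x. a * f x) \<le> a * p f"
    using assms by blast
  note inv = ennreal_inverse_pos_finite[OF assms(3,4)]
  have "p (\<lambda>x. inverse a * (a * f x)) \<le> inverse a * p (\<lambda>x. a * f x)"
    using le[OF scale_in[OF assms(2-4)] inv(1,2)] .
  then show "a * p f \<le> p (\<lambda>x. a * f x)"
    using mult_left_mono[of "p f" "inverse a * p (\<lambda>x. a * f x)" a] by (simp add: inv)
qed

lemma sublinear_onI:
  assumes "p (\<lambda>_. 0) = 0"
    and "\<And>f g. f \<in> C \<Longrightarrow> g \<in> C \<Longrightarrow> f \<le> g \<Longrightarrow> p f \<le> p g"
    and "\<And>f a. f \<in> C \<Longrightarrow> 0 < a \<Longrightarrow> a < top \<Longrightarrow> p (\<lambda>x. a * f x) \<le> a * p f"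
    and "\<And>f g. f \<in> C \<Longrightarrow> g \<in> C \<Longrightarrow> p (\<lambda>x. f x + g x) \<le> p f + p g"
  shows "sublinear_on C p"
  unfolding sublinear_on_def using assms homogeneous_from_le[of p] by blast

text \<open>
  Zorn's lemma: the pointwise infimum of a chain of sublinear functionals is sublinear, because two
  members of a chain have one of them as a common lower bound.
\<close>
lemma exists_minimal_sublinear:
  assumes p0: "sublinear_on C p0" and qp0: "\<And>f. f \<in> C \<Longrightarrow> q f \<le> p0 f"
  obtains p where "minimal_sublinear_on C q p" "\<And>f. f \<in> C \<Longrightarrow> p f \<le> p0 f"
proof -
  \<comment> \<open>Candidates are normalised to vanish outside the cone, so that the pointwise order on them
      is antisymmetric.\<close>
  define S where "S = {p. sublinear_on C p \<and> (\<forall>f\<in>C. q f \<le> p f \<and> p f \<le> p0 f) \<and> (\<forall>f. f \<notin> C \<longrightarrow> p f = 0)}"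
  define P :: "(('a \<Rightarrow> ennreal) \<Rightarrow> ennreal) \<Rightarrow> (('a \<Rightarrow> ennreal) \<Rightarrow> ennreal) \<Rightarrow> bool"
    where "P = (\<lambda>p p'. p' \<le> p)"
  have cut: "(\<lambda>f. if f \<in> C then p f else 0) \<in> S"
    if "sublinear_on C p" "\<And>f. f \<in> C \<Longrightarrow> q f \<le> p f" "\<And>f. f \<in> C \<Longrightarrow> p f \<le> p0 f" for p
    using that zero_in add_in scale_in unfolding S_def sublinear_on_def by auto
  have po: "partial_order_on S (relation_of P S)"
    unfolding P_def partial_order_on_def preorder_on_def refl_on_def trans_on_def antisym_on_def relation_of_def
    by auto
  have "\<exists>u\<in>S. \<forall>a\<in>K. P a u" if K: "K \<in> Chains (relation_of P S)" for K
  proof (cases "K = {}")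
    case True
    have "(\<lambda>f. if f \<in> C then p0 f else 0) \<in> S"
      using p0 qp0 by (intro cut) auto
    then show ?thesis using True by blast
  next
    case False
    have KS: "K \<subseteq> S" using K by (rule Chains_relation_of)
    have chain: "a \<le> b \<or> b \<le> a" if "a \<in> K" "b \<in> K" for a b
      using K that unfolding Chains_def relation_of_def P_def by auto
    have K1: "sublinear_on C a" "f \<in> C \<Longrightarrow> q f \<le> a f" "f \<in> C \<Longrightarrow> a f \<le> p0 f" if "a \<in> K" for a f
      using KS that unfolding S_def by auto
    define u where "u = (\<lambda>f. INF a\<in>K. a f)"
    have u_le: "u f \<le> a f" if "a \<in> K" for a f
      unfolding u_def using that by (rule INF_lower)
    have "sublinear_on C u"
    proof (rule sublinear_onI)
      show "u (\<lambda>_. 0) = 0"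
      proof -
        obtain a where a: "a \<in> K" using False by blast
        then show ?thesis using u_le[OF a, of "\<lambda>_. 0"] sublinear_onD(1)[OF K1(1)[OF a]] by simp
      qed
      show "u f \<le> u g" if "f \<in> C" "g \<in> C" "f \<le> g" for f g
        unfolding u_def using K1(1)[THEN sublinear_onD(2)] that by (intro INF_mono) blast
      show "u (\<lambda>x. c * f x) \<le> c * u f" if "f \<in> C" "0 < c" "c < top" for f c
      proof -
        have "inverse c * u (\<lambda>x. c * f x) \<le> u f"
          unfolding u_def
        proof (rule INF_greatest)
          fix a assume a: "a \<in> K"
          have "(INF a\<in>K. a (\<lambda>x. c * f x)) \<le> c * a f"
            using INF_lower[OF a, of "\<lambda>a. a (\<lambda>x. c * f x)"] sublinear_onD(3)[OF K1(1)[OF a] that] by simp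
          then show "inverse c * (INF a\<in>K. a (\<lambda>x. c * f x)) \<le> a f"
            by (simp add: inverse_mult_le_iff[OF that(2,3)])
        qed
        then show ?thesis by (simp add: inverse_mult_le_iff[OF that(2,3)])
      qed
      show "u (\<lambda>x. f x + g x) \<le> u f + u g" if fg: "f \<in> C" "g \<in> C" for f g
      proof -
        have "u (\<lambda>x. f x + g x) \<le> a f + b g" if ab: "a \<in> K" "b \<in> K" for a b
        proof -
          obtain c where c: "c \<in> K" "c \<le> a" "c \<le> b"
            using chain[OF ab] ab by blast
          have "u (\<lambda>x. f x + g x) \<le> c f + c g"
            using u_le[OF c(1)] sublinear_onD(4)[OF K1(1)[OF c(1)] fg] order_trans by blast
          also have "\<dots> \<le> a f + b g"
            using c by (intro add_mono) (auto simp: le_fun_def)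
          finally show ?thesis .
        qed
        then have "u (\<lambda>x. f x + g x) \<le> (INF a\<in>K. INF b\<in>K. a f + b g)"
          by (intro INF_greatest)
        also have "\<dots> = u f + u g"
          unfolding u_def using False by (simp add: INF_add_const_ennreal INF_const_add_ennreal)
        finally show ?thesis .
      qed
    qed
    moreover have "q f \<le> u f" if "f \<in> C" for f
      using that K1(2) unfolding u_def by (intro INF_greatest)
    moreover have "u f \<le> p0 f" if "f \<in> C" for f
    proof -
      obtain a where "a \<in> K" using False by blast
      then show ?thesis using K1(3)[OF _ that] u_le[of a f] order_trans by blast
    qed
    ultimately have "(\<lambda>f. if f \<in> C then u f else 0) \<in> S"
      by (intro cut)
    moreover have "P a (\<lambda>f. if f \<in> C then u f else 0)" if "a \<in> K" for a
      using u_le[OF that] by (auto simp: P_def le_fun_def)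
    ultimately show ?thesis by blast
  qed
  then have "\<exists>p\<in>S. \<forall>a\<in>S. P p a \<longrightarrow> a = p"
    by (rule predicate_Zorn[OF po])
  then obtain p where p: "p \<in> S" "\<And>a. a \<in> S \<Longrightarrow> P p a \<Longrightarrow> a = p"
    by blast
  show ?thesis
  proof (rule that[of p])
    show p_le: "p f \<le> p0 f" if "f \<in> C" for f
      using p(1) that unfolding S_def by auto
    have "p f \<le> p' f"
      if p': "sublinear_on C p'" "\<And>f. f \<in> C \<Longrightarrow> q f \<le> p' f" "\<And>f. f \<in> C \<Longrightarrow> p' f \<le> p f"
        and f: "f \<in> C" for p' f
    proof -
      have p_out: "\<And>f. f \<notin> C \<Longrightarrow> p f = 0"
        using p(1) unfolding S_def by auto
      have "(\<lambda>f. if f \<in> C then p' f else 0) = p"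
      proof (rule p(2))
        show "(\<lambda>f. if f \<in> C then p' f else 0) \<in> S"
          using p' p_le order_trans by (intro cut) blast+
        show "P p (\<lambda>f. if f \<in> C then p' f else 0)"
          using p'(3) p_out by (auto simp: P_def le_fun_def)
      qed
      then have "p' f = p f"
        using f by (auto dest: fun_cong[of _ _ f])
      then show ?thesis
        by simp
    qed
    then show "minimal_sublinear_on C q p"
      using p(1) unfolding minimal_sublinear_on_def S_def by blast
  qed
qed

text \<open>
  The supremum \<open>e\<close> of all Scott-continuous functionals below \<open>p\<close> is Scott-continuous and lies above
  \<open>q\<close>. It is also sublinear, so by minimality it equals \<open>p\<close>.
\<close>
lemma minimal_sublinear_scott:
  assumes min: "minimal_sublinear_on C q p" and q: "scott_on C q"
  shows "scott_on C p"
proof -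
  note p = min[THEN minimal_sublinear_onD(1)]
  define G where "G = {g. scott_on C g \<and> (\<forall>f\<in>C. g f \<le> p f)}"
  define e where "e = (\<lambda>f. SUP g\<in>G. g f)"
  have ge: "g f \<le> e f" if "g \<in> G" for g f
    unfolding e_def using that by (rule SUP_upper)
  have ep: "e f \<le> p f" if "f \<in> C" for f
    unfolding e_def using that by (intro SUP_least) (auto simp: G_def)
  have qG: "q \<in> G"
    using q min[THEN minimal_sublinear_onD(2)] by (auto simp: G_def)
  have e_scott: "scott_on C e"
    unfolding scott_on_def
  proof (intro conjI ballI allI impI)
    fix f g assume fg: "f \<in> C" "g \<in> C" "f \<le> g"
    show "e f \<le> e g"
      unfolding e_def
    proof (rule SUP_mono)
      fix m assume "m \<in> G"
      then show "\<exists>m'\<in>G. m f \<le> m' g"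
        using fg scott_onD(1)[of C m] by (auto simp: G_def)
    qed
  next
    fix D assume D: "D \<subseteq> C" "directed_family D \<and> Sup D \<in> C"
    have "e (Sup D) = (SUP g\<in>G. SUP f\<in>D. g f)"
      unfolding e_def using D by (intro SUP_cong) (auto simp: G_def scott_on_def)
    then show "e (Sup D) = (SUP f\<in>D. e f)"
      unfolding e_def by (subst SUP_commute)
  qed
  have "sublinear_on C e"
  proof (rule sublinear_onI)
    show "e (\<lambda>_. 0) = 0"
      using ep[OF zero_in] sublinear_onD(1)[OF p] by simp
    show "e f \<le> e g" if "f \<in> C" "g \<in> C" "f \<le> g" for f g
      using e_scott that unfolding scott_on_def by blast
    show "e (\<lambda>x. a * f x) \<le> a * e f" if f: "f \<in> C" and a: "0 < a" "a < top" for f a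
    proof -
      have "g (\<lambda>x. a * f x) \<le> a * e f" if "g \<in> G" for g
      proof -
        have "(\<lambda>f. inverse a * g (\<lambda>x. a * f x)) \<in> G"
        proof -
          have "inverse a * g (\<lambda>x. a * f x) \<le> p f" if "f \<in> C" for f
          proof -
            have "g (\<lambda>x. a * f x) \<le> p (\<lambda>x. a * f x)"
              using \<open>g \<in> G\<close> scale_in[OF that a] by (simp add: G_def)
            then show ?thesis
              by (simp add: inverse_mult_le_iff[OF a] sublinear_onD(3)[OF p that a])
          qed
          then show ?thesis
            using scott_on_scale[OF _ a] that by (simp add: G_def)
        qed
        from ge[OF this, of f] show ?thesis by (simp add: inverse_mult_le_iff[OF a])
      qed
      then show ?thesis unfolding e_def by (intro SUP_least) (simp add: e_def)
    qed
    \<comment> \<open>Addition need not be jointly continuous for the topology behind Scott continuity, so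
        one summand is treated at a time.\<close>
    have half: "h (\<lambda>x. f x + g x) \<le> e f + r"
      if h: "scott_on C h" and f: "f \<in> C" and g: "g \<in> C"
        and bound: "\<And>f. f \<in> C \<Longrightarrow> h (\<lambda>x. f x + g x) \<le> p f + r" for h f g r
    proof (cases "r = top")
      case False
      then have r: "r < top" by (simp add: less_top)
      have "(\<lambda>f. h (\<lambda>x. f x + g x) - r) \<in> G"
        using scott_on_translate_diff[OF h g r] bound False
        by (auto simp: G_def ennreal_minus_le_iff add.commute)
      from ge[OF this, of f] show ?thesis
        using False by (simp add: ennreal_minus_le_iff add.commute)
    qed simp
    show "e (\<lambda>x. f x + g x) \<le> e f + e g" if fg: "f \<in> C" "g \<in> C" for f g
    proof -
      have 1: "e (\<lambda>x. f x + g x) \<le> e f + p g" if "f \<in> C" "g \<in> C" for f g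
        using that ep[OF add_in] sublinear_onD(4)[OF p] order_trans by (intro half[OF e_scott]) blast+
      have "e (\<lambda>x. g x + f x) \<le> e g + e f"
        using 1[of f] fg by (intro half[OF e_scott]) (auto simp: add.commute)
      then show ?thesis by (simp add: add.commute)
    qed
  qed
  moreover have "q f \<le> e f" if "f \<in> C" for f
    using ge[OF qG] .
  ultimately have "p f \<le> e f" if "f \<in> C" for f
    using minimal_sublinear_onD(3)[OF min _ _ ep] that by blast
  then have "p f = e f" if "f \<in> C" for f
    using ep that by (simp add: antisym)
  then show ?thesis
    using scott_on_cong e_scott by blast
qed

text \<open>
  Let \<open>r\<close> be the right-hand side. It is chosen as the least number with \<open>q (y + a z) \<le> p y + a r\<close> for
  all \<open>y\<close> and \<open>a\<close>, so that \<open>x \<mapsto> inf {p y + a r | x \<le> y + a z}\<close> is a sublinear functional between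
  \<open>q\<close> and \<open>p\<close>; it takes a value at most \<open>r\<close> at \<open>z\<close>, and minimality gives \<open>p z \<le> r\<close>. The index set is
  restricted to \<open>p y \<le> q (y + z)\<close> to avoid truncated subtraction; \<open>y = 0\<close> is always
  admitted.
\<close>
lemma minimal_sublinear_eq_SUP:
  assumes min: "minimal_sublinear_on C q p" and q: "superlinear_on C q" and z: "z \<in> C"
  shows "p z = (SUP y\<in>{y\<in>C. p y < top \<and> p y \<le> q (\<lambda>x. y x + z x)}. q (\<lambda>x. y x + z x) - p y)" (is "_ = ?r")
proof (rule antisym)
  note p = min[THEN minimal_sublinear_onD(1)]
  note qp = min[THEN minimal_sublinear_onD(2)]
  show "?r \<le> p z"
  proof (rule SUP_least)
    fix y assume y: "y \<in> {y\<in>C. p y < top \<and> p y \<le> q (\<lambda>x. y x + z x)}"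
    then have "q (\<lambda>x. y x + z x) \<le> p y + p z"
      using qp[OF add_in[of y z]] sublinear_onD(4)[OF p, of y z] z by auto
    then show "q (\<lambda>x. y x + z x) - p y \<le> p z"
      using y by (auto simp: ennreal_minus_le_iff)
  qed
  show "p z \<le> ?r"
  proof (cases "?r = top")
    case False
    define r where "r = ?r"
    have r: "r < top" unfolding r_def using False by (rule less_top[THEN iffD1])
    have q_le: "q (\<lambda>x. y x + z x) \<le> p y + r" if "y \<in> C" for y
    proof (cases "p y < top \<and> p y \<le> q (\<lambda>x. y x + z x)")
      case True
      then have "q (\<lambda>x. y x + z x) - p y \<le> r"
        unfolding r_def using that by (intro SUP_upper) auto
      then show ?thesis using True by (simp add: ennreal_minus_le_iff)
    next
      case False
      then consider "p y = top" | "q (\<lambda>x. y x + z x) \<le> p y"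
        using less_top by fastforce
      then show ?thesis
        by cases (auto intro: add_increasing2)
    qed
    define A where "A = (\<lambda>x. {(y, a). y \<in> C \<and> a < top \<and> x \<le> (\<lambda>u. y u + a * z u)})"
    define p' where "p' = (\<lambda>x. INF (y, a)\<in>A x. p y + a * r)"
    have p'_le: "p' x \<le> p y + a * r" if "y \<in> C" "a < top" "x \<le> (\<lambda>u. y u + a * z u)" for x y a
      unfolding p'_def using that by (intro INF_lower2[of "(y, a)"]) (auto simp: A_def)
    have p'_ge: "t \<le> p' x" if "\<And>y a. y \<in> C \<Longrightarrow> a < top \<Longrightarrow> x \<le> (\<lambda>u. y u + a * z u) \<Longrightarrow> t \<le> p y + a * r" for x t
      unfolding p'_def using that by (intro INF_greatest) (auto simp: A_def)
    have p'p: "p' x \<le> p x" if "x \<in> C" for x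
      using p'_le[of x 0 x] that by simp
    have az: "(\<lambda>u. a * z u) \<in> C" if "a < top" for a
      using that z scale_in[OF z] zero_in by (cases "a = 0") (auto simp: zero_less_iff_neq_zero)
    have "sublinear_on C p'"
    proof (rule sublinear_onI)
      show "p' (\<lambda>_. 0) = 0"
        using p'p[OF zero_in] sublinear_onD(1)[OF p] by simp
      show "p' f \<le> p' g" if "f \<in> C" "g \<in> C" "f \<le> g" for f g
        using order_trans[OF that(3)] by (intro p'_ge p'_le) auto
      show "p' (\<lambda>x. b * f x) \<le> b * p' f" if f: "f \<in> C" and b: "0 < b" "b < top" for f b
      proof -
        have "inverse b * p' (\<lambda>x. b * f x) \<le> p' f"
        proof (rule p'_ge)
          fix y a assume y: "y \<in> C" "a < top" "f \<le> (\<lambda>u. y u + a * z u)"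
          have "p' (\<lambda>x. b * f x) \<le> p (\<lambda>x. b * y x) + (b * a) * r"
          proof (rule p'_le)
            show "(\<lambda>x. b * f x) \<le> (\<lambda>u. b * y u + b * a * z u)"
              using y(3) mult_left_mono[of _ _ b] by (auto simp: le_fun_def distrib_left[symmetric] mult.assoc)
          qed (use y b scale_in in \<open>auto simp: ennreal_mult_less_top\<close>)
          also have "\<dots> = b * (p y + a * r)"
            using sublinear_onD(3)[OF p y(1) b] by (simp add: distrib_left mult.assoc)
          finally show "inverse b * p' (\<lambda>x. b * f x) \<le> p y + a * r"
            by (simp add: inverse_mult_le_iff[OF b])
        qed
        then show ?thesis by (simp add: inverse_mult_le_iff[OF b])
      qed
      show "p' (\<lambda>x. f x + g x) \<le> p' f + p' g" if fg: "f \<in> C" "g \<in> C" for f g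
      proof -
        have A: "A f \<noteq> {}" "A g \<noteq> {}"
          using fg by (auto simp: A_def intro!: exI[of _ 0])
        have *: "p' (\<lambda>x. f x + g x) \<le> (p y + a * r) + (p w + b * r)"
          if "(y, a) \<in> A f" "(w, b) \<in> A g" for y a w b
        proof -
          have 1: "p' (\<lambda>x. f x + g x) \<le> p (\<lambda>x. y x + w x) + (a + b) * r"
          proof (rule p'_le)
            show "(\<lambda>x. f x + g x) \<le> (\<lambda>u. y u + w u + (a + b) * z u)"
            proof (rule le_funI)
              fix u
              have "f u + g u \<le> (y u + a * z u) + (w u + b * z u)"
                using that by (intro add_mono) (auto simp: A_def le_fun_def)
              then show "f u + g u \<le> y u + w u + (a + b) * z u"
                by (simp add: algebra_simps)
            qed
          qed (use that add_in in \<open>auto simp: A_def\<close>)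
          have "p (\<lambda>x. y x + w x) \<le> p y + p w"
            using that by (intro sublinear_onD(4)[OF p]) (auto simp: A_def)
          then have "p (\<lambda>x. y x + w x) + (a + b) * r \<le> (p y + a * r) + (p w + b * r)"
            using add_right_mono[of _ _ "a * r + b * r"] by (simp add: algebra_simps)
          with 1 show ?thesis by (rule order_trans)
        qed
        have "p' (\<lambda>x. f x + g x) \<le> (INF i\<in>A f. INF j\<in>A g. (case i of (y, a) \<Rightarrow> p y + a * r) + (case j of (w, b) \<Rightarrow> p w + b * r))"
          using * by (intro INF_greatest) (auto split: prod.split)
        also have "\<dots> = p' f + p' g"
          unfolding p'_def using A by (simp add: INF_add_const_ennreal INF_const_add_ennreal)
        finally show ?thesis .
      qed
    qed
    moreover have "q x \<le> p' x" if x: "x \<in> C" for x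
    proof (rule p'_ge)
      fix y a assume y: "y \<in> C" "a < top" "x \<le> (\<lambda>u. y u + a * z u)"
      show "q x \<le> p y + a * r"
      proof (cases "a = 0")
        case True
        then have "q x \<le> q y"
          using y x by (intro superlinear_onD(2)[OF q]) auto
        then show ?thesis using qp[OF y(1)] True by simp
      next
        case False
        then have a: "0 < a" "a < top" using y by (auto simp: zero_less_iff_neq_zero)
        note inv = ennreal_inverse_pos_finite[OF a]
        define y' where "y' = (\<lambda>x. inverse a * y x)"
        have y': "y' \<in> C" unfolding y'_def using inv by (intro scale_in y)
        have eq: "(\<lambda>u. y u + a * z u) = (\<lambda>u. a * (y' u + z u))"
          by (simp add: y'_def distrib_left inv)
        have "q x \<le> q (\<lambda>u. a * (y' u + z u))"
          using y(3) x add_in[OF y(1) az[OF a(2)]] unfolding eq by (intro superlinear_onD(2)[OF q])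
        also have "\<dots> = a * q (\<lambda>u. y' u + z u)"
          by (rule superlinear_onD(3)[OF q add_in[OF y' z] a])
        also have "\<dots> \<le> a * (p y' + r)"
          by (intro mult_left_mono q_le y') simp
        also have "\<dots> = p (\<lambda>x. a * y' x) + a * r"
          using sublinear_onD(3)[OF p y' a] by (simp add: distrib_left)
        also have "(\<lambda>x. a * y' x) = y" by (simp add: y'_def inv)
        finally show ?thesis .
      qed
    qed
    ultimately have "p z \<le> p' z"
      using minimal_sublinear_onD(3)[OF min _ _ p'p] z by blast
    also have "\<dots> \<le> p (\<lambda>_. 0) + 1 * r"
      using zero_in by (intro p'_le) auto
    finally show ?thesis
      using sublinear_onD(1)[OF p] by (simp add: r_def)
  next
    case True
    then show ?thesis by (simp only: True top_greatest)
  qed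
qed

text \<open>
  Two terms \<open>q (y + z) - p y\<close> and \<open>q (v + w) - p v\<close> add up to at most \<open>q (y + v + z + w) - p (y + v)\<close>,
  and this is at most \<open>p (z + w)\<close>. Hence \<open>minimal_sublinear_eq_SUP\<close> makes a minimal sublinear
  functional superadditive.
\<close>
theorem sandwich:
  assumes q: "superlinear_on C q" "scott_on C q" and p0: "sublinear_on C p0"
    and qp0: "\<And>f. f \<in> C \<Longrightarrow> q f \<le> p0 f"
  obtains L where "sublinear_on C L" "superlinear_on C L" "scott_on C L"
    "\<And>f. f \<in> C \<Longrightarrow> q f \<le> L f" "\<And>f. f \<in> C \<Longrightarrow> L f \<le> p0 f"
proof -
  obtain p where min: "minimal_sublinear_on C q p" and pp0: "\<And>f. f \<in> C \<Longrightarrow> p f \<le> p0 f"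
    using exists_minimal_sublinear[OF p0 qp0] by blast
  note p = min[THEN minimal_sublinear_onD(1)]
  have "p z + p w \<le> p (\<lambda>x. z x + w x)" if zw: "z \<in> C" "w \<in> C" for z w
  proof -
    let ?F = "\<lambda>z. {y\<in>C. p y < top \<and> p y \<le> q (\<lambda>x. y x + z x)}"
    have F: "?F z \<noteq> {}" for z
      using zero_in sublinear_onD(1)[OF p] by (auto intro!: exI[of _ "\<lambda>_. 0"])
    have "p z + p w = (SUP y\<in>?F z. SUP v\<in>?F w. (q (\<lambda>x. y x + z x) - p y) + (q (\<lambda>x. v x + w x) - p v))"
      unfolding minimal_sublinear_eq_SUP[OF min q(1) zw(1)] minimal_sublinear_eq_SUP[OF min q(1) zw(2)]
      by (rule SUP_add_SUP_ennreal[OF F F])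
    also have "\<dots> \<le> p (\<lambda>x. z x + w x)"
    proof (intro SUP_least)
      fix y v assume y: "y \<in> ?F z" and v: "v \<in> ?F w"
      have yv: "(\<lambda>x. y x + v x) \<in> C" "(\<lambda>x. z x + w x) \<in> C" using y v zw by (auto intro: add_in)
      have "q (\<lambda>x. y x + z x) + q (\<lambda>x. v x + w x) \<le> q (\<lambda>x. (y x + z x) + (v x + w x))"
        using y v zw by (intro superlinear_onD(4)[OF q(1)] add_in) auto
      also have "\<dots> = q (\<lambda>x. (y x + v x) + (z x + w x))"
        by (simp add: ac_simps)
      also have "\<dots> \<le> p (\<lambda>x. (y x + v x) + (z x + w x))"
        by (intro minimal_sublinear_onD(2)[OF min] add_in yv)
      also have "\<dots> \<le> p (\<lambda>x. y x + v x) + p (\<lambda>x. z x + w x)"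
        by (intro sublinear_onD(4)[OF p] yv)
      also have "\<dots> \<le> (p y + p v) + p (\<lambda>x. z x + w x)"
        using y v by (intro add_right_mono sublinear_onD(4)[OF p]) auto
      also have "q (\<lambda>x. y x + z x) + q (\<lambda>x. v x + w x)
          = (p y + p v) + ((q (\<lambda>x. y x + z x) - p y) + (q (\<lambda>x. v x + w x) - p v))"
      proof -
        have "q (\<lambda>x. y x + z x) = p y + (q (\<lambda>x. y x + z x) - p y)"
          "q (\<lambda>x. v x + w x) = p v + (q (\<lambda>x. v x + w x) - p v)"
          using y v by (auto simp: add_diff_inverse_ennreal)
        then show ?thesis by (metis add.assoc add.left_commute)
      qed
      finally show "(q (\<lambda>x. y x + z x) - p y) + (q (\<lambda>x. v x + w x) - p v) \<le> p (\<lambda>x. z x + w x)"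
        using y v by (auto simp: ennreal_add_left_cancel_le)
    qed
    finally show ?thesis .
  qed
  then have "superlinear_on C p"
    unfolding superlinear_on_def
    by (intro conjI ballI allI impI) (simp_all add: sublinear_onD[OF p])
  then show ?thesis
    using p minimal_sublinear_scott[OF min q(2)] minimal_sublinear_onD(2)[OF min] pp0 by (intro that)
qed

end

section \<open>Lower semicontinuous functions\<close>

text \<open>
  The cone of continuous maps into the extended nonnegative reals with the Scott topology. Taking the
  level sets in the whole type, not in the space, forces the functions to vanish outside the space
  (the case \<open>t = 0\<close>), so that the pointwise order is the right one.
\<close>
definition lsc :: "'a topology \<Rightarrow> ('a \<Rightarrow> ennreal) set" where
  "lsc X = {h. \<forall>t. openin X {x. t < h x}}"

lemma lsc_openin: "h \<in> lsc X \<Longrightarrow> openin X {x. t < h x}"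
  by (simp add: lsc_def)

lemma lsc_Sup:
  assumes "D \<subseteq> lsc X"
  shows "Sup D \<in> lsc X"
proof -
  have "{x. t < Sup D x} = (\<Union>f\<in>D. {x. t < f x})" for t
    by (auto simp: less_SUP_iff)
  then show ?thesis
    using assms by (auto simp: lsc_def intro!: openin_Union)
qed

lemma lsc_indicator:
  assumes "openin X U"
  shows "indicator U \<in> lsc X"
proof -
  have "{x. t < indicator U x} = (if t < 1 then U else {})" for t :: ennreal
    by (auto simp: indicator_def)
  then show ?thesis
    using assms by (auto simp: lsc_def)
qed

lemma lsc_zero: "(\<lambda>_. 0) \<in> lsc X"
  by (simp add: lsc_def)

lemma lsc_scale:
  assumes "h \<in> lsc X" "0 < a" "a < top"
  shows "(\<lambda>x. a * h x) \<in> lsc X"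
proof -
  have "t < a * y \<longleftrightarrow> t / a < y" for t y
    using assms(2,3) by (subst divide_less_ennreal) (auto simp: mult.commute)
  then show ?thesis
    using assms(1) by (simp add: lsc_def)
qed

lemma lsc_add:
  assumes "f \<in> lsc X" "g \<in> lsc X"
  shows "(\<lambda>x. f x + g x) \<in> lsc X"
proof -
  have "{x. t < f x + g x} = {x. t < f x} \<union> {x. t < g x} \<union>
      (\<Union>s\<in>{s. s \<le> t \<and> t < top}. {x. t - s < f x} \<inter> {x. s < g x})" for t
    by (subst ennreal_less_add_cases) blast
  then show ?thesis
    using assms by (auto simp: lsc_def intro!: openin_Un openin_Union)
qed

lemma level_subset: "f \<le> g \<Longrightarrow> {x. t < f x} \<subseteq> {x. t < (g x :: ennreal)}"
  using order_less_le_trans by (fastforce simp: le_fun_def)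

lemma level_antitone: "s \<le> t \<Longrightarrow> {x. ennreal t < f x} \<subseteq> {x. ennreal s < f x}"
  using order_le_less_trans[OF ennreal_leI] by blast

section \<open>The integral with respect to a continuous valuation\<close>

lemma continuous_valuationD:
  assumes "continuous_valuation X \<nu>"
  shows "\<nu> {} = 0"
    and "openin X U \<Longrightarrow> openin X V \<Longrightarrow> \<nu> U + \<nu> V = \<nu> (U \<union> V) + \<nu> (U \<inter> V)"
    and "openin X U \<Longrightarrow> openin X V \<Longrightarrow> U \<subseteq> V \<Longrightarrow> \<nu> U \<le> \<nu> V"
    and "D \<noteq> {} \<Longrightarrow> (\<And>U. U \<in> D \<Longrightarrow> openin X U) \<Longrightarrow>
      (\<And>U V. U \<in> D \<Longrightarrow> V \<in> D \<Longrightarrow> \<exists>W\<in>D. U \<subseteq> W \<and> V \<subseteq> W) \<Longrightarrow> \<nu> (\<Union>D) = (SUP U\<in>D. \<nu> U)"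
proof -
  note cv = assms[unfolded continuous_valuation_def]
  show "\<nu> {} = 0"
    using cv by (elim conjE)
  show "openin X U \<Longrightarrow> openin X V \<Longrightarrow> \<nu> U + \<nu> V = \<nu> (U \<union> V) + \<nu> (U \<inter> V)"
    using cv[THEN conjunct2, THEN conjunct2, THEN conjunct1] by simp
  show "openin X U \<Longrightarrow> openin X V \<Longrightarrow> U \<subseteq> V \<Longrightarrow> \<nu> U \<le> \<nu> V"
    using cv[THEN conjunct2, THEN conjunct2, THEN conjunct2, THEN conjunct1] by simp
  show "\<nu> (\<Union>D) = (SUP U\<in>D. \<nu> U)"
    if "D \<noteq> {}" "\<And>U. U \<in> D \<Longrightarrow> openin X U"
      "\<And>U V. U \<in> D \<Longrightarrow> V \<in> D \<Longrightarrow> \<exists>W\<in>D. U \<subseteq> W \<and> V \<subseteq> W"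
    using cv[THEN conjunct2, THEN conjunct2, THEN conjunct2, THEN conjunct2, rule_format, of D] that
    by blast
qed

lemma val_integral_lsc:
  assumes "h \<in> lsc X"
  shows "val_integral X \<nu> h = (\<integral>\<^sup>+t\<in>{0..}. \<nu> {x. ennreal t < h x} \<partial>lborel)"
proof -
  have "{x \<in> topspace X. ennreal t < h x} = {x. ennreal t < h x}" for t
    using openin_subset[OF lsc_openin[OF assms]] by blast
  then show ?thesis by (simp add: val_integral_def)
qed

lemma val_integral_le:
  assumes "\<And>t. 0 \<le> t \<Longrightarrow>
    \<nu> {x \<in> topspace X. ennreal t < f x} \<le> \<xi> {y \<in> topspace Y. ennreal t < g y}"
  shows "val_integral X \<nu> f \<le> val_integral Y \<xi> g"
  unfolding val_integral_def
proof (rule nn_integral_mono)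
  fix t
  show "\<nu> {x \<in> topspace X. ennreal t < f x} * indicator {0..} t
      \<le> \<xi> {y \<in> topspace Y. ennreal t < g y} * indicator {0..} t"
    by (cases "0 \<le> t") (simp_all add: assms)
qed

lemma val_integral_mono:
  assumes "continuous_valuation X \<nu>" "f \<in> lsc X" "g \<in> lsc X" "f \<le> g"
  shows "val_integral X \<nu> f \<le> val_integral X \<nu> g"
  unfolding val_integral_lsc[OF assms(2)] val_integral_lsc[OF assms(3)]
  by (intro nn_integral_mono mult_right_mono continuous_valuationD(3)[OF assms(1)] lsc_openin
      level_subset assms) simp

lemma val_integral_eq_on_topspace:
  assumes "\<And>x. x \<in> topspace X \<Longrightarrow> f x = g x"
  shows "val_integral X \<nu> f = val_integral X \<nu> g"
proof -
  have "{x \<in> topspace X. ennreal t < f x} = {x \<in> topspace X. ennreal t < g x}" for t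
    using assms by auto
  then show ?thesis by (simp add: val_integral_def)
qed

lemma antitone_borel_measurable:
  fixes \<phi> :: "real \<Rightarrow> ennreal"
  assumes "\<And>s t. s \<le> t \<Longrightarrow> \<phi> t \<le> \<phi> s"
  shows "\<phi> \<in> borel_measurable borel"
proof (rule borel_measurableI_greater)
  fix y
  have "is_interval {t. y < \<phi> t}"
    unfolding is_interval_1 using order_less_le_trans[OF _ assms] by blast
  then show "{t \<in> space borel. y < \<phi> t} \<in> sets borel"
    by (simp add: real_interval_borel_measurable)
qed

lemma level_measurable:
  assumes "continuous_valuation X \<nu>" "h \<in> lsc X" "openin X U"
  shows "(\<lambda>t. \<nu> ({x. ennreal t < h x} \<inter> U)) \<in> borel_measurable borel"
  by (intro antitone_borel_measurable continuous_valuationD(3)[OF assms(1)] openin_Int lsc_openin assms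
      Int_mono level_antitone subset_refl)

lemma level_measurable':
  assumes "continuous_valuation X \<nu>" "h \<in> lsc X"
  shows "(\<lambda>t. \<nu> {x. ennreal t < h x}) \<in> borel_measurable borel"
  by (intro antitone_borel_measurable continuous_valuationD(3)[OF assms(1)] lsc_openin assms level_antitone)

lemma val_integral_indicator:
  assumes "continuous_valuation X \<nu>" "openin X U"
  shows "val_integral X \<nu> (indicator U) = \<nu> U"
proof -
  have "\<nu> {x. ennreal t < indicator U x} * indicator {0..} t = \<nu> U * indicator {0..<1} t" for t
  proof -
    have "{x. ennreal t < indicator U x} = (if t < 1 then U else {})"
      by (auto simp: indicator_def)
    then show ?thesis
      by (auto simp: indicator_def continuous_valuationD(1)[OF assms(1)])
  qed
  then show ?thesis
    unfolding val_integral_lsc[OF lsc_indicator[OF assms(2)]]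
    by (simp add: nn_integral_cmult_indicator)
qed

lemma val_integral_zero:
  assumes "continuous_valuation X \<nu>"
  shows "val_integral X \<nu> (\<lambda>_. 0) = 0"
  unfolding val_integral_def by (simp add: continuous_valuationD(1)[OF assms])

lemma val_integral_scale:
  assumes \<nu>: "continuous_valuation X \<nu>" and h: "h \<in> lsc X" and a: "0 < a" "a < top"
  shows "val_integral X \<nu> (\<lambda>x. a * h x) = a * val_integral X \<nu> h"
proof -
  obtain r where r: "a = ennreal r" "0 < r"
    using a by (cases a) auto
  have meas: "(\<lambda>t. \<nu> {x. ennreal t < a * h x} * indicator {0..} t) \<in> borel_measurable borel"
    using level_measurable'[OF \<nu> lsc_scale[OF h a]] by measurable
  have lev: "{x. ennreal (0 + r * t) < a * h x} = {x. ennreal t < h x}" if "0 \<le> t" for t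
  proof -
    have "ennreal (r * t) < ennreal r * y \<longleftrightarrow> ennreal t < y" for y
      using r that by (cases y) (auto simp: ennreal_mult'[symmetric] ennreal_mult_top ennreal_less_iff)
    then show ?thesis by (simp add: r)
  qed
  have "val_integral X \<nu> (\<lambda>x. a * h x) =
      \<bar>r\<bar> * (\<integral>\<^sup>+t. \<nu> {x. ennreal (0 + r * t) < a * h x} * indicator {0..} (0 + r * t) \<partial>lborel)"
    unfolding val_integral_lsc[OF lsc_scale[OF h a]]
    using r by (intro nn_integral_real_affine meas) simp
  also have "(\<lambda>t. \<nu> {x. ennreal (0 + r * t) < a * h x} * indicator {0..} (0 + r * t))
      = (\<lambda>t. \<nu> {x. ennreal t < h x} * indicator {0..} t)"
    using r lev by (auto simp: fun_eq_iff indicator_def zero_le_mult_iff)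
  finally show ?thesis
    using r by (simp add: val_integral_lsc[OF h])
qed

text \<open>
  Level sets of an increasing supremum are increasing unions, so this is monotone convergence for the
  Lebesgue integral over the levels.
\<close>
lemma val_integral_SUP_seq:
  assumes \<nu>: "continuous_valuation X \<nu>" and f: "\<And>n. f n \<in> lsc X" and inc: "incseq f"
  shows "val_integral X \<nu> (\<lambda>x. SUP n. f n x) = (SUP n. val_integral X \<nu> (f n))"
proof -
  have S: "(\<lambda>x. SUP n. f n x) \<in> lsc X"
    using lsc_Sup[of "range f" X] f by (auto simp: image_image Sup_fun_def)
  have lev: "\<nu> {x. ennreal t < (SUP n. f n x)} = (SUP n. \<nu> {x. ennreal t < f n x})" for t
  proof -
    have eq: "{x. ennreal t < (SUP n. f n x)} = (\<Union>n. {x. ennreal t < f n x})"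
      by (auto simp: less_SUP_iff)
    have "\<nu> (\<Union>n. {x. ennreal t < f n x}) = (SUP U\<in>range (\<lambda>n. {x. ennreal t < f n x}). \<nu> U)"
    proof (rule continuous_valuationD(4)[OF \<nu>])
      fix U V assume "U \<in> range (\<lambda>n. {x. ennreal t < f n x})" "V \<in> range (\<lambda>n. {x. ennreal t < f n x})"
      then obtain m n where mn: "U = {x. ennreal t < f m x}" "V = {x. ennreal t < f n x}" by blast
      have "f m \<le> f (max m n)" "f n \<le> f (max m n)"
        using inc by (auto simp: incseq_def)
      then have "U \<subseteq> {x. ennreal t < f (max m n) x}" "V \<subseteq> {x. ennreal t < f (max m n) x}"
        unfolding mn by (simp_all add: level_subset)
      then show "\<exists>W\<in>range (\<lambda>n. {x. ennreal t < f n x}). U \<subseteq> W \<and> V \<subseteq> W" by blast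
    qed (use f lsc_openin in auto)
    then show ?thesis by (simp add: eq image_image)
  qed
  have "val_integral X \<nu> (\<lambda>x. SUP n. f n x)
      = (\<integral>\<^sup>+t. (SUP n. \<nu> {x. ennreal t < f n x} * indicator {0..} t) \<partial>lborel)"
    unfolding val_integral_lsc[OF S] lev by (simp add: SUP_mult_right_ennreal)
  also have "\<dots> = (SUP n. \<integral>\<^sup>+t. \<nu> {x. ennreal t < f n x} * indicator {0..} t \<partial>lborel)"
  proof (rule nn_integral_monotone_convergence_SUP)
    have "\<nu> {x. ennreal t < f m x} \<le> \<nu> {x. ennreal t < f n x}" if "m \<le> n" for m n t
      by (intro continuous_valuationD(3)[OF \<nu>] lsc_openin level_subset f incseqD[OF inc that])
    then show "incseq (\<lambda>n t. \<nu> {x. ennreal t < f n x} * indicator {0..} t)"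
      unfolding incseq_def le_fun_def by (intro allI impI mult_right_mono) simp_all
  next
    fix n
    show "(\<lambda>t. \<nu> {x. ennreal t < f n x} * indicator {0..} t) \<in> borel_measurable lborel"
      using level_measurable'[OF \<nu> f[of n]] by measurable
  qed
  finally show ?thesis by (simp add: val_integral_lsc[OF f])
qed

text \<open>
  Adding \<open>a\<close> on \<open>U\<close> replaces the level set \<open>A t\<close> by \<open>A t \<union> B t\<close>, where \<open>B t\<close> is the part of \<open>U\<close> that is
  lifted above \<open>t\<close>. As \<open>A t \<inter> B t = A t \<inter> U\<close>, modularity turns the claim into an identity of
  integrals over \<open>t\<close> with the common term \<open>J = \<integral> \<nu> (A t \<inter> U) dt\<close> on both sides, by translation
  invariance. If \<open>J\<close> is infinite it cannot be cancelled, but then both sides are infinite.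
\<close>
lemma val_integral_add_indicator:
  assumes \<nu>: "continuous_valuation X \<nu>" and f: "f \<in> lsc X" and U: "openin X U"
    and a: "0 < a" "a < top"
  shows "val_integral X \<nu> (\<lambda>x. f x + a * indicator U x) = val_integral X \<nu> f + a * \<nu> U"
proof -
  obtain r where r: "a = ennreal r" "0 < r"
    using a by (cases a) auto
  let ?g = "\<lambda>x. f x + a * indicator U x"
  have g: "?g \<in> lsc X" by (intro lsc_add lsc_scale lsc_indicator f U a)
  define A where "A t = {x. ennreal t < f x}" for t
  define B where "B t = (if t < r then U else A (t - r) \<inter> U)" for t
  have A: "openin X (A t)" for t unfolding A_def by (rule lsc_openin[OF f])
  have B: "openin X (B t)" for t unfolding B_def using A U by auto
  define \<psi> where "\<psi> t = \<nu> (A t \<inter> U)" for t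
  define J where "J = (\<integral>\<^sup>+t\<in>{0..}. \<psi> t \<partial>lborel)"
  have A_meas: "(\<lambda>t. \<nu> (A t)) \<in> borel_measurable borel"
    unfolding A_def by (rule level_measurable'[OF \<nu> f])
  have \<psi>_meas: "\<psi> \<in> borel_measurable borel"
    unfolding A_def \<psi>_def by (rule level_measurable[OF \<nu> f U])
  have g_meas: "(\<lambda>t. \<nu> {x. ennreal t < ?g x}) \<in> borel_measurable borel"
    by (rule level_measurable'[OF \<nu> g])
  have level: "\<nu> {x. ennreal t < ?g x} + \<psi> t = \<nu> (A t) + \<nu> (B t)" if t: "0 \<le> t" for t
  proof -
    have "ennreal t < y + ennreal r \<longleftrightarrow> ennreal t < y \<or> t < r \<or> ennreal (t - r) < y" for y
    proof (cases y)
      case (real s)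
      then show ?thesis using t r
        by (cases "t < r") (auto simp: ennreal_plus[symmetric] ennreal_less_iff simp del: ennreal_plus)
    qed auto
    moreover have "ennreal (t - r) < y" if "ennreal t < y" for y
      using order_le_less_trans[OF ennreal_leI that, of "t - r"] r by simp
    ultimately have "{x. ennreal t < ?g x} = A t \<union> B t" "A t \<inter> B t = A t \<inter> U"
      using r by (auto simp: A_def B_def indicator_def)
    then show ?thesis
      using continuous_valuationD(2)[OF \<nu> A B, of t t] by (simp add: \<psi>_def)
  qed
  have "J = 1 * (\<integral>\<^sup>+t. \<psi> (- r + 1 * t) * indicator {0..} (- r + 1 * t) \<partial>lborel)"
    unfolding J_def using nn_integral_real_affine[of "\<lambda>t. \<psi> t * indicator {0..} t" 1 "- r"] \<psi>_meas by simp
  also have "\<dots> = (\<integral>\<^sup>+t. \<psi> (t - r) * indicator {r..} t \<partial>lborel)"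
    by (auto intro!: nn_integral_cong simp: indicator_def)
  finally have J: "J = (\<integral>\<^sup>+t. \<psi> (t - r) * indicator {r..} t \<partial>lborel)" .
  have "(\<integral>\<^sup>+t\<in>{0..}. \<nu> (B t) \<partial>lborel) =
      (\<integral>\<^sup>+t. \<nu> U * indicator {0..<r} t + \<psi> (t - r) * indicator {r..} t \<partial>lborel)"
    using r by (intro nn_integral_cong) (auto simp: indicator_def B_def \<psi>_def)
  also have "\<dots> = \<nu> U * r + J"
    using r \<psi>_meas unfolding J by (subst nn_integral_add) (auto simp: nn_integral_cmult_indicator)
  finally have intB: "(\<integral>\<^sup>+t\<in>{0..}. \<nu> (B t) \<partial>lborel) = \<nu> U * r + J" .
  have "B t \<subseteq> B s" if "s \<le> t" for s t
    using level_antitone[of "s - r" "t - r" f] that by (auto simp: B_def A_def)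
  then have B_meas: "(\<lambda>t. \<nu> (B t)) \<in> borel_measurable borel"
    by (intro antitone_borel_measurable continuous_valuationD(3)[OF \<nu>] B)
  have "val_integral X \<nu> ?g + J
      = (\<integral>\<^sup>+t. \<nu> {x. ennreal t < ?g x} * indicator {0..} t + \<psi> t * indicator {0..} t \<partial>lborel)"
    unfolding val_integral_lsc[OF g] J_def using g_meas \<psi>_meas by (intro nn_integral_add[symmetric]) auto
  also have "\<dots> = (\<integral>\<^sup>+t. \<nu> (A t) * indicator {0..} t + \<nu> (B t) * indicator {0..} t \<partial>lborel)"
    using level by (intro nn_integral_cong) (auto simp: indicator_def)
  also have "\<dots> = val_integral X \<nu> f + (\<nu> U * r + J)"
    unfolding val_integral_lsc[OF f] intB[symmetric] A_def[symmetric]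
    using A_meas B_meas by (intro nn_integral_add) auto
  finally have main: "val_integral X \<nu> ?g + J = (val_integral X \<nu> f + a * \<nu> U) + J"
    by (simp add: r ac_simps)
  have "J \<le> val_integral X \<nu> f"
    unfolding val_integral_lsc[OF f] J_def \<psi>_def A_def
    by (intro nn_integral_mono mult_right_mono continuous_valuationD(3)[OF \<nu>] openin_Int lsc_openin f U) auto
  moreover have "val_integral X \<nu> f \<le> val_integral X \<nu> ?g"
    by (intro val_integral_mono[OF \<nu> f g]) (auto simp: le_fun_def)
  ultimately show ?thesis
    using main by (cases "J = top") (auto simp: top_unique add.commute[of _ J] ennreal_add_left_cancel)
qed

section \<open>Dyadic approximation, linearity and Scott continuity\<close>

text \<open>
  The value at \<open>x\<close> is the number of \<open>k\<close> with \<open>1 \<le> k \<le> n * 2 ^ n\<close> and \<open>k / 2 ^ n < h x\<close>, divided by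
  \<open>2 ^ n\<close>. Strict inequality makes each term the indicator of an open set.
\<close>
definition dyadic :: "nat \<Rightarrow> ('a \<Rightarrow> ennreal) \<Rightarrow> 'a \<Rightarrow> ennreal" where
  "dyadic n h = (\<lambda>x. \<Sum>j<n * 2 ^ n.
     ennreal (1 / 2 ^ n) * indicator {x. ennreal (real (Suc j) / 2 ^ n) < h x} x)"

lemma sum_scaled_const_ennreal: "(\<Sum>j<m. ennreal (1 / 2 ^ n)) = ennreal (real m / 2 ^ n)"
  by (simp add: ennreal_of_nat_eq_real_of_nat ennreal_mult'[symmetric])

lemma dyadic_le: "dyadic n h x \<le> h x"
proof -
  let ?T = "\<lambda>m. \<Sum>j<m. ennreal (1 / 2 ^ n) * indicator {x. ennreal (real (Suc j) / 2 ^ n) < h x} x"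
  have "?T m \<le> h x" for m
  proof (induction m)
    case (Suc m)
    show ?case
    proof (cases "ennreal (real (Suc m) / 2 ^ n) < h x")
      case True
      have "?T (Suc m) \<le> (\<Sum>j<Suc m. ennreal (1 / 2 ^ n))"
        by (intro sum_mono) (auto simp: indicator_def)
      also have "\<dots> \<le> h x"
        unfolding sum_scaled_const_ennreal using True by simp
      finally show ?thesis .
    qed (use Suc in simp)
  qed simp
  then show ?thesis by (simp add: dyadic_def)
qed

lemma sum_pairs:
  fixes a :: "nat \<Rightarrow> ennreal"
  shows "(\<Sum>j<m * 2. a j) = (\<Sum>j<m. a (2 * j) + a (2 * j + 1))"
  by (induction m) (simp_all add: add.assoc mult.commute)

text \<open>
  Each step of length \<open>1 / 2 ^ n\<close> is covered by two steps of half that length.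
\<close>
lemma incseq_dyadic: "incseq (\<lambda>n. dyadic n h)"
proof (rule incseq_SucI, rule le_funI)
  fix n x
  let ?a = "\<lambda>n j. ennreal (1 / 2 ^ n) * indicator {x. ennreal (real (Suc j) / 2 ^ n) < h x} x"
  have pair: "?a n j \<le> ?a (Suc n) (2 * j) + ?a (Suc n) (2 * j + 1)" for j
  proof (cases "ennreal (real (Suc j) / 2 ^ n) < h x")
    case True
    have "real (Suc (2 * j)) / 2 ^ Suc n \<le> real (Suc j) / 2 ^ n"
      "real (Suc (2 * j + 1)) / 2 ^ Suc n = real (Suc j) / 2 ^ n"
      by (simp_all add: field_simps)
    then have "ennreal (real (Suc (2 * j)) / 2 ^ Suc n) < h x"
      "ennreal (real (Suc (2 * j + 1)) / 2 ^ Suc n) < h x"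
      using True order_le_less_trans[OF ennreal_leI True] by simp_all
    then have "?a (Suc n) (2 * j) + ?a (Suc n) (2 * j + 1) = ennreal (1 / 2 ^ Suc n) + ennreal (1 / 2 ^ Suc n)"
      by simp
    also have "\<dots> = ennreal (1 / 2 ^ n)"
      by (subst ennreal_plus[symmetric]) (simp_all add: field_simps)
    finally show ?thesis by (simp add: indicator_def)
  qed simp
  have "dyadic n h x \<le> (\<Sum>j<n * 2 ^ n. ?a (Suc n) (2 * j) + ?a (Suc n) (2 * j + 1))"
    unfolding dyadic_def by (intro sum_mono pair)
  also have "\<dots> = (\<Sum>j<n * 2 ^ n * 2. ?a (Suc n) j)"
    by (rule sum_pairs[symmetric])
  also have "\<dots> \<le> dyadic (Suc n) h x"
    unfolding dyadic_def by (intro sum_mono2) auto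
  finally show "dyadic n h x \<le> dyadic (Suc n) h x" .
qed

lemma SUP_dyadic: "(SUP n. dyadic n h x) = h x"
proof (rule antisym)
  show "(SUP n. dyadic n h x) \<le> h x"
    by (intro SUP_least dyadic_le)
  show "h x \<le> (SUP n. dyadic n h x)"
  proof (rule dense_le)
    fix s assume s: "s < h x"
    then obtain r where r: "s = ennreal r" "0 \<le> r"
      by (cases s) (auto simp: top_unique)
    obtain s' where s': "s < s'" "s' < h x" using s dense by blast
    then obtain r' where r': "s' = ennreal r'" "0 \<le> r'"
      by (cases s') (auto simp: top_unique)
    have rr': "r < r'" using s' r r' by (simp add: ennreal_less_iff)
    obtain n1 where n1: "1 / 2 ^ n1 < r' - r"
      using reals_power_lt_ex[of "r' - r" 2] rr' by (auto simp: power_one_over inverse_eq_divide)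
    obtain n2 where n2: "r + 1 \<le> real n2" using real_arch_simple by blast
    define n where "n = max n1 n2"
    have "(1::real) / 2 ^ n \<le> 1 / 2 ^ n1"
      by (intro divide_left_mono power_increasing) (auto simp: n_def)
    then have n: "1 / 2 ^ n < r' - r" "r + 1 \<le> real n"
      using n1 n2 by (auto simp: n_def)
    define m where "m = nat \<lceil>r * 2 ^ n\<rceil>"
    have m: "r * 2 ^ n \<le> real m" "real m < r * 2 ^ n + 1"
      unfolding m_def using r by (auto simp: ceiling_correct) linarith+
    have lo: "r \<le> real m / 2 ^ n" and hi: "real m / 2 ^ n < r'"
    proof -
      show "r \<le> real m / 2 ^ n" using m by (simp add: field_simps)
      have "real m / 2 ^ n < (r * 2 ^ n + 1) / 2 ^ n"
        using m by (intro divide_strict_right_mono) auto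
      also have "\<dots> = r + 1 / 2 ^ n" by (simp add: field_simps)
      finally show "real m / 2 ^ n < r'" using n by linarith
    qed
    have "(1::real) \<le> 2 ^ n" by simp
    then have "real m \<le> (r + 1) * 2 ^ n"
      using m unfolding distrib_right by linarith
    also have "\<dots> \<le> real n * 2 ^ n" using n by (intro mult_right_mono) auto
    finally have "m \<le> n * 2 ^ n"
      by (metis of_nat_le_iff of_nat_mult of_nat_numeral of_nat_power)
    have "s \<le> ennreal (real m / 2 ^ n)" using lo r by (simp add: ennreal_leI)
    also have "\<dots> = (\<Sum>j<m. ennreal (1 / 2 ^ n))"
      by (rule sum_scaled_const_ennreal[symmetric])
    also have "\<dots> \<le> (\<Sum>j<m. ennreal (1 / 2 ^ n) * indicator {x. ennreal (real (Suc j) / 2 ^ n) < h x} x)"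
    proof (intro sum_mono)
      fix j assume "j \<in> {..<m}"
      then have "real (Suc j) / 2 ^ n \<le> real m / 2 ^ n" by (intro divide_right_mono) auto
      then have "ennreal (real (Suc j) / 2 ^ n) \<le> ennreal r'" using hi by (intro ennreal_leI) linarith
      also have "\<dots> < h x" using s' r' by simp
      finally show "ennreal (1 / 2 ^ n) \<le> ennreal (1 / 2 ^ n) * indicator {x. ennreal (real (Suc j) / 2 ^ n) < h x} x"
        by simp
    qed
    also have "\<dots> \<le> dyadic n h x"
      unfolding dyadic_def using \<open>m \<le> n * 2 ^ n\<close> by (intro sum_mono2) auto
    also have "\<dots> \<le> (SUP n. dyadic n h x)" by (rule SUP_upper) simp
    finally show "s \<le> (SUP n. dyadic n h x)" .
  qed
qed

lemma pow2_inverse_pos_finite: "0 < ennreal (1 / 2 ^ n)" "ennreal (1 / 2 ^ n) < top"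
  by simp_all

lemma lsc_sum_scaled:
  fixes m :: nat
  assumes "\<And>j. F j \<in> lsc X"
  shows "(\<lambda>x. \<Sum>j<m. ennreal (1 / 2 ^ n) * F j x) \<in> lsc X"
proof (induction m)
  case (Suc m)
  show ?case
    unfolding sum.lessThan_Suc by (rule lsc_add[OF Suc lsc_scale[OF assms pow2_inverse_pos_finite]])
qed (simp add: lsc_zero)

lemma lsc_dyadic: "h \<in> lsc X \<Longrightarrow> dyadic n h \<in> lsc X"
  unfolding dyadic_def by (intro lsc_sum_scaled lsc_indicator lsc_openin)

lemma function_cone_lsc: "function_cone (lsc X)"
  by unfold_locales (auto intro: lsc_zero lsc_add lsc_scale)

definition linear_scott_on :: "('a \<Rightarrow> ennreal) set \<Rightarrow> (('a \<Rightarrow> ennreal) \<Rightarrow> ennreal) \<Rightarrow> bool" where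
  "linear_scott_on C L \<longleftrightarrow> sublinear_on C L \<and> superlinear_on C L \<and> scott_on C L"

lemma linear_scott_onD:
  assumes "linear_scott_on C L"
  shows "L (\<lambda>_. 0) = 0"
    and "f \<in> C \<Longrightarrow> g \<in> C \<Longrightarrow> f \<le> g \<Longrightarrow> L f \<le> L g"
    and "f \<in> C \<Longrightarrow> 0 < a \<Longrightarrow> a < top \<Longrightarrow> L (\<lambda>x. a * f x) = a * L f"
    and "f \<in> C \<Longrightarrow> g \<in> C \<Longrightarrow> L (\<lambda>x. f x + g x) = L f + L g"
    and "D \<subseteq> C \<Longrightarrow> directed_family D \<Longrightarrow> Sup D \<in> C \<Longrightarrow> L (Sup D) = (SUP f\<in>D. L f)"
proof -
  note sub = sublinear_onD[OF assms[unfolded linear_scott_on_def, THEN conjunct1]]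
  note sup = superlinear_onD[OF assms[unfolded linear_scott_on_def, THEN conjunct2, THEN conjunct1]]
  note sc = scott_onD[OF assms[unfolded linear_scott_on_def, THEN conjunct2, THEN conjunct2]]
  show "L (\<lambda>_. 0) = 0" by (rule sub(1))
  show "f \<in> C \<Longrightarrow> g \<in> C \<Longrightarrow> f \<le> g \<Longrightarrow> L f \<le> L g" by (rule sub(2))
  show "f \<in> C \<Longrightarrow> 0 < a \<Longrightarrow> a < top \<Longrightarrow> L (\<lambda>x. a * f x) = a * L f" by (rule sub(3))
  show "f \<in> C \<Longrightarrow> g \<in> C \<Longrightarrow> L (\<lambda>x. f x + g x) = L f + L g" by (rule antisym[OF sub(4) sup(4)])
  show "D \<subseteq> C \<Longrightarrow> directed_family D \<Longrightarrow> Sup D \<in> C \<Longrightarrow> L (Sup D) = (SUP f\<in>D. L f)" by (rule sc(2))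
qed

lemma linear_scott_onI:
  assumes "L (\<lambda>_. 0) = 0"
    and "\<And>f g. f \<in> C \<Longrightarrow> g \<in> C \<Longrightarrow> f \<le> g \<Longrightarrow> L f \<le> L g"
    and "\<And>f a. f \<in> C \<Longrightarrow> 0 < a \<Longrightarrow> a < top \<Longrightarrow> L (\<lambda>x. a * f x) = a * L f"
    and "\<And>f g. f \<in> C \<Longrightarrow> g \<in> C \<Longrightarrow> L (\<lambda>x. f x + g x) = L f + L g"
    and "\<And>D. D \<subseteq> C \<Longrightarrow> directed_family D \<Longrightarrow> Sup D \<in> C \<Longrightarrow> L (Sup D) = (SUP f\<in>D. L f)"
  shows "linear_scott_on C L"
  unfolding linear_scott_on_def sublinear_on_def superlinear_on_def scott_on_def
  by (intro conjI ballI allI impI; (elim conjE)?) (simp_all add: assms)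

lemma directed_family_range:
  assumes "incseq f"
  shows "directed_family (range f)"
  unfolding directed_family_def
proof (intro conjI ballI)
  fix u v assume "u \<in> range f" "v \<in> range f"
  then obtain m n where "u = f m" "v = f n" by blast
  then have "u \<le> f (max m n)" "v \<le> f (max m n)"
    using assms by (auto simp: incseq_def)
  then show "\<exists>w\<in>range f. u \<le> w \<and> v \<le> w" by blast
qed simp

text \<open>
  The dyadic approximations of \<open>h\<close> form a chain with supremum \<open>h\<close>. Hence a linear Scott-continuous
  functional is determined by its values on indicators of open sets.
\<close>
lemma linear_scott_on_dyadic:
  assumes L: "linear_scott_on (lsc X) L" and h: "h \<in> lsc X"
  shows "L h = (SUP n. \<Sum>j<n * 2 ^ n. ennreal (1 / 2 ^ n) * L (indicator {x. ennreal (real (Suc j) / 2 ^ n) < h x}))"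
proof -
  let ?U = "\<lambda>n j. {x. ennreal (real (Suc j) / 2 ^ n) < h x}"
  have U: "openin X (?U n j)" for n j by (rule lsc_openin[OF h])
  have sum: "L (\<lambda>x. \<Sum>j<m. ennreal (1 / 2 ^ n) * indicator (?U n j) x)
      = (\<Sum>j<m. ennreal (1 / 2 ^ n) * L (indicator (?U n j)))" for m n :: nat
  proof (induction m)
    case (Suc m)
    have "L (\<lambda>x. (\<Sum>j<m. ennreal (1 / 2 ^ n) * indicator (?U n j) x) + ennreal (1 / 2 ^ n) * indicator (?U n m) x)
      = L (\<lambda>x. \<Sum>j<m. ennreal (1 / 2 ^ n) * indicator (?U n j) x) + ennreal (1 / 2 ^ n) * L (indicator (?U n m))"
      by (subst linear_scott_onD(4)[OF L lsc_sum_scaled[OF lsc_indicator[OF U]] lsc_scale[OF lsc_indicator[OF U] pow2_inverse_pos_finite]],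
          subst linear_scott_onD(3)[OF L lsc_indicator[OF U] pow2_inverse_pos_finite]) (rule refl)
    then show ?case by (simp only: sum.lessThan_Suc Suc)
  qed (simp add: linear_scott_onD(1)[OF L])
  have eq: "Sup (range (\<lambda>n. dyadic n h)) = h"
    by (simp add: fun_eq_iff image_image SUP_dyadic)
  have "L (Sup (range (\<lambda>n. dyadic n h))) = (SUP f\<in>range (\<lambda>n. dyadic n h). L f)"
    by (rule linear_scott_onD(5)[OF L _ directed_family_range[OF incseq_dyadic]])
      (use lsc_dyadic[OF h] eq h in auto)
  then show ?thesis
    unfolding eq by (simp only: image_image dyadic_def sum)
qed

lemma linear_scott_on_eqI:
  assumes "linear_scott_on (lsc X) L" "linear_scott_on (lsc X) M"
    and "\<And>U. openin X U \<Longrightarrow> L (indicator U) = M (indicator U)" and "h \<in> lsc X"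
  shows "L h = M h"
  unfolding linear_scott_on_dyadic[OF assms(1,4)] linear_scott_on_dyadic[OF assms(2,4)]
  using assms(3)[OF lsc_openin[OF assms(4)]] by simp

lemma val_integral_add_sum_indicator:
  fixes m :: nat
  assumes \<nu>: "continuous_valuation X \<nu>" and f: "f \<in> lsc X" and U: "\<And>j. openin X (U j)"
  shows "val_integral X \<nu> (\<lambda>x. f x + (\<Sum>j<m. ennreal (1 / 2 ^ n) * indicator (U j) x))
    = val_integral X \<nu> f + (\<Sum>j<m. ennreal (1 / 2 ^ n) * \<nu> (U j))"
proof (induction m)
  case (Suc m)
  have "val_integral X \<nu> (\<lambda>x. (f x + (\<Sum>j<m. ennreal (1 / 2 ^ n) * indicator (U j) x))
      + ennreal (1 / 2 ^ n) * indicator (U m) x)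
    = val_integral X \<nu> f + (\<Sum>j<m. ennreal (1 / 2 ^ n) * \<nu> (U j)) + ennreal (1 / 2 ^ n) * \<nu> (U m)"
    by (subst val_integral_add_indicator[OF \<nu> lsc_add[OF f lsc_sum_scaled[OF lsc_indicator[OF U]]] U pow2_inverse_pos_finite])
      (simp only: Suc)
  then show ?case by (simp add: add.assoc)
qed simp

text \<open>
  Additivity in the second summand, reduced to indicators by approximating it from below. Taking
  \<open>f = 0\<close> identifies the supremum as the integral of \<open>g\<close>.
\<close>
lemma val_integral_add_dyadic:
  assumes \<nu>: "continuous_valuation X \<nu>" and f: "f \<in> lsc X" and g: "g \<in> lsc X"
  shows "val_integral X \<nu> (\<lambda>x. f x + g x) = val_integral X \<nu> f +
    (SUP n. \<Sum>j<n * 2 ^ n. ennreal (1 / 2 ^ n) * \<nu> {x. ennreal (real (Suc j) / 2 ^ n) < g x})"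
proof -
  have "(\<lambda>x. f x + g x) = (\<lambda>x. SUP n. f x + dyadic n g x)"
    by (simp add: fun_eq_iff ennreal_SUP_add_right[symmetric] SUP_dyadic)
  moreover have "incseq (\<lambda>n x. f x + dyadic n g x)"
    using incseq_dyadic[of g] unfolding incseq_def le_fun_def by (simp add: add_left_mono)
  ultimately have "val_integral X \<nu> (\<lambda>x. f x + g x) = (SUP n. val_integral X \<nu> (\<lambda>x. f x + dyadic n g x))"
    using val_integral_SUP_seq[OF \<nu> lsc_add[OF f lsc_dyadic[OF g]]] by simp
  also have "\<dots> = (SUP n. val_integral X \<nu> f +
      (\<Sum>j<n * 2 ^ n. ennreal (1 / 2 ^ n) * \<nu> {x. ennreal (real (Suc j) / 2 ^ n) < g x}))"
    unfolding dyadic_def by (simp only: val_integral_add_sum_indicator[OF \<nu> f lsc_openin[OF g]])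
  finally show ?thesis
    by (simp add: ennreal_SUP_add_right)
qed

lemma val_integral_dyadic:
  assumes \<nu>: "continuous_valuation X \<nu>" and g: "g \<in> lsc X"
  shows "val_integral X \<nu> g =
    (SUP n. \<Sum>j<n * 2 ^ n. ennreal (1 / 2 ^ n) * \<nu> {x. ennreal (real (Suc j) / 2 ^ n) < g x})"
  using val_integral_add_dyadic[OF \<nu> lsc_zero g] by (simp add: val_integral_zero[OF \<nu>])

text \<open>
  Monotone convergence of Lebesgue integrals fails for directed families in general. Here the dyadic
  formula expresses the integral by suprema and finite sums of the values of the valuation on level
  sets, and these commute with directed suprema.
\<close>
theorem linear_scott_val_integral:
  assumes \<nu>: "continuous_valuation X \<nu>"
  shows "linear_scott_on (lsc X) (val_integral X \<nu>)"
proof (rule linear_scott_onI)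
  show "val_integral X \<nu> (\<lambda>x. f x + g x) = val_integral X \<nu> f + val_integral X \<nu> g"
    if "f \<in> lsc X" "g \<in> lsc X" for f g
    unfolding val_integral_add_dyadic[OF \<nu> that] val_integral_dyadic[OF \<nu> that(2)] by (rule refl)
  show "val_integral X \<nu> (Sup D) = (SUP f\<in>D. val_integral X \<nu> f)"
    if D: "D \<subseteq> lsc X" "directed_family D" "Sup D \<in> lsc X" for D
  proof -
    let ?U = "\<lambda>n j f. {x. ennreal (real (Suc j) / 2 ^ n) < f x}"
    have ne: "D \<noteq> {}" using D by (simp add: directed_family_def)
    have dir: "\<exists>h\<in>D. f \<le> h \<and> g \<le> h" if "f \<in> D" "g \<in> D" for f g
      using D(2) that by (auto simp: directed_family_def)
    have lev: "\<nu> (?U n j (Sup D)) = (SUP f\<in>D. \<nu> (?U n j f))" for n j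
    proof -
      have eq: "?U n j (Sup D) = \<Union> (?U n j ` D)"
        by (auto simp: less_SUP_iff)
      have "\<nu> (\<Union> (?U n j ` D)) = (SUP V\<in>?U n j ` D. \<nu> V)"
      proof (rule continuous_valuationD(4)[OF \<nu>])
        show "?U n j ` D \<noteq> {}" using ne by simp
        show "openin X V" if "V \<in> ?U n j ` D" for V using that D(1) lsc_openin by blast
        fix V W assume "V \<in> ?U n j ` D" "W \<in> ?U n j ` D"
        then obtain f g where fg: "f \<in> D" "g \<in> D" "V = ?U n j f" "W = ?U n j g" by blast
        then obtain h where h: "h \<in> D" "f \<le> h" "g \<le> h" using dir by blast
        show "\<exists>S\<in>?U n j ` D. V \<subseteq> S \<and> W \<subseteq> S"
          unfolding fg using h level_subset by (intro bexI[of _ "?U n j h"]) (simp_all add: level_subset)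
      qed
      then show ?thesis by (simp only: eq image_image)
    qed
    have "val_integral X \<nu> (Sup D) = (SUP n. \<Sum>j<n * 2 ^ n. SUP f\<in>D. ennreal (1 / 2 ^ n) * \<nu> (?U n j f))"
      by (simp only: val_integral_dyadic[OF \<nu> D(3)] lev SUP_mult_left_ennreal)
    also have "\<dots> = (SUP n. SUP f\<in>D. \<Sum>j<n * 2 ^ n. ennreal (1 / 2 ^ n) * \<nu> (?U n j f))"
    proof (intro SUP_cong refl SUP_sum_directed ne)
      fix n f g assume fg: "f \<in> D" "g \<in> D"
      then obtain h where h: "h \<in> D" "f \<le> h" "g \<le> h" using dir by blast
      then show "\<exists>k\<in>D. \<forall>j. ennreal (1 / 2 ^ n) * \<nu> (?U n j f) \<le> ennreal (1 / 2 ^ n) * \<nu> (?U n j k)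
          \<and> ennreal (1 / 2 ^ n) * \<nu> (?U n j g) \<le> ennreal (1 / 2 ^ n) * \<nu> (?U n j k)"
        using fg D(1)
        by (intro bexI[of _ h] allI conjI mult_left_mono continuous_valuationD(3)[OF \<nu>] lsc_openin level_subset) auto
    qed
    also have "\<dots> = (SUP f\<in>D. SUP n. \<Sum>j<n * 2 ^ n. ennreal (1 / 2 ^ n) * \<nu> (?U n j f))"
      by (rule SUP_commute)
    also have "\<dots> = (SUP f\<in>D. val_integral X \<nu> f)"
      using D(1) val_integral_dyadic[OF \<nu>] by (intro SUP_cong) auto
    finally show ?thesis .
  qed
qed (auto intro: val_integral_zero[OF \<nu>] val_integral_mono[OF \<nu>] val_integral_scale[OF \<nu>])

text \<open>
  The representation of linear Scott-continuous functionals by valuations. It is restricted to open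
  sets because equality of valuations is equality of functions.
\<close>
definition valuation_of :: "'a topology \<Rightarrow> (('a \<Rightarrow> ennreal) \<Rightarrow> ennreal) \<Rightarrow> 'a set \<Rightarrow> ennreal" where
  "valuation_of X L = (\<lambda>U\<in>{U. openin X U}. L (indicator U))"

lemma directed_family_indicator:
  assumes "D \<noteq> {}" "\<And>U V. U \<in> D \<Longrightarrow> V \<in> D \<Longrightarrow> \<exists>W\<in>D. U \<subseteq> W \<and> V \<subseteq> W"
  shows "directed_family (indicator ` D)"
  unfolding directed_family_def
proof (intro conjI ballI)
  fix f g :: "'a \<Rightarrow> ennreal" assume "f \<in> indicator ` D" "g \<in> indicator ` D"
  then obtain U V where UV: "U \<in> D" "V \<in> D" "f = indicator U" "g = indicator V" by blast
  then obtain W where "W \<in> D" "U \<subseteq> W" "V \<subseteq> W" using assms(2) by blast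
  then show "\<exists>h\<in>indicator ` D. f \<le> h \<and> g \<le> h"
    unfolding UV by (intro bexI[of _ "indicator W"]) (auto simp: le_fun_def indicator_def)
qed (use assms in simp)

text \<open>
  Modularity is the identity \<open>1[U] + 1[V] = 1[U \<union> V] + 1[U \<inter> V]\<close> of indicators.
\<close>
lemma continuous_valuation_of:
  assumes L: "linear_scott_on (lsc X) L"
  shows "continuous_valuation X (valuation_of X L)"
  unfolding continuous_valuation_def
proof (intro conjI allI impI)
  have val: "valuation_of X L U = L (indicator U)" if "openin X U" for U
    using that by (simp add: valuation_of_def)
  show "valuation_of X L \<in> extensional {U. openin X U}" by (simp add: valuation_of_def)
  have "(indicator {} :: 'a \<Rightarrow> ennreal) = (\<lambda>_. 0)" by auto
  then show "valuation_of X L {} = 0" using val[of "{}"] linear_scott_onD(1)[OF L] by simp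
  fix U V assume "openin X U \<and> openin X V"
  then have UV: "openin X U" "openin X V" "openin X (U \<union> V)" "openin X (U \<inter> V)" by auto
  have "(\<lambda>x. indicator U x + indicator V x) = (\<lambda>x. indicator (U \<union> V) x + indicator (U \<inter> V) x :: ennreal)"
    by (auto simp: indicator_def fun_eq_iff)
  then have "L (indicator U) + L (indicator V) = L (indicator (U \<union> V)) + L (indicator (U \<inter> V))"
    by (simp only: linear_scott_onD(4)[OF L lsc_indicator lsc_indicator, symmetric] UV)
  then show "valuation_of X L U + valuation_of X L V = valuation_of X L (U \<union> V) + valuation_of X L (U \<inter> V)"
    using UV by (simp add: val)
next
  fix U V assume UV: "openin X U \<and> openin X V \<and> U \<subseteq> V"
  then have "indicator U \<le> (indicator V :: 'a \<Rightarrow> ennreal)" by (auto simp: indicator_def le_fun_def)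
  then show "valuation_of X L U \<le> valuation_of X L V"
    using UV linear_scott_onD(2)[OF L lsc_indicator lsc_indicator] by (simp add: valuation_of_def)
next
  fix D assume D: "D \<noteq> {} \<and> (\<forall>U\<in>D. openin X U) \<and> (\<forall>U\<in>D. \<forall>V\<in>D. \<exists>W\<in>D. U \<subseteq> W \<and> V \<subseteq> W)"
  let ?I = "indicator :: 'a set \<Rightarrow> 'a \<Rightarrow> ennreal"
  have S: "Sup (?I ` D) = ?I (\<Union>D)"
  proof (rule ext)
    fix x
    show "Sup (?I ` D) x = ?I (\<Union>D) x"
    proof (cases "x \<in> \<Union>D")
      case True
      then obtain U where "U \<in> D" "x \<in> U" by blast
      then have "1 \<le> (SUP U\<in>D. ?I U x)" by (intro SUP_upper2[of U]) auto
      moreover have "(SUP U\<in>D. ?I U x) \<le> 1" by (intro SUP_least) (auto simp: indicator_def)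
      ultimately have "(SUP U\<in>D. ?I U x) = 1" by (rule antisym[rotated])
      then show ?thesis using True by (simp only: Sup_apply image_image indicator_simps)
    next
      case False
      then have "?I U x = 0" if "U \<in> D" for U using that by simp
      then have "(SUP U\<in>D. ?I U x) = (SUP U\<in>D. 0)" by (intro SUP_cong refl)
      also have "\<dots> = 0" using D by simp
      finally show ?thesis
        unfolding Sup_apply image_image indicator_simps(2)[OF False] .
    qed
  qed
  have "directed_family (?I ` D)"
    using D by (intro directed_family_indicator) blast+
  then have "L (Sup (?I ` D)) = (SUP f\<in>?I ` D. L f)"
    by (rule linear_scott_onD(5)[OF L, rotated]) (use D S lsc_indicator in \<open>auto intro!: lsc_indicator\<close>)
  then have "L (?I (\<Union>D)) = (SUP U\<in>D. L (?I U))" by (simp only: S image_image)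
  also have "\<dots> = (SUP U\<in>D. valuation_of X L U)"
    using D by (intro SUP_cong) (auto simp: valuation_of_def)
  finally show "valuation_of X L (\<Union>D) = (SUP U\<in>D. valuation_of X L U)"
    using D by (simp add: valuation_of_def openin_Union)
qed

theorem val_integral_valuation_of:
  assumes L: "linear_scott_on (lsc X) L" and h: "h \<in> lsc X"
  shows "val_integral X (valuation_of X L) h = L h"
proof (rule linear_scott_on_eqI[OF linear_scott_val_integral[OF continuous_valuation_of[OF L]] L _ h])
  fix U assume "openin X U"
  then show "val_integral X (valuation_of X L) (indicator U) = L (indicator U)"
    by (subst val_integral_indicator[OF continuous_valuation_of[OF L]]) (simp_all add: valuation_of_def)
qed

section \<open>The lower integral of a valuation on compact saturated sets\<close>

lemma Q_carrier_subset: "Q \<in> Q_carrier X \<Longrightarrow> Q \<subseteq> topspace X"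
  by (simp add: Q_carrier_def saturated_in_def)

lemma Q_carrier_nonempty: "Q \<in> Q_carrier X \<Longrightarrow> Q \<noteq> {}"
  by (simp add: Q_carrier_def)

lemma openin_Q_box: "openin X U \<Longrightarrow> openin (Q_space X) (Q_box X U)"
  unfolding Q_space_def by (rule topology_generated_by_Basis) blast

lemma Q_box_topspace: "Q_box X (topspace X) = Q_carrier X"
  using Q_carrier_subset by (auto simp: Q_box_def)

text \<open>
  On non-empty compact sets the infimum of a lower semicontinuous function is a minimum. Outside the
  carrier the value is 0, as membership in \<open>lsc\<close> demands.
\<close>
definition min_on :: "'a topology \<Rightarrow> ('a \<Rightarrow> ennreal) \<Rightarrow> 'a set \<Rightarrow> ennreal" where
  "min_on X h = (\<lambda>Q. if Q \<in> Q_carrier X then INF x\<in>Q. h x else 0)"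

lemma min_on_level_subset: "{Q. t < min_on X h Q} \<subseteq> Q_box X {x. t < h x}"
  by (auto simp: min_on_def Q_box_def split: if_splits intro: less_INF_D)

text \<open>
  The infimum over \<open>Q\<close> exceeds \<open>t\<close> iff \<open>Q\<close> lies in the open set \<open>{x. s < h x}\<close> for some \<open>s > t\<close>.
\<close>
lemma min_on_lsc:
  assumes "h \<in> lsc X"
  shows "min_on X h \<in> lsc (Q_space X)"
proof -
  have "{Q. t < min_on X h Q} = (\<Union>s\<in>{t<..}. Q_box X {x. s < h x})" for t
  proof (intro equalityI subsetI)
    fix Q assume "Q \<in> {Q. t < min_on X h Q}"
    then have t: "t < min_on X h Q" by simp
    then obtain s where s: "t < s" "s < min_on X h Q" using dense by blast
    then show "Q \<in> (\<Union>s\<in>{t<..}. Q_box X {x. s < h x})"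
      using min_on_level_subset[of s X h] by blast
  next
    fix Q assume "Q \<in> (\<Union>s\<in>{t<..}. Q_box X {x. s < h x})"
    then obtain s where s: "t < s" "Q \<in> Q_carrier X" "Q \<subseteq> {x. s < h x}"
      by (auto simp: Q_box_def)
    then have "s \<le> (INF x\<in>Q. h x)" by (intro INF_greatest) (auto intro: less_imp_le)
    then show "Q \<in> {Q. t < min_on X h Q}" using s by (simp add: min_on_def)
  qed
  then show ?thesis
    using openin_Q_box[OF lsc_openin[OF assms]] by (auto simp: lsc_def intro!: openin_Union)
qed

lemma min_on_mono: "f \<le> g \<Longrightarrow> min_on X f \<le> min_on X g"
  by (auto simp: min_on_def le_fun_def intro!: INF_mono)

lemma min_on_zero: "min_on X (\<lambda>_. 0) = (\<lambda>_. 0)"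
  by (rule ext) (simp add: min_on_def Q_carrier_nonempty)

lemma min_on_scale:
  assumes a: "0 < a" "a < top"
  shows "min_on X (\<lambda>x. a * h x) = (\<lambda>Q. a * min_on X h Q)"
proof -
  have "(INF x\<in>Q. a * h x) = a * (INF x\<in>Q. h x)" for Q
  proof (rule antisym)
    show "a * (INF x\<in>Q. h x) \<le> (INF x\<in>Q. a * h x)"
      by (intro INF_greatest mult_left_mono INF_lower) auto
    have "inverse a * (INF x\<in>Q. a * h x) \<le> (INF x\<in>Q. h x)"
    proof (rule INF_greatest)
      fix x assume "x \<in> Q"
      then show "inverse a * (INF x\<in>Q. a * h x) \<le> h x"
        unfolding inverse_mult_le_iff[OF a] by (rule INF_lower)
    qed
    then show "(INF x\<in>Q. a * h x) \<le> a * (INF x\<in>Q. h x)"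
      by (simp add: inverse_mult_le_iff[OF a])
  qed
  then show ?thesis by (simp add: min_on_def fun_eq_iff)
qed

lemma min_on_superadditive:
  "min_on X f Q + min_on X g Q \<le> min_on X (\<lambda>x. f x + g x) Q"
  by (auto simp: min_on_def intro!: INF_greatest add_mono INF_lower)

lemma min_on_add_const:
  "min_on X (\<lambda>x. h x + c * indicator (topspace X) x) = (\<lambda>Q. min_on X h Q + c * indicator (Q_carrier X) Q)"
proof (rule ext)
  fix Q
  show "min_on X (\<lambda>x. h x + c * indicator (topspace X) x) Q = min_on X h Q + c * indicator (Q_carrier X) Q"
  proof (cases "Q \<in> Q_carrier X")
    case True
    have "(INF x\<in>Q. h x + c * indicator (topspace X) x) = (INF x\<in>Q. h x + c)"
      using Q_carrier_subset[OF True] by (intro INF_cong) (auto simp: indicator_def)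
    also have "\<dots> = (INF x\<in>Q. h x) + c"
      by (rule INF_add_const_ennreal[OF Q_carrier_nonempty[OF True]])
    finally show ?thesis using True by (simp add: min_on_def)
  qed (simp add: min_on_def)
qed

lemma min_on_indicator: "min_on X (indicator U) = indicator (Q_box X U)"
proof (rule ext)
  fix Q
  show "min_on X (indicator U) Q = indicator (Q_box X U) Q"
  proof (cases "Q \<in> Q_carrier X")
    case True
    show ?thesis
    proof (cases "Q \<subseteq> U")
      case sub: True
      have "(INF x\<in>Q. indicator U x :: ennreal) = (INF x\<in>Q. 1)"
        using sub by (intro INF_cong) auto
      then show ?thesis
        using True sub Q_carrier_nonempty[OF True] by (simp add: min_on_def Q_box_def)
    next
      case False
      then obtain x where "x \<in> Q" "x \<notin> U" by blast
      then have "(INF x\<in>Q. indicator U x :: ennreal) \<le> 0"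
        by (intro INF_lower2[of x]) auto
      then show ?thesis using True False by (simp add: min_on_def Q_box_def)
    qed
  qed (simp add: min_on_def Q_box_def)
qed

text \<open>
  If \<open>Sup D\<close> exceeds \<open>t\<close> on the compact set \<open>Q\<close>, then the directed open level sets of the members of \<open>D\<close>
  cover \<open>Q\<close>, and a single one of them does.
\<close>
lemma min_on_Sup:
  assumes D: "D \<subseteq> lsc X" "directed_family D"
  shows "min_on X (Sup D) = Sup (min_on X ` D)"
proof (rule antisym)
  show "Sup (min_on X ` D) \<le> min_on X (Sup D)"
    by (intro SUP_least min_on_mono Sup_upper)
  show "min_on X (Sup D) \<le> Sup (min_on X ` D)"
  proof (rule le_funI)
    fix Q
    show "min_on X (Sup D) Q \<le> Sup (min_on X ` D) Q"
    proof (rule dense_le)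
      fix t assume "t < min_on X (Sup D) Q"
      then have Q: "Q \<in> Q_carrier X" "Q \<subseteq> {x. t < Sup D x}"
        using min_on_level_subset[of t X "Sup D"] by (auto simp: Q_box_def)
      define \<U> where "\<U> = (\<lambda>f. {x. t < f x}) ` D"
      have ne: "D \<noteq> {}" and dir: "\<And>f g. f \<in> D \<Longrightarrow> g \<in> D \<Longrightarrow> \<exists>h\<in>D. f \<le> h \<and> g \<le> h"
        using D(2) by (auto simp: directed_family_def)
      have "compactin X Q" using Q(1) by (simp add: Q_carrier_def)
      moreover have "\<And>U. U \<in> \<U> \<Longrightarrow> openin X U" using D(1) lsc_openin by (auto simp: \<U>_def)
      moreover have "Q \<subseteq> \<Union>\<U>" using Q(2) by (auto simp: \<U>_def less_SUP_iff)
      ultimately obtain \<F> where \<F>: "finite \<F>" "\<F> \<subseteq> \<U>" "Q \<subseteq> \<Union>\<F>"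
        unfolding compactin_def by (metis (no_types, lifting))
      then obtain F where F: "finite F" "F \<subseteq> D" "\<F> = (\<lambda>f. {x. t < f x}) ` F"
        unfolding \<U>_def by (metis finite_subset_image)
      from F(1,2) have "\<exists>h\<in>D. \<forall>f\<in>F. f \<le> h"
      proof (induction F rule: finite_induct)
        case (insert f F)
        then obtain h where "h \<in> D" "\<forall>f\<in>F. f \<le> h" by blast
        moreover obtain k where "k \<in> D" "f \<le> k" "h \<le> k"
          using dir[of f h] insert.prems calculation by blast
        moreover have "\<forall>g\<in>F. g \<le> k"
          using \<open>\<forall>f\<in>F. f \<le> h\<close> order_trans[OF _ \<open>h \<le> k\<close>] by blast
        ultimately show ?case by blast
      qed (use ne in blast)
      then obtain h where h: "h \<in> D" "\<And>f. f \<in> F \<Longrightarrow> f \<le> h" by blast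
      have "t \<le> h x" if "x \<in> Q" for x
      proof -
        obtain f where "f \<in> F" "t < f x" using \<F>(3) F(3) \<open>x \<in> Q\<close> by blast
        then show ?thesis using h(2)[of f] by (auto simp: le_fun_def intro: order_trans less_imp_le)
      qed
      then have "t \<le> min_on X h Q" using Q(1) by (simp add: min_on_def INF_greatest)
      also have "\<dots> \<le> Sup (min_on X ` D) Q"
        using h(1) by (auto simp: image_image intro: SUP_upper)
      finally show "t \<le> Sup (min_on X ` D) Q" .
    qed
  qed
qed

definition lower_integral :: "'a topology \<Rightarrow> ('a set set \<Rightarrow> ennreal) \<Rightarrow> ('a \<Rightarrow> ennreal) \<Rightarrow> ennreal" where
  "lower_integral X \<mu> h = val_integral (Q_space X) \<mu> (min_on X h)"

lemma lower_integral_indicator: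
  assumes "continuous_valuation (Q_space X) \<mu>" "openin X U"
  shows "lower_integral X \<mu> (indicator U) = \<mu> (Q_box X U)"
  unfolding lower_integral_def min_on_indicator
  by (rule val_integral_indicator[OF assms(1) openin_Q_box[OF assms(2)]])

lemma superlinear_lower_integral:
  assumes \<mu>: "continuous_valuation (Q_space X) \<mu>"
  shows "superlinear_on (lsc X) (lower_integral X \<mu>)"
proof -
  note lin = linear_scott_onD[OF linear_scott_val_integral[OF \<mu>]]
  have "lower_integral X \<mu> f + lower_integral X \<mu> g \<le> lower_integral X \<mu> (\<lambda>x. f x + g x)"
    if "f \<in> lsc X" "g \<in> lsc X" for f g
  proof -
    have "lower_integral X \<mu> f + lower_integral X \<mu> g
        = val_integral (Q_space X) \<mu> (\<lambda>Q. min_on X f Q + min_on X g Q)"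
      unfolding lower_integral_def by (rule lin(4)[OF min_on_lsc min_on_lsc, symmetric]) fact+
    also have "\<dots> \<le> lower_integral X \<mu> (\<lambda>x. f x + g x)"
      unfolding lower_integral_def
      by (intro lin(2) lsc_add min_on_lsc that le_funI min_on_superadditive)
    finally show ?thesis .
  qed
  moreover have "lower_integral X \<mu> (\<lambda>x. a * f x) = a * lower_integral X \<mu> f"
    if "f \<in> lsc X" "0 < a" "a < top" for f and a :: ennreal
    unfolding lower_integral_def min_on_scale[OF that(2,3)] by (rule lin(3)[OF min_on_lsc]) fact+
  moreover have "lower_integral X \<mu> f \<le> lower_integral X \<mu> g"
    if "f \<in> lsc X" "g \<in> lsc X" "f \<le> g" for f g
    unfolding lower_integral_def by (intro lin(2) min_on_lsc min_on_mono that)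
  moreover have "lower_integral X \<mu> (\<lambda>_. 0) = 0"
    unfolding lower_integral_def min_on_zero by (rule lin(1))
  ultimately show ?thesis unfolding superlinear_on_def by simp
qed

lemma scott_lower_integral:
  assumes \<mu>: "continuous_valuation (Q_space X) \<mu>"
  shows "scott_on (lsc X) (lower_integral X \<mu>)"
proof -
  have "lower_integral X \<mu> (Sup D) = (SUP f\<in>D. lower_integral X \<mu> f)"
    if D: "D \<subseteq> lsc X" "directed_family D" "Sup D \<in> lsc X" for D
  proof -
    have "lower_integral X \<mu> (Sup D) = (SUP h\<in>min_on X ` D. val_integral (Q_space X) \<mu> h)"
      unfolding lower_integral_def min_on_Sup[OF D(1,2)]
    proof (rule linear_scott_onD(5)[OF linear_scott_val_integral[OF \<mu>]])
      show sub: "min_on X ` D \<subseteq> lsc (Q_space X)" using D(1) min_on_lsc by blast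
      show "directed_family (min_on X ` D)" by (intro directed_family_image D(2) min_on_mono)
      show "Sup (min_on X ` D) \<in> lsc (Q_space X)" by (rule lsc_Sup[OF sub])
    qed
    then show ?thesis by (simp add: image_image lower_integral_def)
  qed
  moreover note superlinear_onD(2)[OF superlinear_lower_integral[OF \<mu>]]
  ultimately show ?thesis unfolding scott_on_def by simp
qed

lemma lower_integral_add_const:
  assumes \<mu>: "continuous_valuation (Q_space X) \<mu>" and h: "h \<in> lsc X" and c: "c < top"
  shows "lower_integral X \<mu> (\<lambda>x. h x + c * indicator (topspace X) x) = lower_integral X \<mu> h + c * \<mu> (Q_carrier X)"
proof (cases "c = 0")
  case False
  have "openin (Q_space X) (Q_carrier X)" using openin_topspace[of "Q_space X"] by simp
  then show ?thesis
    unfolding lower_integral_def min_on_add_const using c False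
    by (intro val_integral_add_indicator[OF \<mu> min_on_lsc[OF h]]) (auto simp: zero_less_iff_neq_zero)
qed simp

text \<open>
  The level sets of \<open>Q \<mapsto> min h on Q\<close> are contained in the boxes of those of \<open>h\<close>. The right-hand side
  may live on another space, since only levels are compared.
\<close>
lemma lower_integral_le:
  assumes \<mu>: "continuous_valuation (Q_space X) \<mu>" and h: "h \<in> lsc X" and g: "g \<in> lsc Y"
    and le: "\<And>t. \<mu> (Q_box X {x. t < h x}) \<le> \<nu> {y. t < g y}"
  shows "lower_integral X \<mu> h \<le> val_integral Y \<nu> g"
  unfolding lower_integral_def
proof (rule val_integral_le)
  fix t :: real
  have top: "{y \<in> topspace Y. ennreal t < g y} = {y. ennreal t < g y}"
    using openin_subset[OF lsc_openin[OF g]] by blast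
  have "{Q \<in> topspace (Q_space X). ennreal t < min_on X h Q} = {Q. ennreal t < min_on X h Q}"
    using openin_subset[OF lsc_openin[OF min_on_lsc[OF h]]] by blast
  then have op: "openin (Q_space X) {Q \<in> topspace (Q_space X). ennreal t < min_on X h Q}"
    using lsc_openin[OF min_on_lsc[OF h]] by simp
  have "\<mu> {Q \<in> topspace (Q_space X). ennreal t < min_on X h Q} \<le> \<mu> (Q_box X {x. ennreal t < h x})"
    using min_on_level_subset
    by (intro continuous_valuationD(3)[OF \<mu> op] openin_Q_box lsc_openin[OF h]) blast
  also have "\<dots> \<le> \<nu> {y. ennreal t < g y}" by (rule le)
  finally show "\<mu> {Q \<in> topspace (Q_space X). ennreal t < min_on X h Q} \<le> \<nu> {y \<in> topspace Y. ennreal t < g y}"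
    by (simp only: top)
qed

section \<open>Members of lambda that satisfy linear constraints\<close>

text \<open>
  A pair \<open>(e, w)\<close> stands for the constraint \<open>\<integral> e d\<nu> \<le> w\<close>.
\<close>
definition constraint_cone :: "(('a \<Rightarrow> ennreal) \<times> ennreal) set \<Rightarrow> bool" where
  "constraint_cone K \<longleftrightarrow>
     (\<lambda>_. 0, 0) \<in> K \<and>
     (\<forall>e w e' w'. (e, w) \<in> K \<and> (e', w') \<in> K \<longrightarrow> (\<lambda>x. e x + e' x, w + w') \<in> K) \<and>
     (\<forall>e w a. (e, w) \<in> K \<and> 0 < a \<and> a < top \<longrightarrow> (\<lambda>x. a * e x, a * w) \<in> K)"

lemma constraint_coneD:
  assumes "constraint_cone K"
  shows "(\<lambda>_. 0, 0) \<in> K"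
    and "(e, w) \<in> K \<Longrightarrow> (e', w') \<in> K \<Longrightarrow> (\<lambda>x. e x + e' x, w + w') \<in> K"
    and "(e, w) \<in> K \<Longrightarrow> 0 < a \<Longrightarrow> a < top \<Longrightarrow> (\<lambda>x. a * e x, a * w) \<in> K"
  using assms unfolding constraint_cone_def by simp_all

text \<open>
  The best upper bound for \<open>\<integral> h d\<nu>\<close> that a single constraint provides. It is infinite if no \<open>e\<close> is above
  \<open>h\<close>.
\<close>
definition cheapest_bound :: "(('a \<Rightarrow> ennreal) \<times> ennreal) set \<Rightarrow> ('a \<Rightarrow> ennreal) \<Rightarrow> ennreal" where
  "cheapest_bound K h = Inf {w. \<exists>e. (e, w) \<in> K \<and> h \<le> e}"

lemma (in function_cone) sublinear_cheapest_bound: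
  assumes K: "constraint_cone K"
  shows "sublinear_on C (cheapest_bound K)"
proof (rule sublinear_onI)
  have lower: "cheapest_bound K h \<le> w" if "(e, w) \<in> K" "h \<le> e" for h e w
    unfolding cheapest_bound_def using that by (intro Inf_lower) blast
  show "cheapest_bound K (\<lambda>_. 0) = 0"
    using lower[OF constraint_coneD(1)[OF K]] by (simp add: le_fun_def)
  show "cheapest_bound K f \<le> cheapest_bound K g" if "f \<le> g" for f g
    unfolding cheapest_bound_def using order_trans[OF that] by (intro Inf_superset_mono) blast
  show "cheapest_bound K (\<lambda>x. a * f x) \<le> a * cheapest_bound K f" if a: "0 < a" "a < top"
    for f and a :: ennreal
  proof -
    have "inverse a * cheapest_bound K (\<lambda>x. a * f x) \<le> cheapest_bound K f"
      unfolding cheapest_bound_def[of K f]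
    proof (rule Inf_greatest)
      fix w assume "w \<in> {w. \<exists>e. (e, w) \<in> K \<and> f \<le> e}"
      then obtain e where e: "(e, w) \<in> K" "f \<le> e" by blast
      have "(\<lambda>x. a * f x) \<le> (\<lambda>x. a * e x)"
        using e(2) by (auto simp: le_fun_def intro: mult_left_mono)
      then show "inverse a * cheapest_bound K (\<lambda>x. a * f x) \<le> w"
        unfolding inverse_mult_le_iff[OF a]
        using constraint_coneD(3)[OF K e(1) a] by (intro lower)
    qed
    then show ?thesis by (simp add: inverse_mult_le_iff[OF a])
  qed
  show "cheapest_bound K (\<lambda>x. f x + g x) \<le> cheapest_bound K f + cheapest_bound K g" for f g
  proof -
    let ?A = "\<lambda>h. {w. \<exists>e. (e, w) \<in> K \<and> h \<le> e}"
    consider "?A f = {}" | "?A g = {}" | "?A f \<noteq> {}" "?A g \<noteq> {}" by blast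
    then show ?thesis
    proof cases
      case 3
      have "cheapest_bound K (\<lambda>x. f x + g x) \<le> (INF w\<in>?A f. INF w'\<in>?A g. w + w')"
      proof (intro INF_greatest)
        fix w w' assume "w \<in> ?A f" "w' \<in> ?A g"
        then obtain e e' where e: "(e, w) \<in> K" "f \<le> e" "(e', w') \<in> K" "g \<le> e'" by blast
        have "(\<lambda>x. f x + g x) \<le> (\<lambda>x. e x + e' x)"
          using e by (auto simp: le_fun_def intro: add_mono)
        then show "cheapest_bound K (\<lambda>x. f x + g x) \<le> w + w'"
          using constraint_coneD(2)[OF K e(1,3)] by (intro lower)
      qed
      also have "\<dots> = (INF w\<in>?A f. w) + (INF w\<in>?A g. w)"
        by (rule INF_add_INF_ennreal[OF 3, symmetric])
      finally show ?thesis by (simp add: cheapest_bound_def)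
    next
      case 1
      have "cheapest_bound K f = top" unfolding cheapest_bound_def 1 by simp
      then show ?thesis by simp
    next
      case 2
      have "cheapest_bound K g = top" unfolding cheapest_bound_def 2 by simp
      then show ?thesis by simp
    qed
  qed
qed

text \<open>
  The sandwich theorem between the lower integral and \<open>cheapest_bound\<close>. For (sub)probability valuations
  the constraint \<open>\<nu> X \<le> 1\<close> is added to the cone; the lower integral satisfies it, as it maps
  \<open>e + c\<close> to its value at \<open>e\<close> plus \<open>c * \<mu> (Q X)\<close>, and \<open>\<mu> (Q X) \<le> 1\<close>. For probability valuations the converse inequality
  \<open>1 = \<mu> (Q X) \<le> \<nu> X\<close> holds for every valuation above the capacity.
\<close>
theorem exists_selection_with_constraints:
  assumes \<mu>: "\<mu> \<in> topspace (V_space k (Q_space X))"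
    and K: "constraint_cone K"
    and le: "\<And>e w. (e, w) \<in> K \<Longrightarrow> e \<in> lsc X \<and> lower_integral X \<mu> e \<le> w"
  shows "\<exists>\<nu>\<in>lambda_sharp k X \<mu>. \<forall>e w. (e, w) \<in> K \<longrightarrow> val_integral X \<nu> e \<le> w"
proof -
  interpret function_cone "lsc X" by (rule function_cone_lsc)
  have cv: "continuous_valuation (Q_space X) \<mu>" and kind: "has_kind k (Q_space X) \<mu>"
    using \<mu> by auto
  let ?one = "indicator (topspace X) :: 'a \<Rightarrow> ennreal"
  have one: "?one \<in> lsc X" by (simp add: lsc_indicator)
  have one_c: "(\<lambda>x. c * ?one x) \<in> lsc X" if "c < top" for c
    using lsc_scale[OF one _ that] lsc_zero by (cases "c = 0") (auto simp: zero_less_iff_neq_zero)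
  \<comment> \<open>The total mass is bounded only if the kind asks for it; otherwise \<open>c = 0\<close>.\<close>
  define K' where "K' = {(\<lambda>x. e x + c * ?one x, w + c) | e w c. (e, w) \<in> K \<and> c < top \<and> (k = Any \<longrightarrow> c = 0)}"
  have K'I: "(\<lambda>x. e x + c * ?one x, w + c) \<in> K'" if "(e, w) \<in> K" "c < top" "k = Any \<Longrightarrow> c = 0" for e w c
    using that unfolding K'_def by blast
  have K': "constraint_cone K'"
    unfolding constraint_cone_def
  proof (intro conjI allI impI; (elim conjE)?)
    show "(\<lambda>_. 0, 0) \<in> K'" using K'I[OF constraint_coneD(1)[OF K], of 0] by simp
  next
    fix e w e' w' assume "(e, w) \<in> K'" "(e', w') \<in> K'"
    then obtain f v c f' v' c' where
      *: "(f, v) \<in> K" "c < top" "k = Any \<longrightarrow> c = 0" "e = (\<lambda>x. f x + c * ?one x)" "w = v + c"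
         "(f', v') \<in> K" "c' < top" "k = Any \<longrightarrow> c' = 0" "e' = (\<lambda>x. f' x + c' * ?one x)" "w' = v' + c'"
      unfolding K'_def by blast
    have "(\<lambda>x. (f x + f' x) + (c + c') * ?one x, (v + v') + (c + c')) \<in> K'"
      using * by (intro K'I constraint_coneD(2)[OF K]) auto
    then show "(\<lambda>x. e x + e' x, w + w') \<in> K'"
      unfolding * by (simp add: distrib_right ac_simps)
  next
    fix e w and a :: ennreal assume "(e, w) \<in> K'" and a: "0 < a" "a < top"
    then obtain f v c where
      *: "(f, v) \<in> K" "c < top" "k = Any \<longrightarrow> c = 0" "e = (\<lambda>x. f x + c * ?one x)" "w = v + c"
      unfolding K'_def by blast
    have "(\<lambda>x. a * f x + (a * c) * ?one x, a * v + a * c) \<in> K'"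
      using * a by (intro K'I constraint_coneD(3)[OF K]) (auto simp: ennreal_mult_less_top)
    then show "(\<lambda>x. a * e x, a * w) \<in> K'"
      unfolding * by (simp add: distrib_left mult.assoc)
  qed
  have "lower_integral X \<mu> h \<le> cheapest_bound K' h" if h: "h \<in> lsc X" for h
    unfolding cheapest_bound_def
  proof (rule Inf_greatest)
    fix w' assume "w' \<in> {w. \<exists>e. (e, w) \<in> K' \<and> h \<le> e}"
    then obtain e w c where e: "(e, w) \<in> K" "c < top" "k = Any \<longrightarrow> c = 0"
      "h \<le> (\<lambda>x. e x + c * ?one x)" "w' = w + c"
      unfolding K'_def by blast
    have "lower_integral X \<mu> h \<le> lower_integral X \<mu> (\<lambda>x. e x + c * ?one x)"
      using le[OF e(1)]
      by (intro superlinear_onD(2)[OF superlinear_lower_integral[OF cv] h _ e(4)] lsc_add one_c e) auto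
    also have "\<dots> = lower_integral X \<mu> e + c * \<mu> (Q_carrier X)"
      using le[OF e(1)] by (intro lower_integral_add_const cv e) auto
    also have "\<dots> \<le> w + c"
    proof (intro add_mono)
      have "\<mu> (Q_carrier X) \<le> 1" if "k \<noteq> Any" using kind that by (cases k) auto
      then show "c * \<mu> (Q_carrier X) \<le> c"
        using e(3) mult_left_mono[of "\<mu> (Q_carrier X)" 1 c] by (cases "k = Any") auto
    qed (use le[OF e(1)] in auto)
    finally show "lower_integral X \<mu> h \<le> w'" using e(5) by simp
  qed
  then obtain L where L: "sublinear_on (lsc X) L" "superlinear_on (lsc X) L" "scott_on (lsc X) L"
    and low: "\<And>h. h \<in> lsc X \<Longrightarrow> lower_integral X \<mu> h \<le> L h"
    and up: "\<And>h. h \<in> lsc X \<Longrightarrow> L h \<le> cheapest_bound K' h"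
    using sandwich[OF superlinear_lower_integral[OF cv] scott_lower_integral[OF cv] sublinear_cheapest_bound[OF K']]
    by blast
  have lin: "linear_scott_on (lsc X) L" using L by (simp add: linear_scott_on_def)
  define \<nu> where "\<nu> = valuation_of X L"
  have \<nu>: "continuous_valuation X \<nu>" unfolding \<nu>_def by (rule continuous_valuation_of[OF lin])
  have val: "\<nu> U = L (indicator U)" if "openin X U" for U using that by (simp add: \<nu>_def valuation_of_def)
  have ge: "\<mu> (Q_box X U) \<le> \<nu> U" if "openin X U" for U
    using low[OF lsc_indicator[OF that]] lower_integral_indicator[OF cv that] val[OF that] by simp
  have up': "L h \<le> w" if "(e, w) \<in> K'" "h \<le> e" "h \<in> lsc X" for h e w
  proof -
    have "cheapest_bound K' h \<le> w"
      unfolding cheapest_bound_def using that by (intro Inf_lower) blast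
    then show ?thesis using up[OF that(3)] by (rule order_trans[rotated])
  qed
  have "\<nu> (topspace X) \<le> 1" if "k \<noteq> Any"
    unfolding val[OF openin_topspace]
    using up'[OF K'I[OF constraint_coneD(1)[OF K], of 1] _ one] that by (simp add: le_fun_def)
  moreover have "\<mu> (Q_carrier X) \<le> \<nu> (topspace X)"
    using ge[OF openin_topspace] by (simp add: Q_box_topspace)
  ultimately have "has_kind k X \<nu>"
    using kind by (cases k) (auto intro: antisym)
  then have "\<nu> \<in> lambda_sharp k X \<mu>"
    using \<nu> ge by (simp add: lambda_sharp_def)
  moreover have "val_integral X \<nu> e \<le> w" if "(e, w) \<in> K" for e w
  proof -
    have e: "e \<in> lsc X" using le[OF that] by simp
    show ?thesis
      unfolding \<nu>_def val_integral_valuation_of[OF lin e]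
      using K'I[OF that, of 0] by (intro up'[OF _ _ e]) auto
  qed
  ultimately show ?thesis by blast
qed

section \<open>The topology of the space of valuations\<close>

lemma openin_V_evaluation:
  assumes U: "openin X U"
  shows "openin (V_space k X) {\<nu> \<in> topspace (V_space k X). t < \<nu> U}"
proof (cases t)
  case (real r)
  have "openin (V_all X) {\<nu>. continuous_valuation X \<nu> \<and> ennreal r < \<nu> U}"
    unfolding V_all_def using U real by (intro topology_generated_by_Basis) blast
  then have "openin (V_space k X) ({\<nu>. continuous_valuation X \<nu> \<and> ennreal r < \<nu> U} \<inter> {\<nu>. has_kind k X \<nu>})"
    unfolding V_space_def openin_subtopology by blast
  moreover have "{\<nu>. continuous_valuation X \<nu> \<and> ennreal r < \<nu> U} \<inter> {\<nu>. has_kind k X \<nu>}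
      = {\<nu> \<in> topspace (V_space k X). t < \<nu> U}"
    by (auto simp: real)
  ultimately show ?thesis by simp
qed simp

definition V_cylinder :: "valuation_kind \<Rightarrow> 'a topology \<Rightarrow> ('a set \<times> ennreal) set \<Rightarrow> ('a set \<Rightarrow> ennreal) set" where
  "V_cylinder k X B = {\<nu> \<in> topspace (V_space k X). \<forall>(U, r)\<in>B. r < \<nu> U}"

lemma openin_V_cylinder:
  assumes "finite B" "\<And>U r. (U, r) \<in> B \<Longrightarrow> openin X U"
  shows "openin (V_space k X) (V_cylinder k X B)"
  using assms
proof (induction B rule: finite_induct)
  case empty
  then show ?case using openin_topspace[of "V_space k X"] by (simp add: V_cylinder_def)
next
  case (insert b B)
  obtain U r where b: "b = (U, r)" by (cases b)
  have "V_cylinder k X (insert b B) = {\<nu> \<in> topspace (V_space k X). r < \<nu> U} \<inter> V_cylinder k X B"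
    by (auto simp: V_cylinder_def b)
  moreover have "openin X U" using insert.prems b by blast
  moreover have "openin (V_space k X) (V_cylinder k X B)"
    using insert.prems by (intro insert.IH) blast
  ultimately show ?case by (simp only: openin_Int openin_V_evaluation)
qed

lemma V_space_cylinder_base:
  assumes "openin (V_space k X) \<U>" "\<nu> \<in> \<U>"
  shows "\<exists>B. finite B \<and> (\<forall>U r. (U, r) \<in> B \<longrightarrow> openin X U) \<and> \<nu> \<in> V_cylinder k X B \<and> V_cylinder k X B \<subseteq> \<U>"
proof -
  let ?S = "insert {\<nu>. continuous_valuation X \<nu>}
    {{\<nu>. continuous_valuation X \<nu> \<and> \<nu> U > ennreal r} | U r. openin X U \<and> 0 \<le> (r::real)}"
  define C where "C B = {\<nu>. continuous_valuation X \<nu> \<and> (\<forall>(U, r)\<in>B. r < \<nu> U)}" for B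
  define ok where "ok B \<longleftrightarrow> finite B \<and> (\<forall>(U, r)\<in>B. openin X U)" for B :: "('a set \<times> ennreal) set"
  have C_Un: "C (A \<union> B) = C A \<inter> C B" for A B by (auto simp: C_def)
  have ok_Un: "ok (A \<union> B)" if "ok A" "ok B" for A B using that by (auto simp: ok_def)
  obtain T where T: "openin (V_all X) T" "\<U> = T \<inter> {\<nu>. has_kind k X \<nu>}"
    using assms(1) unfolding V_space_def openin_subtopology by blast
  have "generate_topology_on ?S T"
    using T(1) unfolding V_all_def by (rule openin_topology_generated_by)
  then have "\<exists>B. ok B \<and> \<nu> \<in> C B \<and> C B \<subseteq> T" if "\<nu> \<in> T" for \<nu>
    using that
  proof (induction arbitrary: \<nu>)
    case Empty
    then show ?case by simp
  next
    case (Int a b)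
    from Int.prems have "\<nu> \<in> a" "\<nu> \<in> b" by simp_all
    with Int.IH obtain A B where "ok A" "\<nu> \<in> C A" "C A \<subseteq> a" "ok B" "\<nu> \<in> C B" "C B \<subseteq> b"
      by meson
    then show ?case by (intro exI[of _ "A \<union> B"]) (auto simp: C_Un ok_Un)
  next
    case (UN K)
    from UN.prems obtain a where a: "a \<in> K" "\<nu> \<in> a" by blast
    from UN.IH[OF a] obtain B where "ok B" "\<nu> \<in> C B" "C B \<subseteq> a" by blast
    then show ?case using a(1) by (intro exI[of _ B]) blast
  next
    case (Basis s)
    have "s = C {} \<or> (\<exists>U r. openin X U \<and> s = C {(U, ennreal r)})"
      using Basis.hyps by (auto simp: C_def)
    moreover have "ok {}" "\<And>U r. openin X U \<Longrightarrow> ok {(U, r)}" by (auto simp: ok_def)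
    ultimately show ?case using Basis.prems by blast
  qed
  moreover have "\<nu> \<in> T" using assms(2) T(2) by simp
  ultimately obtain B where B: "ok B" "\<nu> \<in> C B" "C B \<subseteq> T" by blast
  have cyl: "V_cylinder k X B = C B \<inter> {\<nu>. has_kind k X \<nu>}" by (auto simp: V_cylinder_def C_def)
  show ?thesis
  proof (intro exI[of _ B] conjI)
    show "finite B" "\<forall>U r. (U, r) \<in> B \<longrightarrow> openin X U" using B(1) by (auto simp: ok_def)
    show "\<nu> \<in> V_cylinder k X B" using assms(2) B(2) T(2) cyl by simp
    show "V_cylinder k X B \<subseteq> \<U>" using B(3) T(2) cyl by blast
  qed
qed

lemma specialization_V_iff:
  "specialization_le (V_space k X) \<nu> \<nu>' \<longleftrightarrow>
     \<nu> \<in> topspace (V_space k X) \<and> \<nu>' \<in> topspace (V_space k X) \<and> (\<forall>U. openin X U \<longrightarrow> \<nu> U \<le> \<nu>' U)"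
proof (intro iffI conjI allI impI)
  assume le: "specialization_le (V_space k X) \<nu> \<nu>'"
  then show "\<nu> \<in> topspace (V_space k X)" "\<nu>' \<in> topspace (V_space k X)"
    unfolding specialization_le_def by blast+
  fix U assume U: "openin X U"
  have *: "t < \<nu>' U" if "t < \<nu> U" for t
    using le openin_V_evaluation[OF U, of k t] that unfolding specialization_le_def by blast
  show "\<nu> U \<le> \<nu>' U"
  proof (rule leI, rule notI)
    assume "\<nu>' U < \<nu> U"
    from *[OF this] show False by simp
  qed
next
  assume le: "\<nu> \<in> topspace (V_space k X) \<and> \<nu>' \<in> topspace (V_space k X) \<and> (\<forall>U. openin X U \<longrightarrow> \<nu> U \<le> \<nu>' U)"
  have "\<nu>' \<in> \<U>" if \<U>: "openin (V_space k X) \<U>" "\<nu> \<in> \<U>" for \<U>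
  proof -
    obtain B where B: "finite B" "\<forall>U r. (U, r) \<in> B \<longrightarrow> openin X U"
      "\<nu> \<in> V_cylinder k X B" "V_cylinder k X B \<subseteq> \<U>"
      using V_space_cylinder_base[OF \<U>] by blast
    have "r < \<nu>' U" if "(U, r) \<in> B" for U r
    proof -
      have "r < \<nu> U" using B(3) that unfolding V_cylinder_def by blast
      also have "\<dots> \<le> \<nu>' U" using le B(2) that by blast
      finally show ?thesis .
    qed
    then have "\<nu>' \<in> V_cylinder k X B" using le unfolding V_cylinder_def by blast
    then show ?thesis using B(4) by blast
  qed
  then show "specialization_le (V_space k X) \<nu> \<nu>'"
    using le unfolding specialization_le_def by blast
qed

text \<open>
  The map \<open>\<nu> \<mapsto> \<integral> h d\<nu>\<close>, cut off outside the space so that it can be a member of \<open>lsc\<close>.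
\<close>
definition integral_map :: "valuation_kind \<Rightarrow> 'a topology \<Rightarrow> ('a \<Rightarrow> ennreal) \<Rightarrow> ('a set \<Rightarrow> ennreal) \<Rightarrow> ennreal" where
  "integral_map k X h = (\<lambda>\<nu>. if \<nu> \<in> topspace (V_space k X) then val_integral X \<nu> h else 0)"

lemma integral_map_indicator:
  assumes "openin X U"
  shows "integral_map k X (indicator U) = (\<lambda>\<nu>. if \<nu> \<in> topspace (V_space k X) then \<nu> U else 0)"
  using assms by (auto simp: integral_map_def fun_eq_iff val_integral_indicator)

text \<open>
  By the dyadic formula it is a supremum of finite sums of multiples of evaluations \<open>\<nu> \<mapsto> \<nu> U\<close>.
\<close>
lemma lsc_integral_map:
  assumes h: "h \<in> lsc X"
  shows "integral_map k X h \<in> lsc (V_space k X)"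
proof -
  let ?ev = "\<lambda>U \<nu>. if \<nu> \<in> topspace (V_space k X) then \<nu> U else (0 :: ennreal)"
  let ?U = "\<lambda>n j. {x. ennreal (real (Suc j) / 2 ^ n) < h x}"
  have ev: "?ev U \<in> lsc (V_space k X)" if "openin X U" for U
  proof -
    have "{\<nu>. t < ?ev U \<nu>} = {\<nu> \<in> topspace (V_space k X). t < \<nu> U}" for t by auto
    then show ?thesis using openin_V_evaluation[OF that] by (simp only: lsc_def mem_Collect_eq) blast
  qed
  let ?s = "\<lambda>n \<nu>. \<Sum>j<n * 2 ^ n. ennreal (1 / 2 ^ n) * ?ev (?U n j) \<nu>"
  have "integral_map k X h = Sup (range ?s)"
  proof (rule ext)
    fix \<nu>
    show "integral_map k X h \<nu> = Sup (range ?s) \<nu>"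
    proof (cases "\<nu> \<in> topspace (V_space k X)")
      case True
      then have "continuous_valuation X \<nu>" by simp
      from val_integral_dyadic[OF this h] show ?thesis
        using True by (simp only: integral_map_def if_True Sup_apply image_image)
    next
      case False
      then show ?thesis by (simp only: integral_map_def if_False Sup_apply image_image) simp
    qed
  qed
  moreover have "range ?s \<subseteq> lsc (V_space k X)"
    by (rule image_subsetI, rule lsc_sum_scaled[OF ev[OF lsc_openin[OF h]]])
  ultimately show ?thesis by (simp only: lsc_Sup)
qed

lemma openin_V_integral:
  assumes "h \<in> lsc X"
  shows "openin (V_space k X) {\<nu> \<in> topspace (V_space k X). t < val_integral X \<nu> h}"
proof -
  have "{\<nu> \<in> topspace (V_space k X). t < val_integral X \<nu> h} = {\<nu>. t < integral_map k X h \<nu>}"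
    by (auto simp: integral_map_def split: if_splits)
  then show ?thesis using lsc_openin[OF lsc_integral_map[OF assms]] by simp
qed

section \<open>The map lambda is continuous and has compact values\<close>

text \<open>
  The convex cone generated by the constraints \<open>\<nu> U \<le> r\<close> for \<open>(U, r)\<close> in \<open>B\<close>. Being inductive, each
  member comes from finitely many generators.
\<close>
inductive constraint_hull :: "('a set \<times> ennreal) set \<Rightarrow> ('a \<Rightarrow> ennreal) \<Rightarrow> ennreal \<Rightarrow> bool" for B where
  zero: "constraint_hull B (\<lambda>_. 0) 0"
| gen: "(U, r) \<in> B \<Longrightarrow> constraint_hull B (indicator U) r"
| add: "constraint_hull B e w \<Longrightarrow> constraint_hull B e' w' \<Longrightarrow> constraint_hull B (\<lambda>x. e x + e' x) (w + w')"
| scale: "constraint_hull B e w \<Longrightarrow> 0 < a \<Longrightarrow> a < top \<Longrightarrow> constraint_hull B (\<lambda>x. a * e x) (a * w)"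

lemma constraint_cone_hull: "constraint_cone {(e, w). constraint_hull B e w}"
  unfolding constraint_cone_def
  by (auto intro: constraint_hull.intros)

lemma constraint_hull_mono:
  assumes "constraint_hull A e w" "A \<subseteq> B"
  shows "constraint_hull B e w"
  using assms(1)
proof induction
  case (gen U r)
  then show ?case using assms(2) by (intro constraint_hull.gen) blast
qed (blast intro: constraint_hull.intros)+

lemma constraint_hull_finite:
  assumes "constraint_hull B e w"
  shows "\<exists>A. finite A \<and> A \<subseteq> B \<and> constraint_hull A e w"
  using assms
proof induction
  case zero
  then show ?case by (intro exI[of _ "{}"]) (simp add: constraint_hull.zero)
next
  case (gen U r)
  then show ?case by (intro exI[of _ "{(U, r)}"]) (simp add: constraint_hull.gen)
next
  case (add e w e' w')
  then obtain A A' where "finite A" "A \<subseteq> B" "constraint_hull A e w"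
    "finite A'" "A' \<subseteq> B" "constraint_hull A' e' w'" by blast
  then show ?case
    by (intro exI[of _ "A \<union> A'"] conjI constraint_hull.add)
      (auto intro: constraint_hull_mono)
next
  case (scale e w a)
  then show ?case by (blast intro: constraint_hull.scale)
qed

lemma constraint_hull_lsc:
  assumes "constraint_hull B e w" "\<And>U r. (U, r) \<in> B \<Longrightarrow> openin X U"
  shows "e \<in> lsc X"
  using assms(1)
  by induction (auto intro: lsc_zero lsc_indicator lsc_add lsc_scale assms(2))

lemma constraint_hull_sound:
  assumes "constraint_hull B e w" and op: "\<And>U r. (U, r) \<in> B \<Longrightarrow> openin X U"
    and \<nu>: "continuous_valuation X \<nu>" and le: "\<And>U r. (U, r) \<in> B \<Longrightarrow> \<nu> U \<le> r"
  shows "val_integral X \<nu> e \<le> w"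
  using assms(1)
proof induction
  case zero
  then show ?case by (simp add: val_integral_zero[OF \<nu>])
next
  case (gen U r)
  then show ?case by (simp add: val_integral_indicator[OF \<nu> op[OF gen]] le)
next
  case (add e w e' w')
  then show ?case
    by (subst linear_scott_onD(4)[OF linear_scott_val_integral[OF \<nu>]])
      (auto intro: add_mono constraint_hull_lsc op)
next
  case (scale e w a)
  then show ?case
    by (subst val_integral_scale[OF \<nu>])
      (auto intro: mult_left_mono constraint_hull_lsc op)
qed

lemma lambda_sharpD:
  assumes "\<nu> \<in> lambda_sharp k X \<mu>"
  shows "\<nu> \<in> topspace (V_space k X)" "continuous_valuation X \<nu>"
    "openin X U \<Longrightarrow> \<mu> (Q_box X U) \<le> \<nu> U"
  using assms unfolding lambda_sharp_def by auto

text \<open>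
  By \<open>exists_selection_with_constraints\<close> the lower integral violates some \<open>(e, w)\<close> in the cone generated
  by \<open>B\<close>. Finitely many generators suffice for \<open>(e, w)\<close>; and \<open>\<mu>'\<close> ranges over the open set on which the
  violation \<open>w < lower_integral X \<mu>' e\<close> persists, where no selection can satisfy these generators.
\<close>
lemma lambda_sharp_covering_persists:
  assumes \<mu>: "\<mu> \<in> topspace (V_space k (Q_space X))"
    and "\<forall>U r. (U, r) \<in> B \<longrightarrow> openin X U"
    and cover: "\<forall>\<nu>\<in>lambda_sharp k X \<mu>. \<exists>(U, r)\<in>B. r < \<nu> U"
  shows "\<exists>A \<O>. finite A \<and> A \<subseteq> B \<and> openin (V_space k (Q_space X)) \<O> \<and> \<mu> \<in> \<O> \<and>
    (\<forall>\<mu>'\<in>\<O>. \<forall>\<nu>\<in>lambda_sharp k X \<mu>'. \<exists>(U, r)\<in>A. r < \<nu> U)"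
proof -
  have B: "openin X U" if "(U, r) \<in> B" for U r using assms(2) that by blast
  have "\<exists>e w. constraint_hull B e w \<and> w < lower_integral X \<mu> e"
  proof (rule ccontr)
    assume "\<not> (\<exists>e w. constraint_hull B e w \<and> w < lower_integral X \<mu> e)"
    then have le: "e \<in> lsc X \<and> lower_integral X \<mu> e \<le> w" if "(e, w) \<in> {(e, w). constraint_hull B e w}" for e w
      using that constraint_hull_lsc[OF _ B] by (auto simp: not_less)
    have "\<exists>\<nu>\<in>lambda_sharp k X \<mu>. \<forall>e w. (e, w) \<in> {(e, w). constraint_hull B e w} \<longrightarrow> val_integral X \<nu> e \<le> w"
      by (rule exists_selection_with_constraints[OF \<mu> constraint_cone_hull]) (rule le)
    then obtain \<nu> where \<nu>: "\<nu> \<in> lambda_sharp k X \<mu>"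
      "\<forall>e w. constraint_hull B e w \<longrightarrow> val_integral X \<nu> e \<le> w"
      by auto
    obtain U r where Ur: "(U, r) \<in> B" "r < \<nu> U" using cover \<nu>(1) by blast
    have "\<nu> U \<le> r"
      using \<nu>(2)[rule_format, of "indicator U" r] constraint_hull.gen[OF Ur(1)]
        val_integral_indicator[OF lambda_sharpD(2)[OF \<nu>(1)] B[OF Ur(1)]] by simp
    then show False using Ur(2) by simp
  qed
  then obtain e w where ew: "constraint_hull B e w" "w < lower_integral X \<mu> e" by blast
  obtain A where A: "finite A" "A \<subseteq> B" "constraint_hull A e w"
    using constraint_hull_finite[OF ew(1)] by blast
  have opA: "openin X U" if "(U, r) \<in> A" for U r using A(2) B that by blast
  have e: "e \<in> lsc X" by (rule constraint_hull_lsc[OF A(3) opA])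
  define \<O> where "\<O> = {\<mu>' \<in> topspace (V_space k (Q_space X)). w < lower_integral X \<mu>' e}"
  show ?thesis
  proof (intro exI[of _ A] exI[of _ \<O>] conjI ballI)
    show "finite A" "A \<subseteq> B" by fact+
    show "openin (V_space k (Q_space X)) \<O>"
      unfolding \<O>_def lower_integral_def by (rule openin_V_integral[OF min_on_lsc[OF e]])
    show "\<mu> \<in> \<O>" using \<mu> ew(2) by (simp add: \<O>_def)
    fix \<mu>' \<nu> assume \<mu>': "\<mu>' \<in> \<O>" and \<nu>: "\<nu> \<in> lambda_sharp k X \<mu>'"
    show "\<exists>(U, r)\<in>A. r < \<nu> U"
    proof (rule ccontr)
      assume "\<not> (\<exists>(U, r)\<in>A. r < \<nu> U)"
      then have "\<nu> U \<le> r" if "(U, r) \<in> A" for U r using that by (auto simp: not_less)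
      then have "val_integral X \<nu> e \<le> w"
        by (intro constraint_hull_sound[OF A(3) opA lambda_sharpD(2)[OF \<nu>]])
      moreover have "lower_integral X \<mu>' e \<le> val_integral X \<nu> e"
        using \<mu>' by (intro lower_integral_le[OF _ e e] lambda_sharpD(3)[OF \<nu>] lsc_openin[OF e]) (auto simp: \<O>_def)
      ultimately show False using \<mu>' by (auto simp: \<O>_def)
    qed
  qed
qed

lemma lambda_sharp_nonempty:
  assumes "\<mu> \<in> topspace (V_space k (Q_space X))"
  shows "lambda_sharp k X \<mu> \<noteq> {}"
proof -
  have cv: "continuous_valuation (Q_space X) \<mu>" using assms by simp
  have "constraint_cone {(\<lambda>_. 0, 0)}" by (simp add: constraint_cone_def)
  then have "\<exists>\<nu>\<in>lambda_sharp k X \<mu>. \<forall>e w. (e, w) \<in> {(\<lambda>_. 0, 0)} \<longrightarrow> val_integral X \<nu> e \<le> w"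
  proof (rule exists_selection_with_constraints[OF assms])
    show "e \<in> lsc X \<and> lower_integral X \<mu> e \<le> w" if "(e, w) \<in> {(\<lambda>_. 0, 0)}" for e w
      using that lsc_zero superlinear_onD(1)[OF superlinear_lower_integral[OF cv]] by simp
  qed
  then show ?thesis by blast
qed

text \<open>By Alexander's subbase theorem only covers by sets \<open>[U > r]\<close> matter.\<close>
lemma lambda_sharp_compact:
  assumes \<mu>: "\<mu> \<in> topspace (V_space k (Q_space X))"
  shows "compactin (V_space k X) (lambda_sharp k X \<mu>)"
proof -
  let ?V = "V_space k X" and ?L = "lambda_sharp k X \<mu>"
  let ?ev = "\<lambda>U r. {\<nu> \<in> topspace ?V. r < \<nu> U}"
  have L: "?L \<subseteq> topspace ?V" by (auto dest: lambda_sharpD)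
  \<comment> \<open>The whole space is included because the sets \<open>[U > r]\<close> miss the zero valuation.\<close>
  define \<B> where "\<B> = insert (topspace ?V) {?ev U r | U r. openin X U}"
  have \<B>_open: "openin ?V S" if "S \<in> \<B>" for S
    using that openin_V_evaluation by (auto simp: \<B>_def simp del: topspace_V_space)
  have "compact_space (subtopology ?V ?L)"
  proof (rule Alexander_subbase_alt[of ?L \<B>])
    show "?L \<subseteq> \<Union>\<B>" using L by (auto simp: \<B>_def simp del: topspace_V_space)
    show "\<exists>C'. finite C' \<and> C' \<subseteq> C \<and> ?L \<subseteq> \<Union>C'" if C: "C \<subseteq> \<B>" "?L \<subseteq> \<Union>C" for C
    proof (cases "topspace ?V \<in> C")
      case True
      then show ?thesis using L by (intro exI[of _ "{topspace ?V}"]) auto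
    next
      case False
      define B where "B = {(U, r). openin X U \<and> ?ev U r \<in> C}"
      have cover: "\<forall>\<nu>\<in>?L. \<exists>(U, r)\<in>B. r < \<nu> U"
      proof
        fix \<nu> assume "\<nu> \<in> ?L"
        obtain S where S: "S \<in> C" "\<nu> \<in> S" using C(2) \<open>\<nu> \<in> ?L\<close> by blast
        then obtain U r where "openin X U" "S = ?ev U r"
          using False C(1) unfolding \<B>_def by blast
        then have "(U, r) \<in> B" "r < \<nu> U" using S unfolding B_def by auto
        then show "\<exists>(U, r)\<in>B. r < \<nu> U" by blast
      qed
      have opB: "\<forall>U r. (U, r) \<in> B \<longrightarrow> openin X U" by (simp add: B_def)
      obtain A \<O> where A: "finite A" "A \<subseteq> B" "openin (V_space k (Q_space X)) \<O>" "\<mu> \<in> \<O>"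
        "\<forall>\<mu>'\<in>\<O>. \<forall>\<nu>\<in>lambda_sharp k X \<mu>'. \<exists>(U, r)\<in>A. r < \<nu> U"
        using lambda_sharp_covering_persists[OF \<mu> opB cover] by (elim exE conjE) (rule that)
      have "?L \<subseteq> \<Union>((\<lambda>(U, r). ?ev U r) ` A)"
      proof
        fix \<nu> assume \<nu>: "\<nu> \<in> ?L"
        obtain U r where "(U, r) \<in> A" "r < \<nu> U" using A(5) A(4) \<nu> by blast
        then show "\<nu> \<in> \<Union>((\<lambda>(U, r). ?ev U r) ` A)" using \<nu> L by blast
      qed
      then show ?thesis
        using A(1,2) by (intro exI[of _ "(\<lambda>(U, r). ?ev U r) ` A"]) (auto simp: B_def)
    qed
    show "topology (arbitrary union_of (finite intersection_of (\<lambda>x. x \<in> \<B>) relative_to ?L)) = subtopology ?V ?L"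
    proof (rule topology_base_unique)
      fix S assume "(finite intersection_of (\<lambda>x. x \<in> \<B>) relative_to ?L) S"
      then obtain F where F: "finite F" "F \<subseteq> \<B>" "S = ?L \<inter> \<Inter>F"
        unfolding relative_to_def intersection_of_def by blast
      show "openin (subtopology ?V ?L) S"
      proof (cases "F = {}")
        case True
        then show ?thesis using F(3) L openin_subtopology_self by (metis Int_UNIV_right Inter_empty openin_subtopology_refl)
      next
        case False
        then have "openin ?V (\<Inter>F)" using F \<B>_open by (intro openin_Inter) auto
        then show ?thesis using F(3) by (auto simp: openin_subtopology)
      qed
    next
      fix \<U> \<nu> assume \<U>: "openin (subtopology ?V ?L) \<U>" "\<nu> \<in> \<U>"
      then obtain T where T: "openin ?V T" "\<U> = T \<inter> ?L" by (auto simp: openin_subtopology)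
      then obtain B where B: "finite B" "\<forall>U r. (U, r) \<in> B \<longrightarrow> openin X U"
        "\<nu> \<in> V_cylinder k X B" "V_cylinder k X B \<subseteq> T"
        using V_space_cylinder_base[OF T(1), of \<nu>] \<U>(2) by blast
      let ?F = "(\<lambda>(U, r). ?ev U r) ` B"
      have F: "?L \<inter> \<Inter>?F = ?L \<inter> V_cylinder k X B"
        using L by (auto simp: V_cylinder_def simp del: topspace_V_space)
      have "(finite intersection_of (\<lambda>x. x \<in> \<B>)) (\<Inter>?F)"
        unfolding intersection_of_def using B(1,2) by (intro exI[of _ ?F]) (auto simp: \<B>_def simp del: topspace_V_space)
      then have "(finite intersection_of (\<lambda>x. x \<in> \<B>) relative_to ?L) (?L \<inter> \<Inter>?F)"
        unfolding relative_to_def by blast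
      then show "\<exists>S. (finite intersection_of (\<lambda>x. x \<in> \<B>) relative_to ?L) S \<and> \<nu> \<in> S \<and> S \<subseteq> \<U>"
        using F B(3,4) \<U>(2) T(2) by (intro exI[of _ "?L \<inter> \<Inter>?F"]) auto
    qed
  qed
  then show ?thesis using L by (simp only: compactin_subspace)
qed

lemma lambda_sharp_in_Q_carrier:
  assumes "\<mu> \<in> topspace (V_space k (Q_space X))"
  shows "lambda_sharp k X \<mu> \<in> Q_carrier (V_space k X)"
proof -
  have "saturated_in (V_space k X) (lambda_sharp k X \<mu>)"
    unfolding saturated_in_def specialization_V_iff
    by (auto simp: lambda_sharp_def intro: order_trans)
  then show ?thesis
    using lambda_sharp_nonempty[OF assms] lambda_sharp_compact[OF assms] by (simp add: Q_carrier_def)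
qed

text \<open>
  Upper semicontinuity of a set-valued map passes from finite unions of subbasic sets to finite unions of
  finite intersections, by induction on the number of intersections: by distributivity the union of
  \<open>\<Inter>(S ` J)\<close> and the rest is the intersection, over \<open>b\<close> in \<open>J\<close>, of the unions of \<open>S b\<close> and the rest,
  and these have one intersection less.
\<close>
lemma upper_continuity_from_subbase:
  fixes L :: "'m \<Rightarrow> 'n set" and S :: "'b \<Rightarrow> 'n set"
  assumes \<mu>: "\<mu> \<in> topspace M"
    and subbase: "\<And>A. finite A \<Longrightarrow> A \<subseteq> I \<Longrightarrow> L \<mu> \<subseteq> \<Union>(S ` A) \<Longrightarrow>
      \<exists>\<O>. openin M \<O> \<and> \<mu> \<in> \<O> \<and> (\<forall>\<mu>'\<in>\<O>. L \<mu>' \<subseteq> \<Union>(S ` A))"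
    and "finite \<F>" "\<forall>J\<in>\<F>. finite J \<and> J \<subseteq> I" "finite A" "A \<subseteq> I"
    and "L \<mu> \<subseteq> \<Union>(S ` A) \<union> (\<Union>J\<in>\<F>. \<Inter>(S ` J))"
  shows "\<exists>\<O>. openin M \<O> \<and> \<mu> \<in> \<O> \<and> (\<forall>\<mu>'\<in>\<O>. L \<mu>' \<subseteq> \<Union>(S ` A) \<union> (\<Union>J\<in>\<F>. \<Inter>(S ` J)))"
  using assms(3-)
proof (induction \<F> arbitrary: A rule: finite_induct)
  case empty
  then show ?case using subbase[of A] by simp
next
  case (insert J \<F>)
  let ?T = "\<lambda>A. \<Union>(S ` A) \<union> (\<Union>J\<in>\<F>. \<Inter>(S ` J))"
  have J: "finite J" "J \<subseteq> I" using insert.prems(1) by simp_all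
  have "\<exists>\<O>. openin M \<O> \<and> \<mu> \<in> \<O> \<and> (\<forall>\<mu>'\<in>\<O>. L \<mu>' \<subseteq> ?T (insert b A))" if b: "b \<in> J" for b
  proof (rule insert.IH)
    have "\<Inter>(S ` J) \<subseteq> S b" using b by blast
    then show "L \<mu> \<subseteq> ?T (insert b A)"
      using insert.prems(4) by auto
  qed (use insert.prems J b in auto)
  then have "\<forall>b\<in>J. \<exists>\<O>. openin M \<O> \<and> \<mu> \<in> \<O> \<and> (\<forall>\<mu>'\<in>\<O>. L \<mu>' \<subseteq> ?T (insert b A))" by blast
  then obtain \<O> where \<O>: "\<forall>b\<in>J. openin M (\<O> b) \<and> \<mu> \<in> \<O> b \<and> (\<forall>\<mu>'\<in>\<O> b. L \<mu>' \<subseteq> ?T (insert b A))"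
    by (rule bchoice[THEN exE])
  let ?O = "topspace M \<inter> \<Inter>(\<O> ` J)"
  have "openin M ?O"
  proof (cases "J = {}")
    case False
    then show ?thesis
      using \<O> J(1) by (intro openin_Int openin_topspace openin_Inter) auto
  qed simp
  moreover have "\<mu> \<in> ?O" using \<mu> \<O> by blast
  moreover have "\<nu> \<in> \<Union>(S ` A) \<union> (\<Union>J\<in>insert J \<F>. \<Inter>(S ` J))"
    if \<mu>': "\<mu>' \<in> ?O" and \<nu>: "\<nu> \<in> L \<mu>'" for \<mu>' \<nu>
  proof (cases "\<nu> \<in> \<Inter>(S ` J)")
    case False
    then obtain b where b: "b \<in> J" "\<nu> \<notin> S b" by blast
    then have "\<mu>' \<in> \<O> b" using \<mu>' by blast
    then have "\<nu> \<in> ?T (insert b A)" using \<O> b(1) \<nu> by blast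
    then show ?thesis using b(2) by auto
  qed simp
  ultimately show ?case by (intro exI[of _ ?O] conjI ballI subsetI)
qed

text \<open>
  As \<open>\<lambda>\<^sup>\<sharp> \<mu>\<close> is compact, an open set around it can be shrunk to a finite union of cylinders, to which
  \<open>upper_continuity_from_subbase\<close> applies.
\<close>
theorem lambda_sharp_continuous:
  "continuous_map (V_space k (Q_space X)) (Q_space (V_space k X)) (lambda_sharp k X)"
  unfolding Q_space_def[of "V_space k X"]
proof (rule continuous_on_generated_topo)
  let ?VQ = "V_space k (Q_space X)" and ?V = "V_space k X"
  show "lambda_sharp k X ` topspace ?VQ \<subseteq> \<Union>{Q_box ?V U | U. openin ?V U}"
  proof -
    have "lambda_sharp k X \<mu> \<in> Q_box ?V (topspace ?V)" if "\<mu> \<in> topspace ?VQ" for \<mu>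
      unfolding Q_box_topspace by (rule lambda_sharp_in_Q_carrier[OF that])
    then show ?thesis using openin_topspace[of ?V] by blast
  qed
  fix \<S> assume "\<S> \<in> {Q_box ?V U | U. openin ?V U}"
  then obtain \<U> where \<U>: "openin ?V \<U>" "\<S> = Q_box ?V \<U>" by blast
  show "openin ?VQ (lambda_sharp k X -` \<S> \<inter> topspace ?VQ)"
  proof (subst openin_subopen, intro ballI)
    fix \<mu> assume "\<mu> \<in> lambda_sharp k X -` \<S> \<inter> topspace ?VQ"
    then have \<mu>: "\<mu> \<in> topspace ?VQ" "lambda_sharp k X \<mu> \<subseteq> \<U>" using \<U>(2) by (auto simp: Q_box_def)
    define \<C> where "\<C> = {B. finite B \<and> (\<forall>U r. (U, r) \<in> B \<longrightarrow> openin X U) \<and> V_cylinder k X B \<subseteq> \<U>}"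
    have "\<And>W. W \<in> V_cylinder k X ` \<C> \<Longrightarrow> openin ?V W"
      by (auto simp: \<C>_def intro!: openin_V_cylinder)
    moreover have "lambda_sharp k X \<mu> \<subseteq> \<Union>(V_cylinder k X ` \<C>)"
    proof
      fix \<nu> assume "\<nu> \<in> lambda_sharp k X \<mu>"
      then have "\<nu> \<in> \<U>" using \<mu>(2) by blast
      from V_space_cylinder_base[OF \<U>(1) this]
      obtain B where "finite B" "\<forall>U r. (U, r) \<in> B \<longrightarrow> openin X U" "\<nu> \<in> V_cylinder k X B" "V_cylinder k X B \<subseteq> \<U>"
        by (elim exE conjE) (rule that)
      then show "\<nu> \<in> \<Union>(V_cylinder k X ` \<C>)" unfolding \<C>_def by blast
    qed
    ultimately obtain \<G> where "finite \<G>" "\<G> \<subseteq> V_cylinder k X ` \<C>" "lambda_sharp k X \<mu> \<subseteq> \<Union>\<G>"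
      using lambda_sharp_compact[OF \<mu>(1)] unfolding compactin_def by (metis (no_types, lifting))
    then obtain \<F> where \<F>: "finite \<F>" "\<F> \<subseteq> \<C>" "lambda_sharp k X \<mu> \<subseteq> \<Union>(V_cylinder k X ` \<F>)"
      by (metis finite_subset_image)
    let ?S = "\<lambda>(U, r). {\<nu>. r < \<nu> U}" and ?I = "{(U, r :: ennreal). openin X U}"
    have cyl: "V_cylinder k X J = topspace ?V \<inter> \<Inter>(?S ` J)" for J
      unfolding V_cylinder_def by auto
    have "\<exists>\<O>. openin ?VQ \<O> \<and> \<mu> \<in> \<O> \<and>
      (\<forall>\<mu>'\<in>\<O>. lambda_sharp k X \<mu>' \<subseteq> \<Union>(?S ` {}) \<union> (\<Union>J\<in>\<F>. \<Inter>(?S ` J)))"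
    proof (rule upper_continuity_from_subbase[OF \<mu>(1), of ?I])
      fix A assume A: "A \<subseteq> ?I" "lambda_sharp k X \<mu> \<subseteq> \<Union>(?S ` A)"
      have op: "\<forall>U r. (U, r) \<in> A \<longrightarrow> openin X U" using A(1) by blast
      have eq: "\<nu> \<in> \<Union>(?S ` B) \<longleftrightarrow> (\<exists>(U, r)\<in>B. r < \<nu> U)" for \<nu> B by auto
      have cover: "\<forall>\<nu>\<in>lambda_sharp k X \<mu>. \<exists>(U, r)\<in>A. r < \<nu> U"
        using A(2) unfolding subset_iff eq by simp
      obtain A' \<O> where *: "finite A'" "A' \<subseteq> A" "openin ?VQ \<O>" "\<mu> \<in> \<O>"
        "\<forall>\<mu>'\<in>\<O>. \<forall>\<nu>\<in>lambda_sharp k X \<mu>'. \<exists>(U, r)\<in>A'. r < \<nu> U"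
        using lambda_sharp_covering_persists[OF \<mu>(1) op cover] by (elim exE conjE) (rule that)
      have "lambda_sharp k X \<mu>' \<subseteq> \<Union>(?S ` A)" if "\<mu>' \<in> \<O>" for \<mu>'
      proof
        fix \<nu> assume "\<nu> \<in> lambda_sharp k X \<mu>'"
        then have "\<nu> \<in> \<Union>(?S ` A')" unfolding eq using *(5) that by blast
        then show "\<nu> \<in> \<Union>(?S ` A)" using *(2) by blast
      qed
      then show "\<exists>\<O>. openin ?VQ \<O> \<and> \<mu> \<in> \<O> \<and> (\<forall>\<mu>'\<in>\<O>. lambda_sharp k X \<mu>' \<subseteq> \<Union>(?S ` A))"
        using *(3,4) by blast
    next
      show "\<forall>J\<in>\<F>. finite J \<and> J \<subseteq> ?I" using \<F>(2) by (auto simp: \<C>_def)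
      show "lambda_sharp k X \<mu> \<subseteq> \<Union>(?S ` {}) \<union> (\<Union>J\<in>\<F>. \<Inter>(?S ` J))"
        using \<F>(3) unfolding cyl by blast
    qed (use \<F>(1) in simp_all)
    then obtain \<O> where \<O>: "openin ?VQ \<O>" "\<mu> \<in> \<O>"
      "\<And>\<mu>'. \<mu>' \<in> \<O> \<Longrightarrow> lambda_sharp k X \<mu>' \<subseteq> (\<Union>J\<in>\<F>. \<Inter>(?S ` J))"
      by auto
    have "\<O> \<subseteq> lambda_sharp k X -` \<S> \<inter> topspace ?VQ"
    proof
      fix \<mu>' assume \<mu>': "\<mu>' \<in> \<O>"
      then have top: "\<mu>' \<in> topspace ?VQ" using openin_subset[OF \<O>(1)] by blast
      have "\<nu> \<in> \<U>" if \<nu>: "\<nu> \<in> lambda_sharp k X \<mu>'" for \<nu>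
      proof -
        obtain J where J: "J \<in> \<F>" "\<nu> \<in> \<Inter>(?S ` J)" using \<O>(3)[OF \<mu>'] \<nu> by blast
        have "\<nu> \<in> V_cylinder k X J"
          unfolding cyl using lambda_sharpD(1)[OF \<nu>] J(2) by blast
        moreover have "V_cylinder k X J \<subseteq> \<U>" using J(1) \<F>(2) unfolding \<C>_def by blast
        ultimately show ?thesis by blast
      qed
      then show "\<mu>' \<in> lambda_sharp k X -` \<S> \<inter> topspace ?VQ"
        using top lambda_sharp_in_Q_carrier[OF top] \<U>(2) by (auto simp: Q_box_def)
    qed
    then show "\<exists>T. openin ?VQ T \<and> \<mu> \<in> T \<and> T \<subseteq> lambda_sharp k X -` \<S> \<inter> topspace ?VQ"
      using \<O>(1,2) by blast
  qed
qed

section \<open>Naturality and the unit law\<close>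

text \<open>
  The common form of the hard inclusions. Since \<open>T\<close> is superadditive, the pairs \<open>(e, w)\<close> with
  \<open>e \<le> T g\<close> and \<open>\<integral> g d\<nu> \<le> w\<close> for some \<open>g\<close> form a cone of constraints; superadditivity suffices
  because pairs with smaller \<open>e\<close> are admitted as well.
\<close>
lemma exists_selection_below:
  assumes \<mu>: "\<mu> \<in> topspace (V_space k (Q_space Z))" and \<nu>: "continuous_valuation X \<nu>"
    and T_lsc: "\<And>g. g \<in> lsc X \<Longrightarrow> T g \<in> lsc Z"
    and T_add: "\<And>g h z. g \<in> lsc X \<Longrightarrow> h \<in> lsc X \<Longrightarrow> T g z + T h z \<le> T (\<lambda>x. g x + h x) z"
    and T_scale: "\<And>g a z. g \<in> lsc X \<Longrightarrow> 0 < a \<Longrightarrow> a < top \<Longrightarrow> a * T g z \<le> T (\<lambda>x. a * g x) z"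
    and le: "\<And>g. g \<in> lsc X \<Longrightarrow> lower_integral Z \<mu> (T g) \<le> val_integral X \<nu> g"
  shows "\<exists>\<nu>'\<in>lambda_sharp k Z \<mu>. \<forall>g\<in>lsc X. val_integral Z \<nu>' (T g) \<le> val_integral X \<nu> g"
proof -
  have cv: "continuous_valuation (Q_space Z) \<mu>" using \<mu> by simp
  define K where "K = {(e, w). e \<in> lsc Z \<and> (\<exists>g\<in>lsc X. e \<le> T g \<and> val_integral X \<nu> g \<le> w)}"
  have KI: "(e, w) \<in> K" if "e \<in> lsc Z" "g \<in> lsc X" "e \<le> T g" "val_integral X \<nu> g \<le> w" for e w g
    using that unfolding K_def by blast
  have KD: "\<exists>g\<in>lsc X. e \<in> lsc Z \<and> e \<le> T g \<and> val_integral X \<nu> g \<le> w" if "(e, w) \<in> K" for e w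
    using that unfolding K_def by blast
  have "constraint_cone K"
    unfolding constraint_cone_def
  proof (intro conjI allI impI; (elim conjE)?)
    show "(\<lambda>_. 0, 0) \<in> K"
      by (rule KI[of _ "\<lambda>_. 0"]) (simp_all add: lsc_zero val_integral_zero[OF \<nu>] le_fun_def)
  next
    fix e w e' w' assume K: "(e, w) \<in> K" "(e', w') \<in> K"
    obtain g where g: "g \<in> lsc X" "e \<in> lsc Z" "e \<le> T g" "val_integral X \<nu> g \<le> w"
      using KD[OF K(1)] by blast
    obtain h where h: "h \<in> lsc X" "e' \<in> lsc Z" "e' \<le> T h" "val_integral X \<nu> h \<le> w'"
      using KD[OF K(2)] by blast
    show "(\<lambda>x. e x + e' x, w + w') \<in> K"
    proof (rule KI[OF lsc_add[OF g(2) h(2)] lsc_add[OF g(1) h(1)]])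
      show "(\<lambda>x. e x + e' x) \<le> T (\<lambda>x. g x + h x)"
        by (rule le_funI, rule order_trans[OF add_mono[OF le_funD[OF g(3)] le_funD[OF h(3)]] T_add[OF g(1) h(1)]])
      show "val_integral X \<nu> (\<lambda>x. g x + h x) \<le> w + w'"
        unfolding linear_scott_onD(4)[OF linear_scott_val_integral[OF \<nu>] g(1) h(1)]
        by (rule add_mono[OF g(4) h(4)])
    qed
  next
    fix e w and a :: ennreal assume K: "(e, w) \<in> K" and a: "0 < a" "a < top"
    obtain g where g: "g \<in> lsc X" "e \<in> lsc Z" "e \<le> T g" "val_integral X \<nu> g \<le> w"
      using KD[OF K] by blast
    show "(\<lambda>x. a * e x, a * w) \<in> K"
    proof (rule KI[OF lsc_scale[OF g(2) a] lsc_scale[OF g(1) a]])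
      show "(\<lambda>x. a * e x) \<le> T (\<lambda>x. a * g x)"
        by (rule le_funI, rule order_trans[OF mult_left_mono[OF le_funD[OF g(3)]] T_scale[OF g(1) a]]) simp
      show "val_integral X \<nu> (\<lambda>x. a * g x) \<le> a * w"
        unfolding val_integral_scale[OF \<nu> g(1) a] using g(4) by (rule mult_left_mono) simp
    qed
  qed
  moreover have "e \<in> lsc Z \<and> lower_integral Z \<mu> e \<le> w" if "(e, w) \<in> K" for e w
  proof -
    obtain g where g: "g \<in> lsc X" "e \<in> lsc Z" "e \<le> T g" "val_integral X \<nu> g \<le> w"
      using KD[OF \<open>(e, w) \<in> K\<close>] by blast
    have "lower_integral Z \<mu> e \<le> lower_integral Z \<mu> (T g)"
      by (rule superlinear_onD(2)[OF superlinear_lower_integral[OF cv] g(2) T_lsc[OF g(1)] g(3)])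
    also have "\<dots> \<le> val_integral X \<nu> g" by (rule le[OF g(1)])
    finally show ?thesis using g(2,4) by simp
  qed
  ultimately obtain \<nu>' where \<nu>': "\<nu>' \<in> lambda_sharp k Z \<mu>"
    "\<forall>e w. (e, w) \<in> K \<longrightarrow> val_integral Z \<nu>' e \<le> w"
    using exists_selection_with_constraints[OF \<mu>, of K] by blast
  have "val_integral Z \<nu>' (T g) \<le> val_integral X \<nu> g" if "g \<in> lsc X" for g
    using \<nu>'(2) KI[OF T_lsc[OF that] that order_refl order_refl] by blast
  then show ?thesis using \<nu>'(1) by blast
qed

lemma continuous_map_preimage:
  assumes "continuous_map X Y f" "openin Y V"
  shows "openin X {x \<in> topspace X. f x \<in> V}"
  using assms by (simp add: continuous_map_def)

lemma V_map_apply: "openin Y V \<Longrightarrow> V_map X Y f \<nu> V = \<nu> {x \<in> topspace X. f x \<in> V}"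
  by (simp add: V_map_def)

lemma V_map_in_V_space:
  assumes f: "continuous_map X Y f" and \<nu>: "\<nu> \<in> topspace (V_space k X)"
  shows "V_map X Y f \<nu> \<in> topspace (V_space k Y)"
proof -
  let ?p = "\<lambda>V. {x \<in> topspace X. f x \<in> V}"
  have cv: "continuous_valuation X \<nu>" and kind: "has_kind k X \<nu>" using \<nu> by auto
  note op = continuous_map_preimage[OF f]
  have "continuous_valuation Y (V_map X Y f \<nu>)"
    unfolding continuous_valuation_def
  proof (intro conjI allI impI)
    show "V_map X Y f \<nu> \<in> extensional {U. openin Y U}" by (simp add: V_map_def)
    show "V_map X Y f \<nu> {} = 0" by (simp add: V_map_apply continuous_valuationD(1)[OF cv])
    fix U V assume "openin Y U \<and> openin Y V"
    then have UV: "openin Y U" "openin Y V" by auto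
    have eqs: "?p (U \<union> V) = ?p U \<union> ?p V" "?p (U \<inter> V) = ?p U \<inter> ?p V" by auto
    show "V_map X Y f \<nu> U + V_map X Y f \<nu> V = V_map X Y f \<nu> (U \<union> V) + V_map X Y f \<nu> (U \<inter> V)"
      unfolding V_map_apply[OF UV(1)] V_map_apply[OF UV(2)] V_map_apply[OF openin_Un[OF UV]]
        V_map_apply[OF openin_Int[OF UV]] eqs
      by (rule continuous_valuationD(2)[OF cv op[OF UV(1)] op[OF UV(2)]])
  next
    fix U V assume UV: "openin Y U \<and> openin Y V \<and> U \<subseteq> V"
    then have "\<nu> (?p U) \<le> \<nu> (?p V)"
      by (intro continuous_valuationD(3)[OF cv] op) auto
    then show "V_map X Y f \<nu> U \<le> V_map X Y f \<nu> V" using UV by (simp add: V_map_apply)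
  next
    fix D assume D: "D \<noteq> {} \<and> (\<forall>U\<in>D. openin Y U) \<and> (\<forall>U\<in>D. \<forall>V\<in>D. \<exists>W\<in>D. U \<subseteq> W \<and> V \<subseteq> W)"
    have eq: "?p (\<Union>D) = \<Union>(?p ` D)" by auto
    have "\<nu> (\<Union>(?p ` D)) = (SUP U\<in>?p ` D. \<nu> U)"
    proof (rule continuous_valuationD(4)[OF cv])
      show "?p ` D \<noteq> {}" using D by blast
      show "openin X U" if "U \<in> ?p ` D" for U using that D op by auto
      fix U V assume "U \<in> ?p ` D" "V \<in> ?p ` D"
      then obtain U' V' where U': "U' \<in> D" "V' \<in> D" "U = ?p U'" "V = ?p V'" by blast
      then obtain W where "W \<in> D" "U' \<subseteq> W" "V' \<subseteq> W" using D by meson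
      then show "\<exists>W\<in>?p ` D. U \<subseteq> W \<and> V \<subseteq> W" using U' by (intro bexI[of _ "?p W"]) auto
    qed
    also have "\<dots> = (SUP U\<in>D. V_map X Y f \<nu> U)"
      unfolding image_image using D by (intro SUP_cong) (auto simp: V_map_apply)
    finally show "V_map X Y f \<nu> (\<Union>D) = (SUP U\<in>D. V_map X Y f \<nu> U)"
      using D by (simp add: V_map_apply openin_Union eq[symmetric])
  qed
  moreover have "?p (topspace Y) = topspace X"
    using continuous_map_image_subset_topspace[OF f] by auto
  then have "has_kind k Y (V_map X Y f \<nu>)"
    using kind by (cases k) (simp_all add: V_map_apply)
  ultimately show ?thesis by simp
qed

lemma lsc_compose:
  assumes f: "continuous_map X Y f" and h: "h \<in> lsc Y"
  shows "(\<lambda>x. if x \<in> topspace X then h (f x) else 0) \<in> lsc X"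
proof -
  have "{x. t < (if x \<in> topspace X then h (f x) else 0)} = {x \<in> topspace X. f x \<in> {y. t < h y}}" for t
    by auto
  then show ?thesis
    using continuous_map_preimage[OF f lsc_openin[OF h]] by (simp only: lsc_def mem_Collect_eq) blast
qed

lemma val_integral_V_map:
  assumes f: "continuous_map X Y f" and h: "h \<in> lsc Y"
  shows "val_integral Y (V_map X Y f \<nu>) h = val_integral X \<nu> (\<lambda>x. if x \<in> topspace X then h (f x) else 0)"
proof -
  have "{x \<in> topspace X. f x \<in> {y. ennreal t < h y}}
      = {x. ennreal t < (if x \<in> topspace X then h (f x) else 0)}" for t
    by auto
  then show ?thesis
    by (simp only: val_integral_lsc[OF h] val_integral_lsc[OF lsc_compose[OF f h]] V_map_apply[OF lsc_openin[OF h]])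
qed

text \<open>
  Open sets are upward closed in the specialization preordering. Therefore saturation affects
  neither compactness nor containment in open sets.
\<close>
lemma up_closure_subset_iff:
  assumes "openin X U" "A \<subseteq> topspace X"
  shows "up_closure X A \<subseteq> U \<longleftrightarrow> A \<subseteq> U"
proof
  have "A \<subseteq> up_closure X A"
    using assms(2) unfolding up_closure_def specialization_le_def by blast
  then show "up_closure X A \<subseteq> U \<Longrightarrow> A \<subseteq> U" by blast
  show "A \<subseteq> U \<Longrightarrow> up_closure X A \<subseteq> U"
    using assms(1) unfolding up_closure_def specialization_le_def by blast
qed

lemma up_closure_in_Q_carrier:
  assumes A: "A \<noteq> {}" "compactin X A"
  shows "up_closure X A \<in> Q_carrier X"
proof -
  have sub: "A \<subseteq> topspace X" using A(2) by (simp add: compactin_def)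
  have "A \<subseteq> up_closure X A"
    using sub unfolding up_closure_def specialization_le_def by blast
  moreover have up_sub: "up_closure X A \<subseteq> topspace X"
    unfolding up_closure_def specialization_le_def by blast
  moreover have "saturated_in X (up_closure X A)"
    unfolding saturated_in_def
  proof (intro conjI allI impI; (elim conjE)?)
    fix x y assume "x \<in> up_closure X A" "specialization_le X x y"
    then obtain a where "a \<in> A" "specialization_le X a x" unfolding up_closure_def by blast
    then have "specialization_le X a y"
      using \<open>specialization_le X x y\<close> unfolding specialization_le_def by blast
    then show "y \<in> up_closure X A" using \<open>a \<in> A\<close> unfolding up_closure_def by blast
  qed (rule up_sub)
  moreover have "compactin X (up_closure X A)"
    unfolding compactin_def
  proof (intro conjI allI impI; (elim conjE)?)
    fix \<U> assume \<U>: "\<forall>U\<in>\<U>. openin X U" "up_closure X A \<subseteq> \<Union>\<U>"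
    have "A \<subseteq> \<Union>\<U>" using \<U>(2) \<open>A \<subseteq> up_closure X A\<close> by blast
    then obtain \<F> where \<F>: "finite \<F>" "\<F> \<subseteq> \<U>" "A \<subseteq> \<Union>\<F>"
      using A(2) \<U>(1) unfolding compactin_def by meson
    have "openin X (\<Union>\<F>)" using \<F>(2) \<U>(1) by (intro openin_Union) blast
    then have "up_closure X A \<subseteq> \<Union>\<F>" using up_closure_subset_iff[OF _ sub] \<F>(3) by blast
    then show "\<exists>\<F>. finite \<F> \<and> \<F> \<subseteq> \<U> \<and> up_closure X A \<subseteq> \<Union>\<F>" using \<F> by blast
  qed (rule up_sub)
  ultimately show ?thesis using A(1) by (auto simp: Q_carrier_def)
qed

lemma Q_map_in_Q_box_iff:
  assumes f: "continuous_map X Y f" and Q: "Q \<in> Q_carrier X" and V: "openin Y V"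
  shows "Q_map Y f Q \<in> Q_box Y V \<longleftrightarrow> Q \<in> Q_box X {x \<in> topspace X. f x \<in> V}"
proof -
  have comp: "compactin X Q" and sub: "Q \<subseteq> topspace X" and ne: "f ` Q \<noteq> {}"
    using Q Q_carrier_subset[OF Q] by (auto simp: Q_carrier_def)
  have "compactin Y (f ` Q)" by (rule image_compactin[OF comp f])
  then have "Q_map Y f Q \<in> Q_carrier Y"
    unfolding Q_map_def by (rule up_closure_in_Q_carrier[OF ne])
  moreover have "Q_map Y f Q \<subseteq> V \<longleftrightarrow> f ` Q \<subseteq> V"
    unfolding Q_map_def using \<open>compactin Y (f ` Q)\<close>
    by (intro up_closure_subset_iff V) (simp add: compactin_def)
  ultimately show ?thesis using Q sub by (auto simp: Q_box_def)
qed

text \<open>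
  Both sides concern the capacity \<open>V \<mapsto> \<mu> (\<box>(f\<^sup>-\<^sup>1 V))\<close>. A valuation \<open>\<nu>\<close> above it has to dominate an image
  \<open>V f (\<nu>')\<close>, which follows from \<open>\<integral> (g \<circ> f) d\<nu>' \<le> \<integral> g d\<nu>\<close>.
\<close>
lemma lambda_sharp_natural:
  assumes f: "continuous_map X Y f" and \<mu>: "\<mu> \<in> topspace (V_space k (Q_space X))"
  shows "lambda_sharp k Y (V_map (Q_space X) (Q_space Y) (Q_map Y f) \<mu>)
    = Q_map (V_space k Y) (V_map X Y f) (lambda_sharp k X \<mu>)"
proof -
  let ?p = "\<lambda>V. {x \<in> topspace X. f x \<in> V}"
  let ?f\<mu> = "V_map (Q_space X) (Q_space Y) (Q_map Y f) \<mu>"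
  have cv: "continuous_valuation (Q_space X) \<mu>" using \<mu> by simp
  have f\<mu>: "?f\<mu> (Q_box Y V) = \<mu> (Q_box X (?p V))" if V: "openin Y V" for V
  proof -
    have "{Q \<in> topspace (Q_space X). Q_map Y f Q \<in> Q_box Y V} = Q_box X (?p V)"
      using Q_map_in_Q_box_iff[OF f _ V] by (auto simp: Q_box_def)
    then show ?thesis by (simp only: V_map_apply[OF openin_Q_box[OF V]])
  qed
  show ?thesis
  proof (intro equalityI subsetI)
    fix \<nu> assume "\<nu> \<in> Q_map (V_space k Y) (V_map X Y f) (lambda_sharp k X \<mu>)"
    then obtain \<nu>' where \<nu>': "\<nu>' \<in> lambda_sharp k X \<mu>"
      and le: "specialization_le (V_space k Y) (V_map X Y f \<nu>') \<nu>"
      unfolding Q_map_def up_closure_def by blast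
    have "?f\<mu> (Q_box Y V) \<le> \<nu> V" if V: "openin Y V" for V
    proof -
      have "\<mu> (Q_box X (?p V)) \<le> \<nu>' (?p V)"
        by (rule lambda_sharpD(3)[OF \<nu>' continuous_map_preimage[OF f V]])
      also have "\<dots> = V_map X Y f \<nu>' V" by (rule V_map_apply[OF V, symmetric])
      also have "\<dots> \<le> \<nu> V" using le V unfolding specialization_V_iff by blast
      finally show ?thesis by (simp only: f\<mu>[OF V])
    qed
    then show "\<nu> \<in> lambda_sharp k Y ?f\<mu>"
      using le unfolding specialization_V_iff lambda_sharp_def by blast
  next
    fix \<nu> assume \<nu>: "\<nu> \<in> lambda_sharp k Y ?f\<mu>"
    note \<nu>_cv = lambda_sharpD(2)[OF \<nu>]
    let ?c = "\<lambda>g x. if x \<in> topspace X then g (f x) else (0 :: ennreal)"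
    have "\<exists>\<nu>'\<in>lambda_sharp k X \<mu>. \<forall>g\<in>lsc Y. val_integral X \<nu>' (?c g) \<le> val_integral Y \<nu> g"
    proof (rule exists_selection_below[OF \<mu> \<nu>_cv])
      fix g assume g: "g \<in> lsc Y"
      show c: "?c g \<in> lsc X" by (rule lsc_compose[OF f g])
      show "lower_integral X \<mu> (?c g) \<le> val_integral Y \<nu> g"
      proof (rule lower_integral_le[OF cv c g])
        fix t
        have "{x. t < ?c g x} = ?p {y. t < g y}" by auto
        then have "\<mu> (Q_box X {x. t < ?c g x}) = ?f\<mu> (Q_box Y {y. t < g y})"
          by (simp only: f\<mu>[OF lsc_openin[OF g]])
        then show "\<mu> (Q_box X {x. t < ?c g x}) \<le> \<nu> {y. t < g y}"
          using lambda_sharpD(3)[OF \<nu> lsc_openin[OF g]] by simp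
      qed
    qed simp_all
    then obtain \<nu>' where \<nu>': "\<nu>' \<in> lambda_sharp k X \<mu>"
      "\<And>g. g \<in> lsc Y \<Longrightarrow> val_integral X \<nu>' (?c g) \<le> val_integral Y \<nu> g"
      by auto
    have "V_map X Y f \<nu>' V \<le> \<nu> V" if V: "openin Y V" for V
    proof -
      have p: "openin X (?p V)" by (rule continuous_map_preimage[OF f V])
      have "?c (indicator V) = indicator (?p V)" by (auto simp: fun_eq_iff indicator_def)
      then have "val_integral X \<nu>' (indicator (?p V)) \<le> \<nu> V"
        using \<nu>'(2)[OF lsc_indicator[OF V]] val_integral_indicator[OF \<nu>_cv V] by simp
      then show ?thesis
        by (simp only: V_map_apply[OF V] val_integral_indicator[OF lambda_sharpD(2)[OF \<nu>'(1)] p])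
    qed
    then have "specialization_le (V_space k Y) (V_map X Y f \<nu>') \<nu>"
      unfolding specialization_V_iff
      using V_map_in_V_space[OF f lambda_sharpD(1)[OF \<nu>'(1)]] lambda_sharpD(1)[OF \<nu>] by blast
    then show "\<nu> \<in> Q_map (V_space k Y) (V_map X Y f) (lambda_sharp k X \<mu>)"
      using \<nu>'(1) unfolding Q_map_def up_closure_def by blast
  qed
qed

text \<open>
  For an open set, \<open>\<up>x \<subseteq> U\<close> means \<open>x \<in> U\<close>, so the capacity of the image of \<open>\<nu>\<close> is \<open>\<nu>\<close> itself.
\<close>
lemma lambda_sharp_unit:
  assumes \<nu>: "\<nu> \<in> topspace (V_space k X)"
  shows "lambda_sharp k X (V_map X (Q_space X) (Q_unit X) \<nu>) = Q_unit (V_space k X) \<nu>"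
proof -
  have "V_map X (Q_space X) (Q_unit X) \<nu> (Q_box X U) = \<nu> U" if U: "openin X U" for U
  proof -
    have "Q_unit X x \<in> Q_box X U \<longleftrightarrow> x \<in> U" if x: "x \<in> topspace X" for x
    proof -
      have "Q_unit X x \<in> Q_carrier X"
        unfolding Q_unit_def using x by (intro up_closure_in_Q_carrier) (simp_all add: finite_imp_compactin)
      then show ?thesis
        using up_closure_subset_iff[OF U, of "{x}"] x by (simp add: Q_box_def Q_unit_def)
    qed
    then have "{x \<in> topspace X. Q_unit X x \<in> Q_box X U} = U"
      using openin_subset[OF U] by blast
    then show ?thesis by (simp only: V_map_apply[OF openin_Q_box[OF U]])
  qed
  then show ?thesis
    using \<nu> unfolding lambda_sharp_def Q_unit_def up_closure_def specialization_V_iff by auto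
qed

section \<open>The multiplication of compact saturated sets\<close>

text \<open>
  Given an open cover of the union, the boxes of finite unions of its members cover the compact
  set \<open>\<Q>\<close> of compact sets.
\<close>
lemma Q_mult_in_Q_carrier:
  assumes \<Q>: "\<Q> \<in> Q_carrier (Q_space X)"
  shows "Q_mult \<Q> \<in> Q_carrier X"
proof -
  have sub: "\<Q> \<subseteq> Q_carrier X" using Q_carrier_subset[OF \<Q>] by simp
  have comp: "compactin (Q_space X) \<Q>" and ne: "\<Q> \<noteq> {}" using \<Q> by (auto simp: Q_carrier_def)
  have "\<Union>\<Q> \<noteq> {}" using ne sub Q_carrier_nonempty by (metis Union_empty_conv ex_in_conv subsetD)
  moreover have top: "\<Union>\<Q> \<subseteq> topspace X" using sub Q_carrier_subset by blast
  moreover have "saturated_in X (\<Union>\<Q>)"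
    unfolding saturated_in_def
  proof (intro conjI allI impI; (elim conjE)?)
    fix x y assume "x \<in> \<Union>\<Q>" "specialization_le X x y"
    then obtain Q where Q: "Q \<in> \<Q>" "x \<in> Q" by blast
    then have "saturated_in X Q" using sub by (auto simp: Q_carrier_def)
    then show "y \<in> \<Union>\<Q>" using Q \<open>specialization_le X x y\<close> unfolding saturated_in_def by blast
  qed (rule top)
  moreover have "compactin X (\<Union>\<Q>)"
    unfolding compactin_def
  proof (intro conjI allI impI; (elim conjE)?)
    fix \<U> assume \<U>: "\<forall>U\<in>\<U>. openin X U" "\<Union>\<Q> \<subseteq> \<Union>\<U>"
    define \<V> where "\<V> = {\<F>. finite \<F> \<and> \<F> \<subseteq> \<U>}"
    have op: "openin X (\<Union>\<F>)" if "\<F> \<in> \<V>" for \<F> using that \<U>(1) unfolding \<V>_def by blast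
    have cov: "\<Q> \<subseteq> \<Union>((\<lambda>\<F>. Q_box X (\<Union>\<F>)) ` \<V>)"
    proof
      fix Q assume Q: "Q \<in> \<Q>"
      then have "compactin X Q" "Q \<subseteq> \<Union>\<U>" using sub \<U>(2) by (auto simp: Q_carrier_def)
      then obtain \<F> where "finite \<F>" "\<F> \<subseteq> \<U>" "Q \<subseteq> \<Union>\<F>"
        using \<U>(1) unfolding compactin_def by meson
      then have "\<F> \<in> \<V>" "Q \<in> Q_box X (\<Union>\<F>)" using Q sub by (auto simp: \<V>_def Q_box_def)
      then show "Q \<in> \<Union>((\<lambda>\<F>. Q_box X (\<Union>\<F>)) ` \<V>)" by blast
    qed
    have "\<forall>W\<in>(\<lambda>\<F>. Q_box X (\<Union>\<F>)) ` \<V>. openin (Q_space X) W"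
      using op openin_Q_box by blast
    then obtain \<G> where "finite \<G>" "\<G> \<subseteq> (\<lambda>\<F>. Q_box X (\<Union>\<F>)) ` \<V>" "\<Q> \<subseteq> \<Union>\<G>"
      using comp cov unfolding compactin_def by meson
    then obtain \<W> where \<W>: "\<W> \<subseteq> \<V>" "finite \<W>" "\<Q> \<subseteq> \<Union>((\<lambda>\<F>. Q_box X (\<Union>\<F>)) ` \<W>)"
      by (metis finite_subset_image)
    have "finite (\<Union>\<W>)" "\<Union>\<W> \<subseteq> \<U>" using \<W>(1,2) unfolding \<V>_def by blast+
    moreover have "\<Union>\<Q> \<subseteq> \<Union>(\<Union>\<W>)" using \<W>(3) unfolding Q_box_def by blast
    ultimately show "\<exists>\<F>. finite \<F> \<and> \<F> \<subseteq> \<U> \<and> \<Union>\<Q> \<subseteq> \<Union>\<F>" by blast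
  qed (rule top)
  ultimately show ?thesis by (simp add: Q_carrier_def Q_mult_def)
qed

lemma Q_mult_in_Q_box_iff:
  assumes "\<Q> \<in> Q_carrier (Q_space X)"
  shows "Q_mult \<Q> \<in> Q_box X U \<longleftrightarrow> \<Q> \<in> Q_box (Q_space X) (Q_box X U)"
  using assms Q_mult_in_Q_carrier[OF assms] Q_carrier_subset[OF assms]
  by (auto simp: Q_box_def Q_mult_def)

text \<open>
  In \<open>Q\<close> the specialization preordering is reverse inclusion. For the values of \<open>\<lambda>\<^sup>\<sharp>\<close> this is seen from
  the open sets \<open>[U > \<nu> U]\<close>, one of which contains \<open>\<lambda>\<^sup>\<sharp> \<mu>\<close> but not \<open>\<nu>\<close> if
  \<open>\<nu>\<close> is outside \<open>\<lambda>\<^sup>\<sharp> \<mu>\<close>.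
\<close>
lemma specialization_Q_lambda_sharp:
  assumes \<mu>: "\<mu> \<in> topspace (V_space k (Q_space X))"
    and le: "specialization_le (Q_space (V_space k X)) (lambda_sharp k X \<mu>) \<Q>"
  shows "\<Q> \<subseteq> lambda_sharp k X \<mu>"
proof
  fix \<nu> assume \<nu>: "\<nu> \<in> \<Q>"
  have \<Q>: "\<Q> \<in> Q_carrier (V_space k X)"
    using le unfolding specialization_le_def by simp
  have top: "\<nu> \<in> topspace (V_space k X)" using Q_carrier_subset[OF \<Q>] \<nu> by blast
  have "\<mu> (Q_box X U) \<le> \<nu> U" if U: "openin X U" for U
  proof (rule leI, rule notI)
    assume less: "\<nu> U < \<mu> (Q_box X U)"
    let ?O = "{\<nu>' \<in> topspace (V_space k X). \<nu> U < \<nu>' U}"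
    have "\<nu> U < \<nu>' U" if "\<nu>' \<in> lambda_sharp k X \<mu>" for \<nu>'
      using less lambda_sharpD(3)[OF that U] by (rule order_less_le_trans)
    then have "lambda_sharp k X \<mu> \<subseteq> ?O"
      using lambda_sharpD(1) by blast
    then have "lambda_sharp k X \<mu> \<in> Q_box (V_space k X) ?O"
      using lambda_sharp_in_Q_carrier[OF \<mu>] by (simp add: Q_box_def)
    then have "\<Q> \<in> Q_box (V_space k X) ?O"
      using le openin_Q_box[OF openin_V_evaluation[OF U]] unfolding specialization_le_def by blast
    then have "\<nu> U < \<nu> U" using \<nu> unfolding Q_box_def by blast
    then show False by simp
  qed
  then show "\<nu> \<in> lambda_sharp k X \<mu>" using top unfolding lambda_sharp_def by blast
qed

text \<open>
  Both sides concern the capacity \<open>U \<mapsto> \<mu> (\<box>\<box>U)\<close>. A valuation \<open>\<nu>\<close> above it has to lie in \<open>\<lambda>\<^sup>\<sharp> m\<close> for some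
  \<open>m\<close> in \<open>\<lambda>\<^sup>\<sharp> \<mu>\<close>, which is implied by \<open>\<integral> (min g on Q) dm \<le> \<integral> g d\<nu>\<close> for indicators \<open>g\<close>.
\<close>
lemma lambda_sharp_Q_mult:
  assumes \<mu>: "\<mu> \<in> topspace (V_space k (Q_space (Q_space X)))"
  shows "lambda_sharp k X (V_map (Q_space (Q_space X)) (Q_space X) Q_mult \<mu>)
    = Q_mult (Q_map (Q_space (V_space k X)) (lambda_sharp k X) (lambda_sharp k (Q_space X) \<mu>))"
  (is "_ = ?rhs")
proof -
  let ?m\<mu> = "V_map (Q_space (Q_space X)) (Q_space X) Q_mult \<mu>"
  have cv: "continuous_valuation (Q_space (Q_space X)) \<mu>" using \<mu> by simp
  have m\<mu>: "?m\<mu> (Q_box X U) = \<mu> (Q_box (Q_space X) (Q_box X U))" if U: "openin X U" for U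
  proof -
    have "{\<Q> \<in> topspace (Q_space (Q_space X)). Q_mult \<Q> \<in> Q_box X U} = Q_box (Q_space X) (Q_box X U)"
    proof (rule set_eqI)
      fix \<Q>
      show "\<Q> \<in> {\<Q> \<in> topspace (Q_space (Q_space X)). Q_mult \<Q> \<in> Q_box X U} \<longleftrightarrow> \<Q> \<in> Q_box (Q_space X) (Q_box X U)"
        by (cases "\<Q> \<in> Q_carrier (Q_space X)")
          (simp_all add: Q_mult_in_Q_box_iff, simp add: Q_box_def)
    qed
    then show ?thesis by (simp only: V_map_apply[OF openin_Q_box[OF U]])
  qed
  show ?thesis
  proof (intro equalityI subsetI)
    fix \<nu> assume "\<nu> \<in> ?rhs"
    then obtain \<Q> m where m: "m \<in> lambda_sharp k (Q_space X) \<mu>" "\<nu> \<in> \<Q>"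
      "specialization_le (Q_space (V_space k X)) (lambda_sharp k X m) \<Q>"
      unfolding Q_mult_def Q_map_def up_closure_def by blast
    have \<nu>: "\<nu> \<in> lambda_sharp k X m"
      using specialization_Q_lambda_sharp[OF lambda_sharpD(1)[OF m(1)] m(3)] m(2) by blast
    have "?m\<mu> (Q_box X U) \<le> \<nu> U" if U: "openin X U" for U
      unfolding m\<mu>[OF U]
      using lambda_sharpD(3)[OF m(1) openin_Q_box[OF U]] lambda_sharpD(3)[OF \<nu> U] by (rule order_trans)
    then show "\<nu> \<in> lambda_sharp k X ?m\<mu>"
      using lambda_sharpD(1)[OF \<nu>] unfolding lambda_sharp_def by blast
  next
    fix \<nu> assume \<nu>: "\<nu> \<in> lambda_sharp k X ?m\<mu>"
    note \<nu>_cv = lambda_sharpD(2)[OF \<nu>]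
    have "\<exists>m\<in>lambda_sharp k (Q_space X) \<mu>. \<forall>g\<in>lsc X. val_integral (Q_space X) m (min_on X g) \<le> val_integral X \<nu> g"
    proof (rule exists_selection_below[OF \<mu> \<nu>_cv])
      fix g assume g: "g \<in> lsc X"
      show c: "min_on X g \<in> lsc (Q_space X)" by (rule min_on_lsc[OF g])
      show "lower_integral (Q_space X) \<mu> (min_on X g) \<le> val_integral X \<nu> g"
      proof (rule lower_integral_le[OF cv c g])
        fix t
        have "\<mu> (Q_box (Q_space X) {Q. t < min_on X g Q}) \<le> \<mu> (Q_box (Q_space X) (Q_box X {x. t < g x}))"
          using min_on_level_subset[of t X g]
          by (intro continuous_valuationD(3)[OF cv] openin_Q_box lsc_openin c g) (auto simp: Q_box_def[of "Q_space X"])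
        also have "\<dots> \<le> \<nu> {x. t < g x}"
          using lambda_sharpD(3)[OF \<nu> lsc_openin[OF g]] by (simp only: m\<mu>[OF lsc_openin[OF g]])
        finally show "\<mu> (Q_box (Q_space X) {Q. t < min_on X g Q}) \<le> \<nu> {x. t < g x}" .
      qed
    qed (simp_all add: min_on_superadditive min_on_scale)
    then obtain m where m: "m \<in> lambda_sharp k (Q_space X) \<mu>"
      "\<And>g. g \<in> lsc X \<Longrightarrow> val_integral (Q_space X) m (min_on X g) \<le> val_integral X \<nu> g"
      by auto
    have "m (Q_box X U) \<le> \<nu> U" if U: "openin X U" for U
    proof -
      have "val_integral (Q_space X) m (indicator (Q_box X U)) \<le> \<nu> U"
        using m(2)[OF lsc_indicator[OF U]] val_integral_indicator[OF \<nu>_cv U] by (simp add: min_on_indicator)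
      then show ?thesis
        by (simp only: val_integral_indicator[OF lambda_sharpD(2)[OF m(1)] openin_Q_box[OF U]])
    qed
    then have \<nu>_m: "\<nu> \<in> lambda_sharp k X m"
      using lambda_sharpD(1)[OF \<nu>] unfolding lambda_sharp_def by blast
    have "specialization_le (Q_space (V_space k X)) (lambda_sharp k X m) (lambda_sharp k X m)"
      unfolding specialization_le_def topspace_Q_space
      using lambda_sharp_in_Q_carrier[OF lambda_sharpD(1)[OF m(1)]] by blast
    then show "\<nu> \<in> ?rhs"
      unfolding Q_mult_def Q_map_def up_closure_def using m(1) \<nu>_m by blast
  qed
qed

section \<open>The multiplication of valuations\<close>

lemma integral_map_preserves:
  shows "f \<in> lsc X \<Longrightarrow> g \<in> lsc X \<Longrightarrow> f \<le> g \<Longrightarrow> integral_map k X f \<le> integral_map k X g"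
    and "f \<in> lsc X \<Longrightarrow> g \<in> lsc X \<Longrightarrow>
      integral_map k X (\<lambda>x. f x + g x) = (\<lambda>\<nu>. integral_map k X f \<nu> + integral_map k X g \<nu>)"
    and "f \<in> lsc X \<Longrightarrow> 0 < a \<Longrightarrow> a < top \<Longrightarrow> integral_map k X (\<lambda>x. a * f x) = (\<lambda>\<nu>. a * integral_map k X f \<nu>)"
    and "integral_map k X (\<lambda>_. 0) = (\<lambda>_. 0)"
  using linear_scott_onD(1-4)[OF linear_scott_val_integral]
  by (auto simp: integral_map_def le_fun_def fun_eq_iff)

lemma integral_map_Sup:
  assumes D: "D \<subseteq> lsc X" "directed_family D"
  shows "integral_map k X (Sup D) = Sup (integral_map k X ` D)"
proof (rule ext)
  fix \<nu>
  show "integral_map k X (Sup D) \<nu> = Sup (integral_map k X ` D) \<nu>"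
  proof (cases "\<nu> \<in> topspace (V_space k X)")
    case True
    then have "continuous_valuation X \<nu>" by simp
    from linear_scott_onD(5)[OF linear_scott_val_integral[OF this] D lsc_Sup[OF D(1)]] show ?thesis
      using True by (simp only: integral_map_def if_True Sup_apply image_image)
  next
    case False
    then show ?thesis
      using D(2) by (simp only: integral_map_def if_False Sup_apply image_image) (simp add: directed_family_def)
  qed
qed

lemma linear_scott_iterated_integral:
  assumes \<Xi>: "continuous_valuation (V_space k X) \<Xi>"
  shows "linear_scott_on (lsc X) (\<lambda>h. val_integral (V_space k X) \<Xi> (integral_map k X h))"
proof (rule linear_scott_onI)
  let ?I = "val_integral (V_space k X) \<Xi>" and ?m = "integral_map k X"
  note lin = linear_scott_onD[OF linear_scott_val_integral[OF \<Xi>]]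
  show "?I (?m (\<lambda>_. 0)) = 0"
    unfolding integral_map_preserves(4) by (rule lin(1))
  show "?I (?m f) \<le> ?I (?m g)"
    if "f \<in> lsc X" "g \<in> lsc X" "f \<le> g" for f g
    using that by (intro lin(2) lsc_integral_map integral_map_preserves(1))
  show "?I (?m (\<lambda>x. a * f x)) = a * ?I (?m f)"
    if "f \<in> lsc X" "0 < a" "a < top" for f and a :: ennreal
    unfolding integral_map_preserves(3)[OF that] using that by (intro lin(3) lsc_integral_map)
  show "?I (?m (\<lambda>x. f x + g x))
      = ?I (?m f) + ?I (?m g)"
    if "f \<in> lsc X" "g \<in> lsc X" for f g
    unfolding integral_map_preserves(2)[OF that] using that by (intro lin(4) lsc_integral_map)
  show "?I (?m (Sup D)) = (SUP h\<in>D. ?I (?m h))"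
    if D: "D \<subseteq> lsc X" "directed_family D" "Sup D \<in> lsc X" for D
  proof -
    have sub: "?m ` D \<subseteq> lsc (V_space k X)" using D(1) lsc_integral_map by blast
    have "directed_family (?m ` D)"
      by (intro directed_family_image D(2) integral_map_preserves(1)) (use D(1) in auto)
    then have "?I (Sup (?m ` D))
        = (SUP h\<in>?m ` D. ?I h)"
      by (rule lin(5)[OF sub _ lsc_Sup[OF sub]])
    then show ?thesis
      by (simp only: integral_map_Sup[OF D(1,2)] image_image)
  qed
qed

text \<open>
  This makes the multiplication a special case of the representation of linear Scott-continuous
  functionals. It gives that the result is a valuation, and the exchange
  of integrals in \<open>val_integral_V_mult\<close>.
\<close>
lemma V_mult_eq_valuation_of:
  "V_mult k X \<Xi> = valuation_of X (\<lambda>h. val_integral (V_space k X) \<Xi> (integral_map k X h))"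
  unfolding V_mult_def valuation_of_def
proof (rule restrict_ext)
  fix U assume "U \<in> {U. openin X U}"
  then have U: "openin X U" by simp
  show "val_integral (V_space k X) \<Xi> (\<lambda>\<nu>. \<nu> U) = val_integral (V_space k X) \<Xi> (integral_map k X (indicator U))"
    unfolding integral_map_indicator[OF U] by (rule val_integral_eq_on_topspace) simp
qed

lemma continuous_valuation_V_mult:
  assumes "continuous_valuation (V_space k X) \<Xi>"
  shows "continuous_valuation X (V_mult k X \<Xi>)"
  unfolding V_mult_eq_valuation_of
  by (rule continuous_valuation_of[OF linear_scott_iterated_integral[OF assms]])

lemma val_integral_V_mult:
  assumes "continuous_valuation (V_space k X) \<Xi>" "h \<in> lsc X"
  shows "val_integral X (V_mult k X \<Xi>) h = val_integral (V_space k X) \<Xi> (integral_map k X h)"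
  unfolding V_mult_eq_valuation_of
  by (rule val_integral_valuation_of[OF linear_scott_iterated_integral[OF assms(1)] assms(2)])

lemma V_mult_in_V_space:
  assumes \<Xi>: "\<Xi> \<in> topspace (V_space k (V_space k X))"
  shows "V_mult k X \<Xi> \<in> topspace (V_space k X)"
proof -
  have cv: "continuous_valuation (V_space k X) \<Xi>" and kind: "has_kind k (V_space k X) \<Xi>"
    using \<Xi> by auto
  let ?one = "indicator (topspace (V_space k X)) :: _ \<Rightarrow> ennreal"
  have one: "val_integral (V_space k X) \<Xi> ?one = \<Xi> (topspace (V_space k X))"
    by (rule val_integral_indicator[OF cv openin_topspace])
  have mult: "V_mult k X \<Xi> (topspace X) = val_integral (V_space k X) \<Xi> (\<lambda>\<nu>. \<nu> (topspace X))"
    by (simp add: V_mult_def)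
  have "has_kind k X (V_mult k X \<Xi>)"
  proof (cases k)
    case Subprobability
    have "val_integral (V_space k X) \<Xi> (\<lambda>\<nu>. \<nu> (topspace X))
        = val_integral (V_space k X) \<Xi> (integral_map k X (indicator (topspace X)))"
      unfolding integral_map_indicator[OF openin_topspace] by (rule val_integral_eq_on_topspace) simp
    also have "\<dots> \<le> val_integral (V_space k X) \<Xi> ?one"
      by (intro val_integral_mono[OF cv] lsc_integral_map lsc_indicator openin_topspace)
        (auto simp: integral_map_indicator le_fun_def Subprobability)
    finally show ?thesis
      using kind unfolding mult[symmetric] one by (simp add: Subprobability)
  next
    case Probability
    have "val_integral (V_space k X) \<Xi> (\<lambda>\<nu>. \<nu> (topspace X)) = val_integral (V_space k X) \<Xi> ?one"
      by (rule val_integral_eq_on_topspace) (simp add: Probability)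
    then show ?thesis
      using kind unfolding mult[symmetric] one by (simp add: Probability)
  qed simp
  then show ?thesis using continuous_valuation_V_mult[OF cv] by simp
qed

text \<open>
  The lower integral of \<open>g\<close> is the minimum of the integrals of \<open>g\<close> over \<open>\<lambda>\<^sup>\<sharp> m\<close>: the ray of constraints
  through \<open>\<integral> g d\<nu> \<le> lower_integral X m g\<close> is satisfied by the lower integral itself.
\<close>
lemma lambda_sharp_integral_attained:
  assumes m: "m \<in> topspace (V_space k (Q_space X))" and g: "g \<in> lsc X"
  shows "\<exists>\<nu>\<in>lambda_sharp k X m. val_integral X \<nu> g \<le> lower_integral X m g"
proof -
  have cv: "continuous_valuation (Q_space X) m" using m by simp
  let ?q = "lower_integral X m g"
  define K where "K = {(\<lambda>x. a * g x, a * ?q) | a. a < top}"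
  have KI: "(\<lambda>x. a * g x, a * ?q) \<in> K" if "a < top" for a using that unfolding K_def by blast
  have "constraint_cone K"
    unfolding constraint_cone_def
  proof (intro conjI allI impI; (elim conjE)?)
    show "(\<lambda>_. 0, 0) \<in> K" using KI[of 0] by simp
  next
    fix e w e' w' assume "(e, w) \<in> K" "(e', w') \<in> K"
    then obtain a a' where a: "a < top" "e = (\<lambda>x. a * g x)" "w = a * ?q"
      "a' < top" "e' = (\<lambda>x. a' * g x)" "w' = a' * ?q"
      unfolding K_def by blast
    show "(\<lambda>x. e x + e' x, w + w') \<in> K"
      using KI[of "a + a'"] a by (simp add: distrib_right)
  next
    fix e w and b :: ennreal assume "(e, w) \<in> K" and b: "0 < b" "b < top"
    then obtain a where a: "a < top" "e = (\<lambda>x. a * g x)" "w = a * ?q"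
      unfolding K_def by blast
    show "(\<lambda>x. b * e x, b * w) \<in> K"
      using KI[of "b * a"] a b by (simp add: ennreal_mult_less_top mult.assoc)
  qed
  moreover have "e \<in> lsc X \<and> lower_integral X m e \<le> w" if "(e, w) \<in> K" for e w
  proof -
    obtain a where a: "a < top" "e = (\<lambda>x. a * g x)" "w = a * ?q"
      using \<open>(e, w) \<in> K\<close> unfolding K_def by blast
    note sup = superlinear_onD[OF superlinear_lower_integral[OF cv]]
    show ?thesis
    proof (cases "a = 0")
      case True
      then show ?thesis using a lsc_zero sup(1) by simp
    next
      case False
      then have "0 < a" by (simp add: zero_less_iff_neq_zero)
      then show ?thesis using a lsc_scale[OF g] sup(3)[OF g] by simp
    qed
  qed
  ultimately obtain \<nu> where "\<nu> \<in> lambda_sharp k X m" "\<forall>e w. (e, w) \<in> K \<longrightarrow> val_integral X \<nu> e \<le> w"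
    using exists_selection_with_constraints[OF m, of K] by blast
  then show ?thesis using KI[of 1] by (intro bexI[of _ \<nu>]) auto
qed

text \<open>
  From left to right, the bound required by \<open>exists_selection_below\<close> is
  \<open>\<integral> (min over \<rho> in \<lambda>\<^sup>\<sharp> m of \<integral> g d\<rho>) d\<xi>(m) \<le> \<integral> g d\<nu>\<close>. By \<open>lambda_sharp_integral_attained\<close> the minimum is at
  most the lower integral of \<open>g\<close> with respect to \<open>m\<close>; integrating over \<open>m\<close> gives the lower integral with
  respect to the multiplication applied to \<open>\<xi>\<close>, above which \<open>\<nu>\<close> lies.
\<close>
lemma lambda_sharp_V_mult:
  assumes \<xi>: "\<xi> \<in> topspace (V_space k (V_space k (Q_space X)))"
  shows "lambda_sharp k X (V_mult k (Q_space X) \<xi>)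
    = Q_map (V_space k X) (V_mult k X)
        (lambda_sharp k (V_space k X)
          (V_map (V_space k (Q_space X)) (Q_space (V_space k X)) (lambda_sharp k X) \<xi>))"
proof -
  let ?V = "V_space k X" and ?VQ = "V_space k (Q_space X)"
  let ?\<zeta> = "V_map ?VQ (Q_space ?V) (lambda_sharp k X) \<xi>"
  have \<xi>_cv: "continuous_valuation ?VQ \<xi>" using \<xi> by simp
  have \<zeta>: "?\<zeta> \<in> topspace (V_space k (Q_space ?V))"
    by (rule V_map_in_V_space[OF lambda_sharp_continuous \<xi>])
  then have \<zeta>_cv: "continuous_valuation (Q_space ?V) ?\<zeta>" by simp
  have m\<xi>_cv: "continuous_valuation (Q_space X) (V_mult k (Q_space X) \<xi>)"
    by (rule continuous_valuation_V_mult[OF \<xi>_cv])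
  show ?thesis
  proof (intro equalityI subsetI)
    fix \<nu> assume "\<nu> \<in> Q_map ?V (V_mult k X) (lambda_sharp k ?V ?\<zeta>)"
    then obtain \<Xi> where \<Xi>: "\<Xi> \<in> lambda_sharp k ?V ?\<zeta>"
      and le: "specialization_le ?V (V_mult k X \<Xi>) \<nu>"
      unfolding Q_map_def up_closure_def by blast
    have "V_mult k (Q_space X) \<xi> (Q_box X U) \<le> \<nu> U" if U: "openin X U" for U
    proof -
      have "V_mult k (Q_space X) \<xi> (Q_box X U) = val_integral ?VQ \<xi> (\<lambda>m. m (Q_box X U))"
        using openin_Q_box[OF U] by (simp add: V_mult_def)
      also have "\<dots> \<le> val_integral ?V \<Xi> (\<lambda>\<nu>. \<nu> U)"
      proof (rule val_integral_le)
        fix t :: real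
        let ?W = "{\<nu> \<in> topspace ?V. ennreal t < \<nu> U}"
        have W: "openin ?V ?W" by (rule openin_V_evaluation[OF U])
        have sub: "{m \<in> topspace ?VQ. ennreal t < m (Q_box X U)}
            \<subseteq> {m \<in> topspace ?VQ. lambda_sharp k X m \<in> Q_box ?V ?W}"
        proof
          fix m assume "m \<in> {m \<in> topspace ?VQ. ennreal t < m (Q_box X U)}"
          then have m: "m \<in> topspace ?VQ" "ennreal t < m (Q_box X U)" by blast+
          have "ennreal t < \<nu> U" if "\<nu> \<in> lambda_sharp k X m" for \<nu>
            using m(2) lambda_sharpD(3)[OF that U] by (rule order_less_le_trans)
          then have "lambda_sharp k X m \<subseteq> ?W" using lambda_sharpD(1) by blast
          then have "lambda_sharp k X m \<in> Q_box ?V ?W"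
            using lambda_sharp_in_Q_carrier[OF m(1)] unfolding Q_box_def by blast
          then show "m \<in> {m \<in> topspace ?VQ. lambda_sharp k X m \<in> Q_box ?V ?W}" using m(1) by blast
        qed
        have "\<xi> {m \<in> topspace ?VQ. ennreal t < m (Q_box X U)}
            \<le> \<xi> {m \<in> topspace ?VQ. lambda_sharp k X m \<in> Q_box ?V ?W}"
          by (intro continuous_valuationD(3)[OF \<xi>_cv _ _ sub] openin_V_evaluation openin_Q_box U
              continuous_map_preimage[OF lambda_sharp_continuous] W)
        also have "\<dots> = ?\<zeta> (Q_box ?V ?W)"
          by (rule V_map_apply[OF openin_Q_box[OF W], symmetric])
        also have "\<dots> \<le> \<Xi> ?W" by (rule lambda_sharpD(3)[OF \<Xi> W])
        finally show "\<xi> {m \<in> topspace ?VQ. ennreal t < m (Q_box X U)} \<le> \<Xi> ?W" .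
      qed
      also have "\<dots> = V_mult k X \<Xi> U" using U by (simp add: V_mult_def)
      also have "\<dots> \<le> \<nu> U" using le U unfolding specialization_V_iff by blast
      finally show ?thesis .
    qed
    then show "\<nu> \<in> lambda_sharp k X (V_mult k (Q_space X) \<xi>)"
      using le unfolding specialization_V_iff lambda_sharp_def by blast
  next
    fix \<nu> assume \<nu>: "\<nu> \<in> lambda_sharp k X (V_mult k (Q_space X) \<xi>)"
    note \<nu>_cv = lambda_sharpD(2)[OF \<nu>]
    let ?c = "integral_map k X"
    have "\<exists>\<Xi>\<in>lambda_sharp k ?V ?\<zeta>. \<forall>g\<in>lsc X. val_integral ?V \<Xi> (?c g) \<le> val_integral X \<nu> g"
    proof (rule exists_selection_below[OF \<zeta> \<nu>_cv])
      fix g assume g: "g \<in> lsc X"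
      show c: "?c g \<in> lsc ?V" by (rule lsc_integral_map[OF g])
      let ?d = "\<lambda>m. if m \<in> topspace ?VQ then min_on ?V (?c g) (lambda_sharp k X m) else 0"
      have "?d m \<le> integral_map k (Q_space X) (min_on X g) m" for m
      proof (cases "m \<in> topspace ?VQ")
        case True
        obtain \<nu>' where \<nu>': "\<nu>' \<in> lambda_sharp k X m" "val_integral X \<nu>' g \<le> lower_integral X m g"
          using lambda_sharp_integral_attained[OF True g] by blast
        have "min_on ?V (?c g) (lambda_sharp k X m) \<le> ?c g \<nu>'"
          using \<nu>'(1) lambda_sharp_in_Q_carrier[OF True] by (simp add: min_on_def INF_lower)
        also have "\<dots> \<le> lower_integral X m g"
          using \<nu>'(2) lambda_sharpD(1)[OF \<nu>'(1)] by (simp only: integral_map_def if_True)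
        finally show ?thesis using True by (simp only: integral_map_def if_True lower_integral_def)
      next
        case False
        then show ?thesis by (simp only: if_False zero_le)
      qed
      then have d: "?d \<le> integral_map k (Q_space X) (min_on X g)" by (rule le_funI)
      have "lower_integral ?V ?\<zeta> (?c g) = val_integral ?VQ \<xi> ?d"
        unfolding lower_integral_def by (rule val_integral_V_map[OF lambda_sharp_continuous min_on_lsc[OF c]])
      also have "\<dots> \<le> val_integral ?VQ \<xi> (integral_map k (Q_space X) (min_on X g))"
        by (intro val_integral_mono[OF \<xi>_cv _ _ d] lsc_compose[OF lambda_sharp_continuous] min_on_lsc
            lsc_integral_map g)
      also have "\<dots> = lower_integral X (V_mult k (Q_space X) \<xi>) g"
        unfolding lower_integral_def by (rule val_integral_V_mult[OF \<xi>_cv min_on_lsc[OF g], symmetric])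
      also have "\<dots> \<le> val_integral X \<nu> g"
        by (rule lower_integral_le[OF m\<xi>_cv g g]) (rule lambda_sharpD(3)[OF \<nu> lsc_openin[OF g]])
      finally show "lower_integral ?V ?\<zeta> (?c g) \<le> val_integral X \<nu> g" .
    qed (simp_all add: integral_map_preserves)
    then obtain \<Xi> where \<Xi>: "\<Xi> \<in> lambda_sharp k ?V ?\<zeta>"
      "\<And>g. g \<in> lsc X \<Longrightarrow> val_integral ?V \<Xi> (?c g) \<le> val_integral X \<nu> g"
      by auto
    have "V_mult k X \<Xi> U \<le> \<nu> U" if U: "openin X U" for U
    proof -
      have "val_integral ?V \<Xi> (?c (indicator U)) \<le> \<nu> U"
        using \<Xi>(2)[OF lsc_indicator[OF U]] val_integral_indicator[OF \<nu>_cv U] by simp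
      moreover have "V_mult k X \<Xi> U = val_integral ?V \<Xi> (?c (indicator U))"
        unfolding V_mult_eq_valuation_of using U by (simp add: valuation_of_def)
      ultimately show ?thesis by simp
    qed
    then have "specialization_le ?V (V_mult k X \<Xi>) \<nu>"
      unfolding specialization_V_iff
      using V_mult_in_V_space[OF lambda_sharpD(1)[OF \<Xi>(1)]] lambda_sharpD(1)[OF \<nu>] by blast
    then show "\<nu> \<in> Q_map ?V (V_mult k X) (lambda_sharp k ?V ?\<zeta>)"
      using \<Xi>(1) unfolding Q_map_def up_closure_def by blast
  qed
qed

theorem theorem4p13:
  fixes k :: valuation_kind
    and X :: "'a topology" and Y :: "'b topology"
  shows
    "continuous_map (V_space k (Q_space X)) (Q_space (V_space k X)) (lambda_sharp k X)
     \<and>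
     (\<forall>f. continuous_map X Y f \<longrightarrow>
        (\<forall>\<mu> \<in> topspace (V_space k (Q_space X)).
           lambda_sharp k Y (V_map (Q_space X) (Q_space Y) (Q_map Y f) \<mu>)
           = Q_map (V_space k Y) (V_map X Y f) (lambda_sharp k X \<mu>)))
     \<and>
     (\<forall>\<nu> \<in> topspace (V_space k X).
        lambda_sharp k X (V_map X (Q_space X) (Q_unit X) \<nu>)
        = Q_unit (V_space k X) \<nu>)
     \<and>
     (\<forall>\<mu> \<in> topspace (V_space k (Q_space (Q_space X))).
        lambda_sharp k X (V_map (Q_space (Q_space X)) (Q_space X) Q_mult \<mu>)
        = Q_mult (Q_map (Q_space (V_space k X)) (lambda_sharp k X)
                    (lambda_sharp k (Q_space X) \<mu>)))
     \<and>
     (\<forall>\<xi> \<in> topspace (V_space k (V_space k (Q_space X))).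
        lambda_sharp k X (V_mult k (Q_space X) \<xi>)
        = Q_map (V_space k X) (V_mult k X)
            (lambda_sharp k (V_space k X)
               (V_map (V_space k (Q_space X)) (Q_space (V_space k X)) (lambda_sharp k X) \<xi>)))"
  by (intro conjI allI ballI impI lambda_sharp_continuous lambda_sharp_natural lambda_sharp_unit
      lambda_sharp_Q_mult lambda_sharp_V_mult)

end
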